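(* Let $K$ be any field, let $\kappa$ be an ordinal with uncountable cofinality, and let $E_\kappa$ be the graph with vertices the ordinals less than $\kappa$ (defined in the context). Then the Leavitt path algebra $L_K(E_\kappa)$ is a prime, non-primitive, von Neumann regular ring. In particular, let $\{\kappa_\alpha\mid\alpha\in\mathcal{A}\}$ be a collection of uncountable ordinals, each of uncountable cofinality, and each having different cardinality. Then the collection $\{L_{\mathbb{C}}(E_{\kappa_\alpha})\mid\alpha\in\mathcal{A}\}$ consists of pairwise nonisomorphic, prime, non-primitive, von Neumann regular $\mathbb{C}$-algebras.
   Context: A (directed) graph $E=(E^0,E^1,r,s)$ consists of sets $E^0$ (vertices), $E^1$ (edges), of arbitrary cardinality, and functions $r,s:E^1\to E^0$ (range and source). For an ordinal $\kappa$, the graph $E_\kappa$ has vertex set $\{\alpha\mid\alpha<\kappa\}$ and edge set $\{e_{\alpha,\beta}\mid\alpha,\beta<\kappa,\ \alpha<\beta\}$, with $s(e_{\alpha,\beta})=\alpha$ and $r(e_{\alpha,\beta})=\beta$. An ordinal $\kappa$ has countable cofinality if there is an at most countable set $C$ of ordinals strictly less than $\kappa$ such that every $\alpha<\kappa$ satisfies $\alpha\le\beta$ for some $\beta\in C$ (so in particular every countable ordinal and every successor ordinal has countable cofinality); otherwise $\kappa$ has uncountable cofinality. The Leavitt path algebra $L_K(E)$ is the (associative, not necessarily unital) $K$-algebra generated by the set $\{v\mid v\in E^0\}\cup\{e,e^*\mid e\in E^1\}$ subject to the relations: (V) $vw=\delta_{v,w}v$ for $v,w\in E^0$; (E1) $s(e)e=er(e)=e$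 for $e\in E^1$; (E2) $r(e)e^*=e^*s(e)=e^*$ for $e\in E^1$; (CK1) $e^*e'=\delta_{e,e'}r(e)$ for $e,e'\in E^1$; (CK2) $v=\sum_{\{e\in E^1\mid s(e)=v\}}ee^*$ for every vertex $v$ with $1\le|s^{-1}(v)|<\infty$. A ring $R$ (possibly nonunital) is prime if the product of any two nonzero two-sided ideals is nonzero; left primitive if it admits a simple faithful left $R$-module; von Neumann regular if for each $a\in R$ there is $x\in R$ with $a=axa$. Since $L_K(E)\cong L_K(E)^{op}$, left and right primitivity coincide for $L_K(E)$, and one simply says primitive. *)

theory Defs
  imports
    "HOL-Algebra.Algebra"
    "HOL-Library.Poly_Mapping"
    "HOL-Library.Countable_Set"
    "HOL-Library.Equipollence"
    "Graph_Theory.Digraph"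
begin

section \<open>Rings and algebras without unit\<close>

text \<open>
  The ring records of HOL-Algebra are reused for rings that need not have a unit; the field
  \<^const>\<open>one\<close> is then never looked at. Likewise a left module or an algebra is a
  \<^type>\<open>module_ext\<close> record in which only the relevant fields are used.
\<close>

locale nonunital_ring = abelian_group R for R (structure) +
  assumes m_closed: "\<lbrakk>x \<in> carrier R; y \<in> carrier R\<rbrakk> \<Longrightarrow> x \<otimes> y \<in> carrier R"
    and m_assoc: "\<lbrakk>x \<in> carrier R; y \<in> carrier R; z \<in> carrier R\<rbrakk>
      \<Longrightarrow> (x \<otimes> y) \<otimes> z = x \<otimes> (y \<otimes> z)"
    and l_distr: "\<lbrakk>x \<in> carrier R; y \<in> carrier R; z \<in> carrier R\<rbrakk>
      \<Longrightarrow> (x \<oplus> y) \<otimes> z = x \<otimes> z \<oplus> y \<otimes> z"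
    and r_distr: "\<lbrakk>x \<in> carrier R; y \<in> carrier R; z \<in> carrier R\<rbrakk>
      \<Longrightarrow> z \<otimes> (x \<oplus> y) = z \<otimes> x \<oplus> z \<otimes> y"

text \<open>The ground field is the whole type \<open>'k\<close>.\<close>

locale nonunital_algebra = nonunital_ring A
  for A :: "('k::field, 'a) module" (structure) +
  assumes smult_closed: "x \<in> carrier A \<Longrightarrow> c \<odot> x \<in> carrier A"
    and smult_l_distr: "x \<in> carrier A \<Longrightarrow> (c + d) \<odot> x = c \<odot> x \<oplus> d \<odot> x"
    and smult_r_distr: "\<lbrakk>x \<in> carrier A; y \<in> carrier A\<rbrakk>
      \<Longrightarrow> c \<odot> (x \<oplus> y) = c \<odot> x \<oplus> c \<odot> y"
    and smult_assoc: "x \<in> carrier A \<Longrightarrow> (c * d) \<odot> x = c \<odot> (d \<odot> x)"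
    and smult_one: "x \<in> carrier A \<Longrightarrow> 1 \<odot> x = x"
    and smult_mult_left: "\<lbrakk>x \<in> carrier A; y \<in> carrier A\<rbrakk>
      \<Longrightarrow> (c \<odot> x) \<otimes> y = c \<odot> (x \<otimes> y)"
    and smult_mult_right: "\<lbrakk>x \<in> carrier A; y \<in> carrier A\<rbrakk>
      \<Longrightarrow> x \<otimes> (c \<odot> y) = c \<odot> (x \<otimes> y)"

definition two_sided_ideal :: "'a set \<Rightarrow> ('a, 'x) ring_scheme \<Rightarrow> bool" where
  "two_sided_ideal I R \<longleftrightarrow> additive_subgroup I R \<and>
     (\<forall>a\<in>I. \<forall>x\<in>carrier R. x \<otimes>\<^bsub>R\<^esub> a \<in> I \<and> a \<otimes>\<^bsub>R\<^esub> x \<in> I)"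

definition algebra_ideal :: "'a set \<Rightarrow> ('k::field, 'a) module \<Rightarrow> bool" where
  "algebra_ideal I A \<longleftrightarrow> two_sided_ideal I A \<and> (\<forall>c. \<forall>a\<in>I. c \<odot>\<^bsub>A\<^esub> a \<in> I)"

definition gen_algebra_ideal :: "('k::field, 'a) module \<Rightarrow> 'a set \<Rightarrow> 'a set" where
  "gen_algebra_ideal A S = \<Inter>{I. algebra_ideal I A \<and> S \<subseteq> I}"

text \<open>
  The ring structure on cosets is that of \<^const>\<open>FactRing\<close>, which makes sense without a unit.
\<close>

definition quotient_algebra ::
    "('k::field, 'a) module \<Rightarrow> 'a set \<Rightarrow> ('k, 'a set) module" where
  "quotient_algebra A I =
     ring.extend (A Quot I)
       (module.fields (\<lambda>c S. \<Union>x\<in>S. I +>\<^bsub>A\<^esub> (c \<odot>\<^bsub>A\<^esub> x)))"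

definition algebra_iso ::
    "('k::field, 'a) module \<Rightarrow> ('k, 'b) module \<Rightarrow> ('a \<Rightarrow> 'b) set" where
  "algebra_iso A B = {h. bij_betw h (carrier A) (carrier B) \<and>
     (\<forall>x\<in>carrier A. \<forall>y\<in>carrier A. h (x \<oplus>\<^bsub>A\<^esub> y) = h x \<oplus>\<^bsub>B\<^esub> h y) \<and>
     (\<forall>x\<in>carrier A. \<forall>y\<in>carrier A. h (x \<otimes>\<^bsub>A\<^esub> y) = h x \<otimes>\<^bsub>B\<^esub> h y) \<and>
     (\<forall>c. \<forall>x\<in>carrier A. h (c \<odot>\<^bsub>A\<^esub> x) = c \<odot>\<^bsub>B\<^esub> h x)}"

definition algebra_isomorphic ::
    "('k::field, 'a) module \<Rightarrow> ('k, 'b) module \<Rightarrow> bool" where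
  "algebra_isomorphic A B \<longleftrightarrow> algebra_iso A B \<noteq> {}"


section \<open>Prime, primitive and von Neumann regular rings\<close>

definition prime_ring :: "('a, 'x) ring_scheme \<Rightarrow> bool" where
  "prime_ring R \<longleftrightarrow> nonunital_ring R \<and>
     (\<forall>I J. two_sided_ideal I R \<longrightarrow> two_sided_ideal J R \<longrightarrow>
        I \<noteq> {\<zero>\<^bsub>R\<^esub>} \<longrightarrow> J \<noteq> {\<zero>\<^bsub>R\<^esub>} \<longrightarrow> I \<cdot>\<^bsub>R\<^esub> J \<noteq> {\<zero>\<^bsub>R\<^esub>})"

definition von_neumann_regular_ring :: "('a, 'x) ring_scheme \<Rightarrow> bool" where
  "von_neumann_regular_ring R \<longleftrightarrow> nonunital_ring R \<and>
     (\<forall>a\<in>carrier R. \<exists>x\<in>carrier R. a = a \<otimes>\<^bsub>R\<^esub> x \<otimes>\<^bsub>R\<^esub> a)"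

locale left_module = R?: nonunital_ring R + M?: abelian_group M
  for R :: "('a, 'x) ring_scheme" (structure) and M :: "('a, 'm) module" (structure) +
  assumes act_closed: "\<lbrakk>a \<in> carrier R; m \<in> carrier M\<rbrakk> \<Longrightarrow> a \<odot>\<^bsub>M\<^esub> m \<in> carrier M"
    and act_l_distr: "\<lbrakk>a \<in> carrier R; b \<in> carrier R; m \<in> carrier M\<rbrakk>
      \<Longrightarrow> (a \<oplus>\<^bsub>R\<^esub> b) \<odot>\<^bsub>M\<^esub> m = a \<odot>\<^bsub>M\<^esub> m \<oplus>\<^bsub>M\<^esub> b \<odot>\<^bsub>M\<^esub> m"
    and act_r_distr: "\<lbrakk>a \<in> carrier R; m \<in> carrier M; n \<in> carrier M\<rbrakk>
      \<Longrightarrow> a \<odot>\<^bsub>M\<^esub> (m \<oplus>\<^bsub>M\<^esub> n) = a \<odot>\<^bsub>M\<^esub> m \<oplus>\<^bsub>M\<^esub> a \<odot>\<^bsub>M\<^esub> n"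
    and act_assoc: "\<lbrakk>a \<in> carrier R; b \<in> carrier R; m \<in> carrier M\<rbrakk>
      \<Longrightarrow> (a \<otimes>\<^bsub>R\<^esub> b) \<odot>\<^bsub>M\<^esub> m = a \<odot>\<^bsub>M\<^esub> (b \<odot>\<^bsub>M\<^esub> m)"

definition left_submodule ::
    "'m set \<Rightarrow> ('a, 'x) ring_scheme \<Rightarrow> ('a, 'm) module \<Rightarrow> bool" where
  "left_submodule N R M \<longleftrightarrow>
     additive_subgroup N M \<and> (\<forall>a\<in>carrier R. \<forall>n\<in>N. a \<odot>\<^bsub>M\<^esub> n \<in> N)"

text \<open>
  As usual over a ring without unit, simplicity of \<open>M\<close> includes \<open>RM \<noteq> 0\<close>.
\<close>

definition simple_left_module ::
    "('a, 'x) ring_scheme \<Rightarrow> ('a, 'm) module \<Rightarrow> bool" where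
  "simple_left_module R M \<longleftrightarrow> left_module R M \<and>
     (\<exists>a\<in>carrier R. \<exists>m\<in>carrier M. a \<odot>\<^bsub>M\<^esub> m \<noteq> \<zero>\<^bsub>M\<^esub>) \<and>
     (\<forall>N. left_submodule N R M \<longrightarrow> N = {\<zero>\<^bsub>M\<^esub>} \<or> N = carrier M)"

definition faithful_left_module ::
    "('a, 'x) ring_scheme \<Rightarrow> ('a, 'm) module \<Rightarrow> bool" where
  "faithful_left_module R M \<longleftrightarrow> left_module R M \<and>
     (\<forall>a\<in>carrier R. (\<forall>m\<in>carrier M. a \<odot>\<^bsub>M\<^esub> m = \<zero>\<^bsub>M\<^esub>) \<longrightarrow> a = \<zero>\<^bsub>R\<^esub>)"

text \<open>
  HOL cannot quantify over types inside a formula, so the type in which the module lives is a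
  parameter. A theorem denying this predicate for a type variable \<open>'m\<close> denies the existence of
  a simple faithful left module on any type whatsoever.
\<close>

definition left_primitive_ring :: "'m itself \<Rightarrow> ('a, 'x) ring_scheme \<Rightarrow> bool" where
  "left_primitive_ring _ R \<longleftrightarrow> nonunital_ring R \<and>
     (\<exists>M :: ('a, 'm) module. simple_left_module R M \<and> faithful_left_module R M)"


section \<open>Leavitt path algebras\<close>

text \<open>
  Words form a monoid under concatenation, so that \<open>'g list \<Rightarrow>\<^sub>0 'k\<close> is the ring of
  noncommutative polynomials in \<open>'g\<close>. Its elements without constant term form the free
  nonunital algebra.
\<close>

instantiation list :: (type) monoid_add
begin

definition zero_list :: "'a list" where "zero_list = []"

definition plus_list :: "'a list \<Rightarrow> 'a list \<Rightarrow> 'a list" where "plus_list xs ys = xs @ ys"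

instance
  by standard (simp_all add: zero_list_def plus_list_def)

end

definition free_nonunital_algebra ::
    "'g set \<Rightarrow> ('k::field, 'g list \<Rightarrow>\<^sub>0 'k) module" where
  "free_nonunital_algebra S =
     \<lparr>carrier = {f. \<forall>w\<in>Poly_Mapping.keys f. w \<noteq> [] \<and> set w \<subseteq> S},
      monoid.mult = (*), monoid.one = 1, ring.zero = 0, ring.add = (+),
      smult = (\<lambda>c. Poly_Mapping.map (\<lambda>a. c * a))\<rparr>"

text \<open>
  A graph is a digraph record of the graph library: \<^const>\<open>tail\<close> is the source map and
  \<^const>\<open>head\<close> the range map. \<open>Ghost e\<close> is the generator \<open>e\<^sup>*\<close>.
\<close>

datatype ('v, 'e) lpa_gen = Vert 'v | Edge 'e | Ghost 'e

definition lpa_gens :: "('v, 'e) pre_digraph \<Rightarrow> ('v, 'e) lpa_gen set" where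
  "lpa_gens G = Vert ` verts G \<union> Edge ` arcs G \<union> Ghost ` arcs G"

definition gen :: "'g \<Rightarrow> 'g list \<Rightarrow>\<^sub>0 'k::field" where
  "gen x = Poly_Mapping.single [x] 1"

definition lpa_relators ::
    "('v, 'e) pre_digraph \<Rightarrow> (('v, 'e) lpa_gen list \<Rightarrow>\<^sub>0 'k::field) set" where
  "lpa_relators G =
     (\<comment> \<open>(V)\<close>
      {gen (Vert v) * gen (Vert w) - (if v = w then gen (Vert v) else 0) | v w.
         v \<in> verts G \<and> w \<in> verts G}) \<union>
     (\<comment> \<open>(E1)\<close>
      {gen (Vert (tail G e)) * gen (Edge e) - gen (Edge e) | e. e \<in> arcs G} \<union>
      {gen (Edge e) * gen (Vert (head G e)) - gen (Edge e) | e. e \<in> arcs G}) \<union>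
     (\<comment> \<open>(E2)\<close>
      {gen (Vert (head G e)) * gen (Ghost e) - gen (Ghost e) | e. e \<in> arcs G} \<union>
      {gen (Ghost e) * gen (Vert (tail G e)) - gen (Ghost e) | e. e \<in> arcs G}) \<union>
     (\<comment> \<open>(CK1)\<close>
      {gen (Ghost e) * gen (Edge f) - (if e = f then gen (Vert (head G e)) else 0) | e f.
         e \<in> arcs G \<and> f \<in> arcs G}) \<union>
     (\<comment> \<open>(CK2)\<close>
      {gen (Vert v) - (\<Sum>e\<in>out_arcs G v. gen (Edge e) * gen (Ghost e)) | v.
         v \<in> verts G \<and> finite (out_arcs G v) \<and> out_arcs G v \<noteq> {}})"

definition leavitt_path_algebra ::
    "'k::field itself \<Rightarrow> ('v, 'e) pre_digraph \<Rightarrow>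
     ('k, (('v, 'e) lpa_gen list \<Rightarrow>\<^sub>0 'k) set) module" where
  "leavitt_path_algebra _ G =
     (let F = free_nonunital_algebra (lpa_gens G)
      in quotient_algebra F (gen_algebra_ideal F (lpa_relators G)))"


section \<open>Ordinals and their graphs\<close>

text \<open>
  An ordinal is given by a (reflexive) well-order relation \<open>\<kappa>\<close>; the elements of
  \<^term>\<open>Field \<kappa>\<close> play the role of the ordinals \<open>\<alpha> < \<kappa>\<close>, and
  \<open>(\<alpha>, \<beta>) \<in> \<kappa>\<close> means \<open>\<alpha> \<le> \<beta>\<close>. The edge
  \<open>e\<^bsub>\<alpha>,\<beta>\<^esub>\<close> is the pair \<open>(\<alpha>, \<beta>)\<close>.
\<close>

definition ordinal_digraph :: "'o rel \<Rightarrow> ('o, 'o \<times> 'o) pre_digraph" where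
  "ordinal_digraph \<kappa> =
     \<lparr>verts = Field \<kappa>, arcs = {(\<alpha>, \<beta>). (\<alpha>, \<beta>) \<in> \<kappa> \<and> \<alpha> \<noteq> \<beta>},
      tail = fst, head = snd\<rparr>"

definition countable_cofinality :: "'o rel \<Rightarrow> bool" where
  "countable_cofinality \<kappa> \<longleftrightarrow>
     (\<exists>C. countable C \<and> C \<subseteq> Field \<kappa> \<and> (\<forall>\<alpha>\<in>Field \<kappa>. \<exists>\<beta>\<in>C. (\<alpha>, \<beta>) \<in> \<kappa>))"

abbreviation uncountable_cofinality :: "'o rel \<Rightarrow> bool" where
  "uncountable_cofinality \<kappa> \<equiv> \<not> countable_cofinality \<kappa>"

end

theory Submission
  imports Defs "HOL-Library.Sublist"
begin

text \<open>
  Every countable set of ordinals below \<open>\<kappa>\<close> has a strict upper bound below \<open>\<kappa>\<close>. In particular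
  \<open>\<kappa>\<close> is a limit, every vertex of the graph emits infinitely many edges, and relation (CK2) is
  vacuous. A path is then just a nonempty strictly increasing list \<open>i\<close> of elements of
  \<^term>\<open>Field \<kappa>\<close>, and the Leavitt path algebra is spanned by the elements \<open>i j\<^sup>*\<close> for
  paths \<open>i\<close>, \<open>j\<close> with the same last vertex.

  The whole argument takes place in a faithful representation. On the space of all functions
  \<open>'o list \<Rightarrow> 'k\<close> let \<open>i j\<^sup>*\<close> act as the operator \<open>shift i j\<close> that replaces the prefix
  \<open>j\<close> by the prefix \<open>i\<close>. Reducing words to the normal form \<open>i j\<^sup>*\<close> modulo the defining ideal
  (\<open>reducible_word\<close>) and observing that the operators \<open>shift i j\<close> are linearly independent
  (\<open>shift_combination_zero\<close>) identifies the Leavitt path algebra with their span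
  \<open>path_algebra\<close> (\<open>LPA_representation\<close>).

  Regularity. For a finite set \<open>U\<close> of vertices the paths inside \<open>U\<close> give a finite-dimensional
  subalgebra spanned by matrix units: \<open>path_unit U i j\<close> is \<open>shift i j\<close> restricted to those
  lists that do not continue inside \<open>U\<close> after the prefix \<open>j\<close>. An element of an algebra of
  matrices is regular by Gaussian elimination: if \<open>a - a y a\<close> is regular then so is \<open>a\<close>, and a
  suitable multiple \<open>y\<close> of one matrix unit clears one row.

  Primeness. Cutting a nonzero element down to one matrix entry and then passing to a vertex
  \<open>w\<close> outside \<open>U\<close> shows that the ideal generated by a nonzero element contains all vertices above
  some bound (\<open>compress_to_vertex\<close>), so two nonzero ideals have a common vertex.

  Non-primitivity. Let \<open>m\<close> be a nonzero element of a simple faithful module and \<open>N\<close> its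
  annihilator. For each vertex \<open>v\<close> the ideal spanned by the \<open>i j\<^sup>*\<close> with last vertex at least
  \<open>v\<close> contains some \<open>r\<close> with \<open>r m = m\<close>. Let \<open>B\<close> be the set of paths \<open>\<beta>\<close> with
  \<open>\<beta>\<^sup>* m \<noteq> 0\<close>. As \<open>r m \<noteq> 0\<close>, one of the paths \<open>j\<close> in the terms of \<open>r\<close> lies in \<open>B\<close>; as
  \<open>\<beta>\<^sup>* r m = \<beta>\<^sup>* m \<noteq> 0\<close>, every \<open>\<beta>\<close> in \<open>B\<close> is comparable, in the prefix order, with one
  of the finitely many paths \<open>i\<close> in the terms of \<open>r\<close>. All these paths end at or above \<open>v\<close>.
  Iterate along \<open>\<omega>\<close>, taking \<open>v\<^bsub>n+1\<^esub>\<close> above the ends of the paths \<open>i\<close> for \<open>v\<^bsub>n\<^esub>\<close>. The sequence \<open>v\<^bsub>n\<^esub>\<close> is bounded, and a member of \<open>B\<close> ending at or above its bound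
  has one of the paths for \<open>v\<^bsub>n\<^esub>\<close> as a prefix, for every \<open>n\<close>. These prefixes are distinct,
  since the one for \<open>n\<close> ends at or above \<open>v\<^bsub>n\<^esub>\<close> and below \<open>v\<^bsub>n+1\<^esub>\<close>, but
  a list has only finitely many prefixes (\<open>path_algebra_not_primitive\<close>).

  Non-isomorphism. The vertices are orthogonal idempotents, so their images under an isomorphism
  are linearly independent; each of these lies in one of the finite-dimensional subalgebras given by
  finite sets of vertices of the other graph, and an infinite set has as many finite subsets as
  elements (\<open>path_algebra_dimension\<close>).
\<close>

section \<open>Linear operators on a space of functions\<close>

text \<open>
  The linear operators on the space of functions \<open>'p \<Rightarrow> 'k\<close>, as a type in the class
  \<^class>\<open>ring_1\<close>.
\<close>

typedef (overloaded) ('p, 'k) lin_op =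
  "{T :: ('p \<Rightarrow> 'k::field) \<Rightarrow> 'p \<Rightarrow> 'k.
     (\<forall>f g. T (\<lambda>x. f x + g x) = (\<lambda>x. T f x + T g x)) \<and> (\<forall>c f. T (\<lambda>x. c * f x) = (\<lambda>x. c * T f x))}"
  morphisms app Lin_op
  by (rule exI[of _ id]) simp

setup_lifting type_definition_lin_op

instantiation lin_op :: (type, field) ring_1
begin

lift_definition zero_lin_op :: "('a, 'b) lin_op" is "\<lambda>f x. 0" by simp
lift_definition one_lin_op :: "('a, 'b) lin_op" is "\<lambda>f. f" by simp
lift_definition plus_lin_op :: "('a, 'b) lin_op \<Rightarrow> ('a, 'b) lin_op \<Rightarrow> ('a, 'b) lin_op"
  is "\<lambda>S T f x. S f x + T f x" by (auto simp: algebra_simps)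
lift_definition uminus_lin_op :: "('a, 'b) lin_op \<Rightarrow> ('a, 'b) lin_op"
  is "\<lambda>T f x. - T f x" by (auto simp: algebra_simps)
lift_definition minus_lin_op :: "('a, 'b) lin_op \<Rightarrow> ('a, 'b) lin_op \<Rightarrow> ('a, 'b) lin_op"
  is "\<lambda>S T f x. S f x - T f x" by (auto simp: algebra_simps)
lift_definition times_lin_op :: "('a, 'b) lin_op \<Rightarrow> ('a, 'b) lin_op \<Rightarrow> ('a, 'b) lin_op"
  is "\<lambda>S T f. S (T f)" by simp

instance
proof
  show "(0::('a,'b) lin_op) \<noteq> 1"
  proof
    assume "(0::('a,'b) lin_op) = 1"
    then have "app (0::('a,'b) lin_op) (\<lambda>_. 1) undefined = app 1 (\<lambda>_. 1) undefined" by simp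
    then show False by (simp add: zero_lin_op.rep_eq one_lin_op.rep_eq)
  qed
qed (transfer; force simp: algebra_simps)+

end

lift_definition op_scale :: "'k::field \<Rightarrow> ('p, 'k) lin_op \<Rightarrow> ('p, 'k) lin_op"
  is "\<lambda>c T f x. c * T f x" by (auto simp: algebra_simps)

global_interpretation op: vector_space op_scale
  by standard (transfer; simp add: algebra_simps)+

lemma op_scale_mult_left: "op_scale c S * T = op_scale c (S * T)"
  by transfer simp

lemma op_scale_mult_right: "S * op_scale c T = op_scale c (S * T)"
  by transfer simp

lemma lin_op_eqI: "(\<And>f x. app S f x = app T f x) \<Longrightarrow> S = T"
  by transfer blast

lemma app_sum: "app (sum T A) f x = (\<Sum>a\<in>A. app (T a) f x)"
  by (induction A rule: infinite_finite_induct) (auto simp: zero_lin_op.rep_eq plus_lin_op.rep_eq)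

lemmas app_simps = zero_lin_op.rep_eq one_lin_op.rep_eq plus_lin_op.rep_eq uminus_lin_op.rep_eq
  minus_lin_op.rep_eq times_lin_op.rep_eq op_scale.rep_eq app_sum

lemma span_mult:
  assumes "\<And>a b. a \<in> A \<Longrightarrow> b \<in> B \<Longrightarrow> a * b \<in> op.span C"
    and "S \<in> op.span A" and "T \<in> op.span B"
  shows "S * T \<in> op.span C"
proof -
  have *: "a * T \<in> op.span C" if "a \<in> A" for a
    using assms(3)
  proof (induction rule: op.span_induct_alt)
    case base then show ?case by (simp add: op.span_zero)
  next
    case (step c x y)
    then show ?case using assms(1)[OF that step(1)]
      by (simp add: distrib_left op_scale_mult_right op.span_add op.span_scale)
  qed
  show ?thesis
    using assms(2)
  proof (induction rule: op.span_induct_alt)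
    case base then show ?case by (simp add: op.span_zero)
  next
    case (step c x y)
    then show ?case using *[OF step(1)]
      by (simp add: distrib_right op_scale_mult_left op.span_add op.span_scale)
  qed
qed

section \<open>Prefix replacement operators\<close>

text \<open>
  The operator \<open>shift i j\<close> sends the point mass at \<open>j @ z\<close> to the point mass at \<open>i @ z\<close> and
  annihilates the point masses at lists without the prefix \<open>j\<close>; in the definition this is expressed
  by precomposition. The lists need not be paths.
\<close>

lift_definition shift :: "'a list \<Rightarrow> 'a list \<Rightarrow> ('a list, 'k::field) lin_op"
  is "\<lambda>i j f x. if prefix i x then f (j @ drop (length i) x) else 0"
  by (auto simp: fun_eq_iff)

lemma shift_mult_append: "shift i j * shift (j @ m) l = shift (i @ m) l"
  by (rule lin_op_eqI) (auto simp: shift.rep_eq times_lin_op.rep_eq prefix_def)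

lemma shift_append_mult: "shift i (k @ m) * shift k l = shift i (l @ m)"
  by (rule lin_op_eqI) (auto simp: shift.rep_eq times_lin_op.rep_eq prefix_def)

lemma shift_mult_same [simp]: "shift i j * shift j l = shift i l"
  using shift_mult_append[of i j "[]" l] by simp

lemma shift_mult_zero:
  assumes "\<not> prefix j k" "\<not> prefix k j" shows "shift i j * shift k l = 0"
proof (rule lin_op_eqI)
  fix f x
  have "\<not> prefix k (j @ z)" for z
    using assms prefix_same_cases[of k "j @ z" j] by auto
  then show "app (shift i j * shift k l) f x = app 0 f x"
    by (auto simp: shift.rep_eq app_simps)
qed

lemma shift_nonzero: "shift i j \<noteq> 0"
proof
  assume "shift i j = (0 :: ('a list, 'k::field) lin_op)"
  then have "app (shift i j) (\<lambda>_. 1::'k) i = app 0 (\<lambda>_. 1) i" by simp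
  then show False by (simp add: shift.rep_eq app_simps)
qed

lemma shift_app_delta:
  assumes "app (shift k l) (\<lambda>x. if x = j then 1 else 0 :: 'k::field) i \<noteq> 0"
  shows "\<exists>z. i = k @ z \<and> j = l @ z"
  using assms by (auto simp: shift.rep_eq prefix_def split: if_splits)

text \<open>
  Linear independence: let \<open>j\<close> be a shortest second list that occurs with a nonzero coefficient.
  On the point mass at \<open>j\<close> a term \<open>shift k l\<close> vanishes unless \<open>l\<close> is a prefix of \<open>j\<close>,
  and then \<open>l = j\<close>, so that the result is a combination of distinct point masses.
\<close>

lemma shift_combination_zero:
  assumes fin: "finite P"
    and zero: "(\<Sum>(i, j)\<in>P. op_scale (c i j) (shift i j)) = (0 :: ('a list, 'k::field) lin_op)"
    and mem: "(i, j) \<in> P"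
  shows "c i j = 0"
proof (rule ccontr)
  assume "c i j \<noteq> 0"
  define Q where "Q = {(i, j) \<in> P. c i j \<noteq> 0}"
  have "(i, j) \<in> Q" using mem \<open>c i j \<noteq> 0\<close> by (simp add: Q_def)
  then obtain q where q: "q \<in> Q" "\<And>r. r \<in> Q \<Longrightarrow> length (snd q) \<le> length (snd r)"
    using arg_min_natI[of "\<lambda>q. q \<in> Q" "(i,j)" "\<lambda>q. length (snd q)"]
      arg_min_nat_le[of "\<lambda>q. q \<in> Q" _ "\<lambda>q. length (snd q)"] by metis
  obtain i0 j0 where ij: "q = (i0, j0)" by force
  have P0: "(i0, j0) \<in> P" "c i0 j0 \<noteq> 0" using q(1) by (auto simp: Q_def ij)
  define d where "d = (\<lambda>x. if x = j0 then 1 else 0 :: 'k)"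
  have other: "c k l * app (shift k l) d i0 = 0" if "(k, l) \<in> P" "(k, l) \<noteq> (i0, j0)" for k l
  proof (rule ccontr)
    assume *: "c k l * app (shift k l) d i0 \<noteq> 0"
    then obtain z where z: "i0 = k @ z" "j0 = l @ z"
      using shift_app_delta[of k l j0 i0] by (auto simp: d_def)
    have "(k, l) \<in> Q" using that * by (auto simp: Q_def)
    then have "length j0 \<le> length l" using q(2)[of "(k,l)"] by (simp add: ij)
    then show False using z that by auto
  qed
  have "0 = app (\<Sum>(i, j)\<in>P. op_scale (c i j) (shift i j)) d i0"
    using zero by (simp add: app_simps)
  also have "\<dots> = (\<Sum>(k, l)\<in>P. c k l * app (shift k l) d i0)"
    by (auto simp: app_simps case_prod_beta)
  also have "\<dots> = (\<Sum>p\<in>{(i0, j0)}. c (fst p) (snd p) * app (shift (fst p) (snd p)) d i0)"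
    unfolding case_prod_beta
  proof (intro sum.mono_neutral_right ballI)
    show "c (fst p) (snd p) * app (shift (fst p) (snd p)) d i0 = 0" if "p \<in> P - {(i0, j0)}" for p
      using other[of "fst p" "snd p"] that by (cases p) simp
  qed (use P0 fin in auto)
  also have "\<dots> = c i0 j0"
    by (simp add: shift.rep_eq d_def)
  finally show False using P0 by simp
qed

section \<open>Von Neumann regularity of matrix algebras\<close>

text \<open>McCoy's lemma: regularity of \<open>a - a y a\<close> implies regularity of \<open>a\<close>.\<close>

lemma regular_lift:
  fixes a :: "'r::ring"
  assumes "a - a * y * a = (a - a * y * a) * z * (a - a * y * a)"
  shows "a = a * (y + z - y * a * z - z * a * y + y * a * z * a * y) * a"
proof -
  have "a = a * y * a + (a - a * y * a)" by simp
  also have "\<dots> = a * y * a + (a - a * y * a) * z * (a - a * y * a)" using assms by simp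
  also have "\<dots> = a * (y + z - y * a * z - z * a * y + y * a * z * a * y) * a"
    by (simp add: algebra_simps)
  finally show ?thesis .
qed

text \<open>
  Elements \<open>E i j\<close>, for indices \<open>i\<close>, \<open>j\<close> in the same class of the relation \<open>r\<close>,
  that multiply like matrix units. They span a homomorphic image of a finite product of matrix
  algebras, one factor for each class. For indices in different classes \<open>E i j\<close> has no meaning.
\<close>

locale matrix_units =
  fixes P :: "'i set" and r :: "'i \<Rightarrow> 'i \<Rightarrow> bool" and E :: "'i \<Rightarrow> 'i \<Rightarrow> ('p, 'k::field) lin_op"
  assumes finite_index: "finite P"
    and r_sym: "r i j \<Longrightarrow> r j i" and r_trans: "r i j \<Longrightarrow> r j k \<Longrightarrow> r i k"
    and unit_mult: "\<lbrakk>i \<in> P; j \<in> P; k \<in> P; l \<in> P; r i j; r k l\<rbrakk>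
      \<Longrightarrow> E i j * E k l = (if j = k then E i l else 0)"
begin

definition matrix_algebra :: "('p, 'k) lin_op set" where
  "matrix_algebra = op.span {E i j | i j. i \<in> P \<and> j \<in> P \<and> r i j}"

text \<open>Matrices supported on the pairs of indices in the same class.\<close>

definition coefficients :: "('i \<Rightarrow> 'i \<Rightarrow> 'k) \<Rightarrow> bool" where
  "coefficients c \<longleftrightarrow> (\<forall>i j. c i j \<noteq> 0 \<longrightarrow> i \<in> P \<and> j \<in> P \<and> r i j)"

definition of_matrix :: "('i \<Rightarrow> 'i \<Rightarrow> 'k) \<Rightarrow> ('p, 'k) lin_op" where
  "of_matrix c = (\<Sum>i\<in>P. \<Sum>j\<in>P. op_scale (c i j) (E i j))"

lemma unit_in_matrix_algebra: "\<lbrakk>i \<in> P; j \<in> P; r i j\<rbrakk> \<Longrightarrow> E i j \<in> matrix_algebra"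
  unfolding matrix_algebra_def by (intro op.span_base) blast

lemma matrix_algebra_mult: "\<lbrakk>a \<in> matrix_algebra; b \<in> matrix_algebra\<rbrakk> \<Longrightarrow> a * b \<in> matrix_algebra"
  unfolding matrix_algebra_def
proof (erule (1) span_mult[rotated])
  fix a b assume "a \<in> {E i j | i j. i \<in> P \<and> j \<in> P \<and> r i j}" "b \<in> {E i j | i j. i \<in> P \<and> j \<in> P \<and> r i j}"
  then obtain i j k l where *: "i \<in> P" "j \<in> P" "k \<in> P" "l \<in> P" "r i j" "r k l" "a = E i j" "b = E k l"
    by blast
  show "a * b \<in> op.span {E i j | i j. i \<in> P \<and> j \<in> P \<and> r i j}"
    using * unit_mult[of i j k l] r_trans[of i j l] by (auto intro: op.span_base op.span_zero)
qed

lemma matrix_algebra_combination: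
  "a \<in> matrix_algebra \<Longrightarrow> \<exists>c. coefficients c \<and> a = of_matrix c"
  unfolding matrix_algebra_def
proof (induction rule: op.span_induct_alt)
  case base
  show ?case by (intro exI[of _ "\<lambda>_ _. 0"]) (simp add: coefficients_def of_matrix_def)
next
  case (step b x y)
  then obtain i0 j0 c where *: "i0 \<in> P" "j0 \<in> P" "r i0 j0" "x = E i0 j0" "coefficients c" "y = of_matrix c"
    by blast
  define c' where "c' i j = (if i = i0 \<and> j = j0 then b else 0) + c i j" for i j
  have "of_matrix c' = (\<Sum>i\<in>P. \<Sum>j\<in>P. op_scale (if i = i0 \<and> j = j0 then b else 0) (E i j)) + of_matrix c"
    by (simp add: of_matrix_def c'_def op.scale_left_distrib sum.distrib)
  also have "(\<Sum>i\<in>P. \<Sum>j\<in>P. op_scale (if i = i0 \<and> j = j0 then b else 0) (E i j))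
    = (\<Sum>i\<in>P. if i = i0 then (\<Sum>j\<in>P. if j = j0 then op_scale b (E i j) else 0) else 0)"
    by (intro sum.cong) (auto intro!: sum.cong sum.neutral)
  also have "\<dots> = op_scale b (E i0 j0)"
    using * finite_index by simp
  finally have "op_scale b x + y = of_matrix c'" using * by simp
  moreover have "coefficients c'" using * by (auto simp: coefficients_def c'_def)
  ultimately show ?case by blast
qed

lemma of_matrix_mult_unit:
  assumes "coefficients c" "k \<in> P" "l \<in> P" "r k l"
  shows "of_matrix c * E k l = (\<Sum>i\<in>P. op_scale (c i k) (E i l))"
proof -
  have "of_matrix c * E k l = (\<Sum>i\<in>P. \<Sum>j\<in>P. op_scale (c i j) (E i j * E k l))"
    by (simp add: of_matrix_def sum_distrib_right op_scale_mult_left)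
  also have "\<dots> = (\<Sum>i\<in>P. \<Sum>j\<in>P. if j = k then op_scale (c i k) (E i l) else 0)"
  proof (intro sum.cong refl)
    fix i j assume "i \<in> P" "j \<in> P"
    then show "op_scale (c i j) (E i j * E k l) = (if j = k then op_scale (c i k) (E i l) else 0)"
      using assms unit_mult[of i j k l] by (cases "c i j = 0") (auto simp: coefficients_def)
  qed
  finally show ?thesis using assms finite_index by simp
qed

lemma unit_mult_of_matrix:
  assumes "coefficients c" "k \<in> P" "l \<in> P" "r k l"
  shows "E k l * of_matrix c = (\<Sum>j\<in>P. op_scale (c l j) (E k j))"
proof -
  have "E k l * of_matrix c = (\<Sum>i\<in>P. \<Sum>j\<in>P. op_scale (c i j) (E k l * E i j))"
    by (simp add: of_matrix_def sum_distrib_left op_scale_mult_right)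
  also have "\<dots> = (\<Sum>i\<in>P. \<Sum>j\<in>P. if i = l then op_scale (c l j) (E k j) else 0)"
  proof (intro sum.cong refl)
    fix i j assume "i \<in> P" "j \<in> P"
    then show "op_scale (c i j) (E k l * E i j) = (if i = l then op_scale (c l j) (E k j) else 0)"
      using assms unit_mult[of k l i j] by (cases "c i j = 0") (auto simp: coefficients_def)
  qed
  also have "\<dots> = (\<Sum>j\<in>P. op_scale (c l j) (E k j))"
    using assms finite_index by (subst sum.swap) simp
  finally show ?thesis .
qed

lemma r_refl: "r i j \<Longrightarrow> r i i"
  using r_sym r_trans by blast

lemma corner:
  assumes "coefficients c" "k \<in> P" "l \<in> P" "r k l"
  shows "E k k * of_matrix c * E l l = op_scale (c k l) (E k l)"
proof -
  have rr: "r k k" "r l l" using assms(4) r_refl r_sym by blast+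
  have "E k k * of_matrix c * E l l = (\<Sum>i\<in>P. op_scale (c i l) (E k k * E i l))"
    using of_matrix_mult_unit[OF assms(1,3,3) rr(2)]
    by (simp add: mult.assoc sum_distrib_left op_scale_mult_right)
  also have "\<dots> = (\<Sum>i\<in>P. if i = k then op_scale (c k l) (E k l) else 0)"
  proof (intro sum.cong refl)
    fix i assume "i \<in> P"
    then show "op_scale (c i l) (E k k * E i l) = (if i = k then op_scale (c k l) (E k l) else 0)"
      using assms unit_mult[of k k i l] rr by (cases "c i l = 0") (auto simp: coefficients_def)
  qed
  finally show ?thesis using assms finite_index by simp
qed

text \<open>
  Gaussian elimination, by induction on the number of nonzero rows: for a nonzero entry
  \<open>c i0 j0\<close> of \<open>a\<close> and \<open>y\<close> the inverse of that entry at position \<open>(j0, i0)\<close>, the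
  matrix \<open>d\<close> of \<open>a - a y a\<close> has a zero row \<open>i0\<close> and no new nonzero rows.
\<close>

lemma of_matrix_regular:
  "coefficients c \<Longrightarrow> \<exists>x\<in>matrix_algebra. of_matrix c = of_matrix c * x * of_matrix c"
proof (induction "card {i\<in>P. \<exists>j. c i j \<noteq> 0}" arbitrary: c rule: less_induct)
  case less
  show ?case
  proof (cases "\<forall>i j. c i j = 0")
    case True
    then have "of_matrix c = 0" by (simp add: of_matrix_def)
    then show ?thesis by (auto simp: matrix_algebra_def intro!: bexI[of _ 0] op.span_zero)
  next
    case False
    then obtain i0 j0 where c0: "c i0 j0 \<noteq> 0" by blast
    then have ij: "i0 \<in> P" "j0 \<in> P" "r i0 j0" "r j0 i0"
      using less.prems r_sym by (auto simp: coefficients_def)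
    define a where "a = of_matrix c"
    define y where "y = op_scale (inverse (c i0 j0)) (E j0 i0)"
    define d where "d i j = c i j - c i j0 * inverse (c i0 j0) * c i0 j" for i j
    have y: "y \<in> matrix_algebra"
      using ij unit_in_matrix_algebra unfolding y_def matrix_algebra_def by (blast intro: op.span_scale)
    have d: "coefficients d"
      unfolding coefficients_def
    proof (intro allI impI)
      fix i j assume "d i j \<noteq> 0"
      then have "c i j \<noteq> 0 \<or> c i j0 \<noteq> 0 \<and> c i0 j \<noteq> 0" by (auto simp: d_def)
      then show "i \<in> P \<and> j \<in> P \<and> r i j"
        using less.prems ij r_trans unfolding coefficients_def by blast
    qed
    have "a * y * a = op_scale (inverse (c i0 j0)) ((\<Sum>i\<in>P. op_scale (c i j0) (E i i0)) * a)"
      using of_matrix_mult_unit[OF less.prems ij(2,1,4)]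
      by (simp add: a_def y_def op_scale_mult_right op_scale_mult_left)
    also have "(\<Sum>i\<in>P. op_scale (c i j0) (E i i0)) * a
      = (\<Sum>i\<in>P. \<Sum>j\<in>P. op_scale (c i j0 * c i0 j) (E i j))"
      unfolding sum_distrib_right
    proof (intro sum.cong refl)
      fix i assume "i \<in> P"
      show "op_scale (c i j0) (E i i0) * a = (\<Sum>j\<in>P. op_scale (c i j0 * c i0 j) (E i j))"
      proof (cases "c i j0 = 0")
        case False
        then have "r i i0" using less.prems ij r_trans unfolding coefficients_def by blast
        then show ?thesis
          using unit_mult_of_matrix[OF less.prems \<open>i \<in> P\<close> ij(1)]
          by (simp add: a_def op_scale_mult_left op.scale_sum_right)
      qed simp
    qed
    finally have "a * y * a = (\<Sum>i\<in>P. \<Sum>j\<in>P. op_scale (c i j0 * inverse (c i0 j0) * c i0 j) (E i j))"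
      by (simp add: op.scale_sum_right mult_ac)
    then have ad: "a - a * y * a = of_matrix d"
      by (simp add: a_def of_matrix_def d_def op.scale_left_diff_distrib sum_subtractf)
    have "{i\<in>P. \<exists>j. d i j \<noteq> 0} \<subset> {i\<in>P. \<exists>j. c i j \<noteq> 0}"
    proof
      show "{i\<in>P. \<exists>j. d i j \<noteq> 0} \<subseteq> {i\<in>P. \<exists>j. c i j \<noteq> 0}"
      proof
        fix i assume "i \<in> {i\<in>P. \<exists>j. d i j \<noteq> 0}"
        then obtain j where "i \<in> P" "d i j \<noteq> 0" by blast
        then have "c i j \<noteq> 0 \<or> c i j0 \<noteq> 0" by (auto simp: d_def)
        with \<open>i \<in> P\<close> show "i \<in> {i\<in>P. \<exists>j. c i j \<noteq> 0}" by blast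
      qed
      have "d i0 j = 0" for j using c0 by (simp add: d_def)
      then show "{i\<in>P. \<exists>j. d i j \<noteq> 0} \<noteq> {i\<in>P. \<exists>j. c i j \<noteq> 0}"
        using ij c0 by blast
    qed
    then have "card {i\<in>P. \<exists>j. d i j \<noteq> 0} < card {i\<in>P. \<exists>j. c i j \<noteq> 0}"
      using finite_index by (intro psubset_card_mono) auto
    from less.hyps[OF this d] obtain z where z: "z \<in> matrix_algebra"
      "a - a * y * a = (a - a * y * a) * z * (a - a * y * a)"
      unfolding ad by blast
    have a: "a \<in> matrix_algebra"
      unfolding a_def of_matrix_def matrix_algebra_def
    proof (intro op.span_sum)
      fix i j assume "i \<in> P" "j \<in> P"
      then show "op_scale (c i j) (E i j) \<in> op.span {E i j |i j. i \<in> P \<and> j \<in> P \<and> r i j}"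
        using less.prems unit_in_matrix_algebra[of i j] by (cases "c i j = 0")
          (auto simp: coefficients_def matrix_algebra_def op.span_zero intro: op.span_scale)
    qed
    have "y + z - y * a * z - z * a * y + y * a * z * a * y \<in> matrix_algebra"
    proof -
      have "y * a * z \<in> matrix_algebra" "z * a * y \<in> matrix_algebra" "y * a * z * a * y \<in> matrix_algebra"
        using y z(1) a by (simp_all add: matrix_algebra_mult)
      then show ?thesis using y z(1) unfolding matrix_algebra_def
        by (intro op.span_add op.span_diff)
    qed
    with regular_lift[OF z(2)] show ?thesis unfolding a_def by blast
  qed
qed

lemma matrix_algebra_regular: "a \<in> matrix_algebra \<Longrightarrow> \<exists>x\<in>matrix_algebra. a = a * x * a"
  using matrix_algebra_combination of_matrix_regular by blast

end

section \<open>Paths in a well-ordered set\<close>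

locale ordinal_paths =
  fixes \<kappa> :: "'o rel"
  assumes well_order: "Well_order \<kappa>"
begin

text \<open>The strict order; the edges of the graph are the pairs in this relation.\<close>

definition prec :: "'o \<Rightarrow> 'o \<Rightarrow> bool" where "prec a b \<longleftrightarrow> (a, b) \<in> \<kappa> \<and> a \<noteq> b"

text \<open>A path is identified with the list of its vertices; \<open>[v]\<close> is the path of length zero.\<close>

definition path :: "'o list \<Rightarrow> bool" where
  "path i \<longleftrightarrow> i \<noteq> [] \<and> set i \<subseteq> Field \<kappa> \<and> sorted_wrt prec i"

text \<open>The pairs of paths for which \<open>i j\<^sup>*\<close> is a nonzero element of the Leavitt path algebra.\<close>

definition coterminal :: "'o list \<Rightarrow> 'o list \<Rightarrow> bool" where
  "coterminal i j \<longleftrightarrow> path i \<and> path j \<and> last i = last j"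

lemma prec_trans: "prec a b \<Longrightarrow> prec b c \<Longrightarrow> prec a c"
  using well_order unfolding prec_def well_order_on_def linear_order_on_def partial_order_on_def
    preorder_on_def trans_def antisym_def by blast

lemma prec_irrefl: "\<not> prec a a"
  by (simp add: prec_def)

lemma prec_asym: "prec a b \<Longrightarrow> \<not> prec b a"
  using prec_trans prec_irrefl by blast

lemma prec_total: "a \<in> Field \<kappa> \<Longrightarrow> b \<in> Field \<kappa> \<Longrightarrow> prec a b \<or> a = b \<or> prec b a"
  using well_order unfolding prec_def well_order_on_def linear_order_on_def total_on_def by blast

lemma prec_Field: "prec a b \<Longrightarrow> a \<in> Field \<kappa> \<and> b \<in> Field \<kappa>"
  unfolding prec_def Field_def by blast

lemma path_nonempty: "path i \<Longrightarrow> i \<noteq> []"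
  by (simp add: path_def)

lemma path_last_Field: "path i \<Longrightarrow> last i \<in> Field \<kappa>"
  using last_in_set by (force simp: path_def)

lemma path_single: "v \<in> Field \<kappa> \<Longrightarrow> path [v]"
  by (simp add: path_def)

lemma path_append_last: "path (i @ m) \<Longrightarrow> i \<noteq> [] \<Longrightarrow> m \<noteq> [] \<Longrightarrow> prec (last i) (last (i @ m))"
  by (auto simp: path_def sorted_wrt_append)

lemma path_le_last: "path i \<Longrightarrow> a \<in> set i \<Longrightarrow> a = last i \<or> prec a (last i)"
  by (induction i rule: rev_induct) (auto simp: path_def sorted_wrt_append)

lemma path_transplant:
  assumes "path i" "path (j @ m)" "j \<noteq> []" "last i = last j" shows "path (i @ m)"
  unfolding path_def
proof (intro conjI)
  show "i @ m \<noteq> []" "set (i @ m) \<subseteq> Field \<kappa>" using assms by (auto simp: path_def)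
  have "prec a b" if "a \<in> set i" "b \<in> set m" for a b
  proof -
    have "prec (last i) b" using assms that by (auto simp: path_def sorted_wrt_append)
    then show ?thesis using path_le_last[OF assms(1) that(1)] prec_trans by auto
  qed
  then show "sorted_wrt prec (i @ m)"
    using assms by (auto simp: path_def sorted_wrt_append)
qed

lemma path_snoc: "path i \<Longrightarrow> prec (last i) w \<Longrightarrow> path (i @ [w])"
  using path_transplant[of i "[last i]" "[w]"] prec_Field by (auto simp: path_def)

lemma path_distinct:
  assumes "path i" shows "distinct i"
proof -
  have "sorted_wrt prec i" using assms by (simp add: path_def)
  then show ?thesis by (induction i) (auto simp: prec_irrefl)
qed

lemma finite_paths: "finite U \<Longrightarrow> finite {i. path i \<and> set i \<subseteq> U}"
  by (rule finite_subset[OF _ finite_subset_distinct]) (auto dest: path_distinct)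

lemma coterminal_sym: "coterminal i j \<Longrightarrow> coterminal j i"
  and coterminal_trans: "coterminal i j \<Longrightarrow> coterminal j k \<Longrightarrow> coterminal i k"
  by (auto simp: coterminal_def)

lemma coterminal_append: "coterminal i j \<Longrightarrow> path (j @ m) \<Longrightarrow> coterminal (i @ m) (j @ m)"
  using path_transplant[of i j m] by (cases m rule: rev_cases) (auto simp: coterminal_def path_nonempty)

text \<open>
  The product of \<open>i j\<^sup>*\<close> and \<open>k l\<^sup>*\<close> is zero or of the same form, and its paths end at or
  above the ends of the paths of both factors.
\<close>

lemma shift_mult_cases:
  assumes "coterminal i j" "coterminal k l"
  shows "shift i j * shift k l = (0 :: ('o list, 'k::field) lin_op) \<or>
    (\<exists>p q. coterminal p q \<and> shift i j * shift k l = (shift p q :: ('o list, 'k) lin_op) \<and>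
      (last q = last j \<or> prec (last j) (last q)) \<and> (last q = last l \<or> prec (last l) (last q)))"
proof -
  consider "\<not> prefix j k" "\<not> prefix k j" | m where "k = j @ m" | m where "j = k @ m"
    by (auto simp: prefix_def)
  then show ?thesis
  proof cases
    case 1
    then show ?thesis by (simp add: shift_mult_zero)
  next
    case 2
    have p: "path (j @ m)" using assms 2 by (simp add: coterminal_def)
    have "coterminal (i @ m) (j @ m)" using assms p by (simp add: coterminal_append)
    then have "coterminal (i @ m) l" using assms 2 coterminal_trans by blast
    moreover have "last (j @ m) = last l" using assms 2 by (simp add: coterminal_def)
    moreover have "last (j @ m) = last j \<or> prec (last j) (last (j @ m))"
      using path_append_last[OF p] assms by (cases "m = []") (auto simp: coterminal_def path_nonempty)
    ultimately show ?thesis using 2 by (metis shift_mult_append)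
  next
    case 3
    have p: "path (k @ m)" using assms 3 by (simp add: coterminal_def)
    have "coterminal l k" using assms coterminal_sym by blast
    then have "coterminal (k @ m) (l @ m)" using p coterminal_append coterminal_sym by blast
    then have par: "coterminal i (l @ m)" using assms 3 coterminal_trans by blast
    moreover have "last (l @ m) = last j" using assms 3 par by (simp add: coterminal_def)
    moreover have "last (l @ m) = last l \<or> prec (last l) (last (l @ m))"
      using path_append_last[of l m] assms par
      by (cases "m = []") (auto simp: coterminal_def path_nonempty)
    ultimately show ?thesis using 3 by (metis shift_append_mult)
  qed
qed

text \<open>The elements \<open>i j\<^sup>*\<close> whose paths end in \<open>D\<close>.\<close>

definition path_shifts :: "'o set \<Rightarrow> ('o list, 'k::field) lin_op set" where
  "path_shifts D = {shift i j | i j. coterminal i j \<and> last j \<in> D}"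

text \<open>
  The span of all elements \<open>i j\<^sup>*\<close>. When (CK2) is vacuous, this is the image of the Leavitt path
  algebra in the ring of operators.
\<close>

definition path_algebra :: "('o list, 'k::field) lin_op set" where
  "path_algebra = op.span {shift i j | i j. coterminal i j}"

lemma path_shifts_Field: "path_shifts (Field \<kappa>) = {shift i j | i j. coterminal i j}"
  unfolding path_shifts_def coterminal_def using path_last_Field by blast

lemma shift_in_path_algebra: "coterminal i j \<Longrightarrow> shift i j \<in> path_algebra"
  unfolding path_algebra_def by (intro op.span_base) blast

lemma path_shifts_mult:
  assumes D: "\<And>a b. a \<in> D \<Longrightarrow> prec a b \<Longrightarrow> b \<in> D" and "coterminal i j" "coterminal k l"
    "last j \<in> D \<or> last l \<in> D"
  shows "shift i j * shift k l \<in> op.span (path_shifts D :: ('o list, 'k::field) lin_op set)"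
proof -
  consider "shift i j * shift k l = (0 :: ('o list, 'k) lin_op)"
    | p q where "coterminal p q" "shift i j * shift k l = (shift p q :: ('o list, 'k) lin_op)"
        "last q = last j \<or> prec (last j) (last q)" "last q = last l \<or> prec (last l) (last q)"
    using shift_mult_cases[OF assms(2,3), where 'k='k] by blast
  then show ?thesis
  proof cases
    case 1
    then show ?thesis by (simp add: op.span_zero)
  next
    case 2
    then have "last q \<in> D" using assms(4) D by metis
    then have "shift i j * shift k l \<in> (path_shifts D :: ('o list, 'k) lin_op set)"
      unfolding path_shifts_def using 2 by blast
    then show ?thesis by (rule op.span_base)
  qed
qed

lemma path_algebra_mult:
  assumes "a \<in> path_algebra" "b \<in> path_algebra"
  shows "a * b \<in> (path_algebra :: ('o list, 'k::field) lin_op set)"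
proof -
  let ?S = "{shift i j | i j. coterminal i j} :: ('o list, 'k) lin_op set"
  have "a * b \<in> op.span ?S" if ab: "a \<in> ?S" "b \<in> ?S" for a b
  proof -
    obtain i j k l where ijkl: "coterminal i j" "coterminal k l" "a = shift i j" "b = shift k l"
      using ab by blast
    show ?thesis
      using path_shifts_mult[of "Field \<kappa>" i j k l, where 'k='k] ijkl prec_Field path_last_Field
      unfolding path_shifts_Field coterminal_def by blast
  qed
  then show ?thesis using assms unfolding path_algebra_def by (rule span_mult)
qed

lemma path_algebra_simps:
  "0 \<in> path_algebra"
  "a \<in> path_algebra \<Longrightarrow> b \<in> path_algebra \<Longrightarrow> a + b \<in> path_algebra"
  "a \<in> path_algebra \<Longrightarrow> b \<in> path_algebra \<Longrightarrow> a - b \<in> path_algebra"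
  "a \<in> path_algebra \<Longrightarrow> op_scale c a \<in> path_algebra"
  unfolding path_algebra_def by (auto intro: op.span_zero op.span_add op.span_diff op.span_scale)

section \<open>Subalgebras on finitely many vertices\<close>

definition paths_in :: "'o set \<Rightarrow> 'o list set" where
  "paths_in U = {i. path i \<and> set i \<subseteq> U}"

text \<open>The span of the \<open>i j\<^sup>*\<close> with both paths inside \<open>U\<close>.\<close>

definition algebra_in :: "'o set \<Rightarrow> ('o list, 'k::field) lin_op set" where
  "algebra_in U = op.span {shift i j | i j. i \<in> paths_in U \<and> j \<in> paths_in U \<and> last i = last j}"

text \<open>
  The element \<open>i q j\<^sup>*\<close>, where \<open>q\<close> is the last vertex of \<open>i\<close> minus the sum of \<open>e e\<^sup>*\<close> over the
  edges \<open>e\<close> from that vertex to vertices of \<open>U\<close>.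
\<close>

definition path_unit :: "'o set \<Rightarrow> 'o list \<Rightarrow> 'o list \<Rightarrow> ('o list, 'k::field) lin_op" where
  "path_unit U i j = shift i j - (\<Sum>w\<in>{w\<in>U. prec (last i) w}. shift (i @ [w]) (j @ [w]))"

text \<open>A path ending in \<open>v\<close> can be prolonged inside \<open>U\<close> by the first element of \<open>z\<close>.\<close>

definition continues :: "'o set \<Rightarrow> 'o \<Rightarrow> 'o list \<Rightarrow> bool" where
  "continues U v z \<longleftrightarrow> z \<noteq> [] \<and> hd z \<in> U \<and> prec v (hd z)"

lemma path_algebra_sum: "(\<And>x. x \<in> A \<Longrightarrow> f x \<in> path_algebra) \<Longrightarrow> sum f A \<in> path_algebra"
  unfolding path_algebra_def by (rule op.span_sum)

text \<open>
  As an operator, \<open>path_unit U i j\<close> is the restriction of \<open>shift i j\<close> to the lists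
  that do not continue inside \<open>U\<close>.
\<close>

lemma app_path_unit:
  assumes "finite U"
  shows "app (path_unit U i j) f x =
    (if prefix i x \<and> \<not> continues U (last i) (drop (length i) x) then f (j @ drop (length i) x) else 0)"
proof (cases "prefix i x")
  case False
  then have "\<not> prefix (i @ [w]) x" for w using append_prefixD by blast
  with False show ?thesis by (simp add: path_unit_def app_simps shift.rep_eq)
next
  case True
  then obtain z where z: "x = i @ z" by (auto simp: prefix_def)
  let ?W = "{w\<in>U. prec (last i) w}"
  have fin: "finite ?W" using assms by simp
  show ?thesis
  proof (cases z)
    case Nil
    then show ?thesis by (simp add: z path_unit_def app_simps shift.rep_eq continues_def)
  next
    case (Cons a z')
    have "app (path_unit U i j) f x = f (j @ z) - (\<Sum>w\<in>?W. if w = a then f (j @ z) else 0)"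
      by (auto simp: path_unit_def app_simps shift.rep_eq z Cons intro!: sum.cong)
    also have "\<dots> = (if continues U (last i) z then 0 else f (j @ z))"
      using fin by (auto simp: continues_def Cons)
    finally show ?thesis by (simp add: z)
  qed
qed

text \<open>A list has at most one prefix that is a path inside \<open>U\<close> and cannot be prolonged inside \<open>U\<close>.\<close>

lemma stop_unique:
  assumes "j @ z = k @ u" "j \<in> paths_in U" "k \<in> paths_in U"
    "\<not> continues U (last j) z" "\<not> continues U (last k) u"
  shows "j = k"
proof -
  have *: "m = []" if "j @ m \<in> paths_in U" "j \<in> paths_in U" "\<not> continues U (last j) (m @ u)" for j m u
  proof (rule ccontr)
    assume "m \<noteq> []"
    then obtain a m' where m: "m = a # m'" by (cases m) auto
    have "a \<in> U" "prec (last j) a"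
      using that by (auto simp: paths_in_def path_def m sorted_wrt_append)
    then show False using that(3) by (simp add: continues_def m)
  qed
  from assms(1) consider m where "j = k @ m" "u = m @ z" | m where "k = j @ m" "z = m @ u"
    by (auto simp: append_eq_append_conv2)
  then show ?thesis using assms *[of k _ z] *[of j _ u] by cases auto
qed

lemma path_unit_mult:
  assumes "finite U" "i \<in> paths_in U" "j \<in> paths_in U" "k \<in> paths_in U" "l \<in> paths_in U"
    "last i = last j" "last k = last l"
  shows "path_unit U i j * path_unit U k l =
    (if j = k then path_unit U i l else 0 :: ('o list, 'k::field) lin_op)"
proof (rule lin_op_eqI)
  fix f :: "'o list \<Rightarrow> 'k" and x
  show "app (path_unit U i j * path_unit U k l) f x = app (if j = k then path_unit U i l else 0 :: ('o list, 'k) lin_op) f x"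
  proof (cases "prefix i x \<and> \<not> continues U (last i) (drop (length i) x)")
    case False
    then show ?thesis by (auto simp: app_simps app_path_unit[OF assms(1)])
  next
    case True
    then obtain z where z: "x = i @ z" "\<not> continues U (last i) z" by (auto simp: prefix_def)
    show ?thesis
    proof (cases "j = k")
      case True
      then show ?thesis using z assms by (simp add: app_simps app_path_unit[OF assms(1)])
    next
      case False
      have "\<not> (prefix k (j @ z) \<and> \<not> continues U (last k) (drop (length k) (j @ z)))"
      proof
        assume *: "prefix k (j @ z) \<and> \<not> continues U (last k) (drop (length k) (j @ z))"
        then obtain u where u: "j @ z = k @ u" by (auto simp: prefix_def)
        have "\<not> continues U (last k) u" using * unfolding u by simp
        then show False using stop_unique[OF u] z assms False by simp
      qed
      moreover have "drop (length i) (i @ z) = z" by simp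
      ultimately show ?thesis using z False
        by (auto simp: app_simps app_path_unit[OF assms(1)] simp del: drop_append)
    qed
  qed
qed

lemma matrix_units_path_unit:
  assumes "finite U"
  shows "matrix_units (paths_in U) (\<lambda>i j. last i = last j) (path_unit U :: _ \<Rightarrow> _ \<Rightarrow> ('o list, 'k::field) lin_op)"
proof
  show "finite (paths_in U)" using assms unfolding paths_in_def by (rule finite_paths)
  fix i j k l
  assume "i \<in> paths_in U" "j \<in> paths_in U" "k \<in> paths_in U" "l \<in> paths_in U"
    "last i = last j" "last k = last l"
  then show "path_unit U i j * path_unit U k l =
      (if j = k then path_unit U i l else 0 :: ('o list, 'k) lin_op)"
    by (rule path_unit_mult[OF assms])
qed auto

lemma paths_in_coterminal: "i \<in> paths_in U \<Longrightarrow> j \<in> paths_in U \<Longrightarrow> last i = last j \<Longrightarrow> coterminal i j"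
  by (simp add: paths_in_def coterminal_def)

lemma path_unit_in_path_algebra:
  assumes "i \<in> paths_in U" "j \<in> paths_in U" "last i = last j"
  shows "path_unit U i j \<in> path_algebra"
  unfolding path_unit_def
proof (intro path_algebra_simps path_algebra_sum shift_in_path_algebra)
  show par: "coterminal i j" using assms by (rule paths_in_coterminal)
  show "coterminal (i @ [w]) (j @ [w])" if "w \<in> {w \<in> U. prec (last i) w}" for w
    using coterminal_append[OF par path_snoc] that par by (auto simp: coterminal_def)
qed

text \<open>
  The relation \<open>i j\<^sup>* = i q j\<^sup>* + \<Sum>\<^sub>e (i e) (j e)\<^sup>*\<close> prolongs the paths, so the
  recursion stops because \<open>U\<close> is finite.
\<close>

lemma shift_in_matrix_algebra:
  assumes "finite U"
  shows "i \<in> paths_in U \<Longrightarrow> j \<in> paths_in U \<Longrightarrow> last i = last j \<Longrightarrow>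
    (shift i j :: ('o list, 'k::field) lin_op)
      \<in> matrix_units.matrix_algebra (paths_in U) (\<lambda>i j. last i = last j) (path_unit U)"
proof (induction "card {w\<in>U. prec (last i) w}" arbitrary: i j rule: less_induct)
  case less
  interpret matrix_units "paths_in U" "\<lambda>i j. last i = last j" "path_unit U :: _ \<Rightarrow> _ \<Rightarrow> ('o list, 'k) lin_op"
    using assms by (rule matrix_units_path_unit)
  let ?W = "{w\<in>U. prec (last i) w}"
  have "shift (i @ [w]) (j @ [w]) \<in> matrix_algebra" if w: "w \<in> ?W" for w
  proof (rule less.hyps)
    show "i @ [w] \<in> paths_in U" "j @ [w] \<in> paths_in U"
      using w less.prems path_snoc by (auto simp: paths_in_def)
    show "last (i @ [w]) = last (j @ [w])" by simp
    have "{u\<in>U. prec w u} \<subset> ?W"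
      using w prec_trans prec_irrefl by blast
    then show "card {u\<in>U. prec (last (i @ [w])) u} < card ?W"
      using assms by (auto intro: psubset_card_mono)
  qed
  then have "(\<Sum>w\<in>?W. shift (i @ [w]) (j @ [w])) \<in> matrix_algebra"
    unfolding matrix_algebra_def by (intro op.span_sum) blast
  with unit_in_matrix_algebra[OF less.prems]
  have "path_unit U i j + (\<Sum>w\<in>?W. shift (i @ [w]) (j @ [w])) \<in> matrix_algebra"
    unfolding matrix_algebra_def by (rule op.span_add)
  then show ?case by (simp add: path_unit_def)
qed

lemma algebra_in_subset:
  assumes "finite U"
  shows "(algebra_in U :: ('o list, 'k::field) lin_op set)
    \<subseteq> matrix_units.matrix_algebra (paths_in U) (\<lambda>i j. last i = last j) (path_unit U)"
proof -
  interpret matrix_units "paths_in U" "\<lambda>i j. last i = last j" "path_unit U :: _ \<Rightarrow> _ \<Rightarrow> ('o list, 'k) lin_op"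
    using assms by (rule matrix_units_path_unit)
  show ?thesis unfolding algebra_in_def using shift_in_matrix_algebra[OF assms, where 'k='k]
    unfolding matrix_algebra_def by (intro op.span_minimal) auto
qed

lemma algebra_in_mono: "U \<subseteq> Y \<Longrightarrow> algebra_in U \<subseteq> algebra_in Y"
  unfolding algebra_in_def paths_in_def by (intro op.span_mono) blast

lemma path_algebra_finite_support:
  assumes "a \<in> path_algebra"
  shows "\<exists>U. finite U \<and> U \<subseteq> Field \<kappa> \<and> a \<in> algebra_in U"
  using assms unfolding path_algebra_def
proof (induction rule: op.span_induct_alt)
  case base
  show ?case by (intro exI[of _ "{}"]) (simp add: algebra_in_def op.span_zero)
next
  case (step c x y)
  then obtain i j U where *: "coterminal i j" "x = shift i j" "finite U" "U \<subseteq> Field \<kappa>" "y \<in> algebra_in U"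
    by blast
  let ?Y = "U \<union> set i \<union> set j"
  have "x \<in> algebra_in ?Y"
    unfolding algebra_in_def using * by (intro op.span_base) (auto simp: paths_in_def coterminal_def)
  moreover have "y \<in> algebra_in ?Y" using * algebra_in_mono[of U ?Y] by blast
  ultimately have "op_scale c x + y \<in> algebra_in ?Y"
    unfolding algebra_in_def by (intro op.span_add op.span_scale)
  moreover have "finite ?Y" "?Y \<subseteq> Field \<kappa>" using * by (auto simp: coterminal_def path_def)
  ultimately show ?case by (intro exI[of _ ?Y] conjI)
qed

theorem path_algebra_regular:
  fixes a :: "('o list, 'k::field) lin_op"
  assumes "a \<in> path_algebra" shows "\<exists>x\<in>path_algebra. a = a * x * a"
proof -
  obtain U where U: "finite U" "a \<in> algebra_in U" using path_algebra_finite_support[OF assms] by blast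
  interpret matrix_units "paths_in U" "\<lambda>i j. last i = last j" "path_unit U :: _ \<Rightarrow> _ \<Rightarrow> ('o list, 'k) lin_op"
    using U(1) by (rule matrix_units_path_unit)
  have "a \<in> matrix_algebra" by (rule subsetD[OF algebra_in_subset[OF U(1)] U(2)])
  then obtain x where x: "x \<in> matrix_algebra" "a = a * x * a" using matrix_algebra_regular by blast
  have "matrix_algebra \<subseteq> path_algebra"
    unfolding matrix_algebra_def
  proof (rule op.span_minimal)
    show "op.subspace (path_algebra :: ('o list, 'k) lin_op set)" by (simp add: path_algebra_def)
    show "{path_unit U i j | i j. i \<in> paths_in U \<and> j \<in> paths_in U \<and> last i = last j}
      \<subseteq> (path_algebra :: ('o list, 'k) lin_op set)"
      by clarify (rule path_unit_in_path_algebra)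
  qed
  with x show ?thesis by blast
qed

end

context ordinal_paths
begin

section \<open>Vertices in ideals\<close>

text \<open>
  Every nonzero ideal contains every vertex that is large enough and avoids finitely many vertices.
\<close>

lemma compress_to_vertex:
  fixes a :: "('o list, 'k::field) lin_op"
  assumes a: "a \<in> path_algebra" "a \<noteq> 0"
  shows "\<exists>U v. finite U \<and> v \<in> Field \<kappa> \<and>
    (\<forall>w. prec v w \<longrightarrow> w \<notin> U \<longrightarrow> (\<exists>x\<in>path_algebra. \<exists>y\<in>path_algebra. x * a * y = shift [w] [w]))"
proof -
  obtain U where U: "finite U" "a \<in> algebra_in U" using path_algebra_finite_support[OF a(1)] by blast
  interpret matrix_units "paths_in U" "\<lambda>i j. last i = last j" "path_unit U :: _ \<Rightarrow> _ \<Rightarrow> ('o list, 'k) lin_op"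
    using U(1) by (rule matrix_units_path_unit)
  have "a \<in> matrix_algebra" by (rule subsetD[OF algebra_in_subset[OF U(1)] U(2)])
  then obtain c where c: "coefficients c" "a = of_matrix c" using matrix_algebra_combination by blast
  obtain i j where ij: "c i j \<noteq> 0"
  proof (rule ccontr)
    assume "\<not> thesis"
    then have "c i j = 0" for i j using that by blast
    then show False using a(2) c(2) by (simp add: of_matrix_def)
  qed
  then have ij': "i \<in> paths_in U" "j \<in> paths_in U" "last i = last j"
    using c(1) by (auto simp: coefficients_def)
  have par: "coterminal i j" using ij' by (rule paths_in_coterminal)
  have "\<exists>x\<in>path_algebra. \<exists>y\<in>path_algebra. x * a * y = shift [w] [w]"
    if w: "prec (last i) w" "w \<notin> U" for w
  proof -
    have snoc: "path (i @ [w])" "path (j @ [w])"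
      using w par path_snoc by (auto simp: coterminal_def)
    \<comment> \<open>The outer matrix units isolate the entry \<open>(i, j)\<close>; the edge to \<open>w\<close>, which lies outside
      \<open>U\<close>, then turns \<open>path_unit U i j\<close> into the vertex \<open>w\<close>.\<close>
    define x :: "('o list, 'k) lin_op" where
      "x = op_scale (inverse (c i j)) (shift [w] (i @ [w])) * path_unit U i i"
    define y :: "('o list, 'k) lin_op" where "y = path_unit U j j * shift (j @ [w]) [w]"
    have "path [w]" using w prec_Field path_single by blast
    then have "coterminal [w] (i @ [w])" "coterminal (j @ [w]) [w]"
      using snoc by (simp_all add: coterminal_def)
    then have "x \<in> path_algebra" "y \<in> path_algebra"
      unfolding x_def y_def using ij'
      by (auto intro!: path_algebra_mult path_algebra_simps shift_in_path_algebra path_unit_in_path_algebra)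
    have "path_unit U i j * shift (j @ [w]) [w] = (shift (i @ [w]) [w] :: ('o list, 'k) lin_op)"
    proof -
      have "shift (i @ [u]) (j @ [u]) * shift (j @ [w]) [w] = (0 :: ('o list, 'k) lin_op)"
        if "u \<in> {u\<in>U. prec (last i) u}" for u
        using that w by (intro shift_mult_zero) (auto simp: prefix_def)
      then have "(\<Sum>u\<in>{u\<in>U. prec (last i) u}. shift (i @ [u]) (j @ [u]) * shift (j @ [w]) [w])
        = (0 :: ('o list, 'k) lin_op)" by (intro sum.neutral) blast
      then show ?thesis
        by (simp add: path_unit_def left_diff_distrib sum_distrib_right shift_mult_append)
    qed
    then have "shift [w] (i @ [w]) * path_unit U i j * shift (j @ [w]) [w]
      = (shift [w] [w] :: ('o list, 'k) lin_op)"
      by (simp add: mult.assoc)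
    moreover have "x * a * y = op_scale (inverse (c i j))
        (shift [w] (i @ [w]) * (path_unit U i i * of_matrix c * path_unit U j j) * shift (j @ [w]) [w])"
      by (simp add: x_def y_def c(2) mult.assoc op_scale_mult_left)
    ultimately have "x * a * y = shift [w] [w]"
      using corner[OF c(1) ij'(1,2,3)] ij by (simp add: op_scale_mult_left op_scale_mult_right)
    then show ?thesis using \<open>x \<in> path_algebra\<close> \<open>y \<in> path_algebra\<close> by blast
  qed
  moreover have "last i \<in> Field \<kappa>" using par path_last_Field by (simp add: coterminal_def)
  ultimately show ?thesis using U(1) by blast
qed

end

section \<open>Primeness and non-primitivity\<close>

context ordinal_paths
begin

lemma span_path_shifts_subset: "op.span (path_shifts D) \<subseteq> (path_algebra :: ('o list, 'k::field) lin_op set)"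
  unfolding path_algebra_def path_shifts_def by (intro op.span_mono) auto

lemma span_path_shifts_ideal:
  fixes a r :: "('o list, 'k::field) lin_op"
  assumes D: "\<And>a b. a \<in> D \<Longrightarrow> prec a b \<Longrightarrow> b \<in> D" and a: "a \<in> path_algebra"
    and r: "r \<in> op.span (path_shifts D)"
  shows "a * r \<in> op.span (path_shifts D)" "r * a \<in> op.span (path_shifts D)"
proof -
  have *: "x * y \<in> op.span (path_shifts D) \<and> y * x \<in> op.span (path_shifts D)"
    if xy: "x \<in> {shift i j | i j. coterminal i j}" "y \<in> path_shifts D"
    for x y :: "('o list, 'k) lin_op"
  proof -
    obtain i j k l where ij: "x = shift i j" "coterminal i j"
      and kl: "y = shift k l" "coterminal k l" "last l \<in> D"
      using xy by (auto simp: path_shifts_def)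
    show ?thesis
      unfolding ij(1) kl(1)
      by (intro conjI; rule path_shifts_mult, erule (1) D) (use ij kl in auto)
  qed
  show "a * r \<in> op.span (path_shifts D)"
    by (rule span_mult[OF _ a[unfolded path_algebra_def] r]) (use * in simp)
  show "r * a \<in> op.span (path_shifts D)"
    by (rule span_mult[OF _ r a[unfolded path_algebra_def]]) (use * in simp)
qed

lemma span_path_shifts_finite:
  assumes "r \<in> op.span (path_shifts D :: ('o list, 'k::field) lin_op set)"
  shows "\<exists>Q. finite Q \<and> (\<forall>(i, j)\<in>Q. coterminal i j \<and> last j \<in> D) \<and> r \<in> op.span ((\<lambda>(i, j). shift i j) ` Q)"
  using assms
proof (induction rule: op.span_induct_alt)
  case base
  show ?case by (rule exI[of _ "{}"]) (simp add: op.span_zero)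
next
  case (step c x y)
  then obtain i j Q where *: "x = shift i j" "coterminal i j" "last j \<in> D" "finite Q"
    "\<forall>(i, j)\<in>Q. coterminal i j \<and> last j \<in> D" "y \<in> op.span ((\<lambda>(i, j). shift i j) ` Q)"
    by (auto simp: path_shifts_def)
  let ?Q = "insert (i, j) Q"
  have "x \<in> op.span ((\<lambda>(i, j). shift i j) ` ?Q)"
    using * by (intro op.span_base) simp
  moreover have "y \<in> op.span ((\<lambda>(i, j). shift i j) ` ?Q)"
    using *(6) op.span_mono[of "(\<lambda>(i, j). shift i j) ` Q" "(\<lambda>(i, j). shift i j) ` ?Q"] by auto
  ultimately have "op_scale c x + y \<in> op.span ((\<lambda>(i, j). shift i j) ` ?Q)"
    by (intro op.span_add op.span_scale)
  then show ?case using * by (intro exI[of _ ?Q]) simp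
qed

end

locale uncountable_ordinal_paths = ordinal_paths \<kappa> for \<kappa> :: "'o rel" +
  assumes uncountable_cof: "uncountable_cofinality \<kappa>"
begin

lemma countable_bound:
  assumes "countable C" "C \<subseteq> Field \<kappa>" shows "\<exists>w\<in>Field \<kappa>. \<forall>c\<in>C. prec c w"
proof -
  obtain w where w: "w \<in> Field \<kappa>" "\<And>c. c \<in> C \<Longrightarrow> (w, c) \<notin> \<kappa>"
    using assms uncountable_cof unfolding countable_cofinality_def by meson
  have "refl_on (Field \<kappa>) \<kappa>"
    using well_order by (simp add: well_order_on_def linear_order_on_def partial_order_on_def preorder_on_def)
  then have ww: "(w, w) \<in> \<kappa>" using w(1) by (rule refl_onD)
  have "prec c w" if c: "c \<in> C" for c
  proof -
    have "c \<in> Field \<kappa>" using c assms(2) by (rule subsetD[rotated])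
    then show ?thesis using w(2)[OF c] ww prec_total[of c w] w(1) by (auto simp: prec_def)
  qed
  then show ?thesis using w(1) by (intro bexI[of _ w] ballI)
qed

theorem path_algebra_prime:
  fixes a b :: "('o list, 'k::field) lin_op"
  assumes "a \<in> path_algebra" "a \<noteq> 0" "b \<in> path_algebra" "b \<noteq> 0"
  shows "\<exists>x\<in>path_algebra. \<exists>y\<in>path_algebra. \<exists>z\<in>path_algebra. \<exists>u\<in>path_algebra.
    (x * a * y) * (z * b * u) \<noteq> 0"
proof -
  obtain A v where A: "finite A" "v \<in> Field \<kappa>"
    "\<And>w. \<lbrakk>prec v w; w \<notin> A\<rbrakk> \<Longrightarrow> \<exists>x\<in>path_algebra. \<exists>y\<in>path_algebra. x * a * y = shift [w] [w]"
    using compress_to_vertex[OF assms(1,2)] by metis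
  obtain B v' where B: "finite B" "v' \<in> Field \<kappa>"
    "\<And>w. \<lbrakk>prec v' w; w \<notin> B\<rbrakk> \<Longrightarrow> \<exists>x\<in>path_algebra. \<exists>y\<in>path_algebra. x * b * y = shift [w] [w]"
    using compress_to_vertex[OF assms(3,4)] by metis
  let ?C = "{v, v'} \<union> (A \<union> B) \<inter> Field \<kappa>"
  have "countable ?C" using A(1) B(1) by (intro countable_finite) simp
  then obtain w where w: "\<forall>c\<in>?C. prec c w" "w \<in> Field \<kappa>"
    using countable_bound[of ?C] A(2) B(2) by auto
  then have "prec v w" "prec v' w" "w \<notin> A" "w \<notin> B" using prec_irrefl by blast+
  then obtain x y z u where *: "x \<in> path_algebra" "y \<in> path_algebra" "z \<in> path_algebra"
    "u \<in> path_algebra" "x * a * y = shift [w] [w]" "z * b * u = shift [w] [w]"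
    using A(3) B(3) by metis
  have "(x * a * y) * (z * b * u) \<noteq> 0"
    unfolding *(5,6) by (simp add: shift_nonzero)
  with * show ?thesis by metis
qed

text \<open>
  The left ideal \<open>N\<close> plays the role of the annihilator of an element \<open>m\<close> of a simple faithful
  module; \<open>a - a r \<in> N\<close> for all \<open>a\<close> expresses that \<open>r m = m\<close>.
\<close>

theorem path_algebra_not_primitive:
  fixes N :: "('o list, 'k::field) lin_op set"
  assumes N: "N \<subset> path_algebra" "0 \<in> N" "\<And>m n. m \<in> N \<Longrightarrow> n \<in> N \<Longrightarrow> m + n \<in> N"
      "\<And>a n. a \<in> path_algebra \<Longrightarrow> n \<in> N \<Longrightarrow> a * n \<in> N"
    and unit: "\<And>v. v \<in> Field \<kappa> \<Longrightarrow>
      \<exists>r\<in>op.span (path_shifts {u. u = v \<or> prec v u}). \<forall>a\<in>path_algebra. a - a * r \<in> N"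
  shows False
proof -
  define ghost :: "'o list \<Rightarrow> ('o list, 'k) lin_op" where "ghost \<beta> = shift [last \<beta>] \<beta>" for \<beta>
  define B where "B = {\<beta>. path \<beta> \<and> ghost \<beta> \<notin> N}"
  define up where "up v = {u. u = v \<or> prec v u}" for v
  have ghost: "ghost \<beta> \<in> path_algebra" if "path \<beta>" for \<beta>
    unfolding ghost_def using that path_single path_last_Field
    by (intro shift_in_path_algebra) (simp add: coterminal_def)
  \<comment> \<open>The first paths of the terms of \<open>r\<close> catch \<open>B\<close>, and one of the second paths lies in \<open>B\<close>.\<close>
  have "\<exists>F. finite F \<and> (\<forall>i\<in>F. path i \<and> last i \<in> up v) \<and>
      (\<forall>\<beta>\<in>B. \<exists>i\<in>F. prefix i \<beta> \<or> prefix \<beta> i) \<and> (\<exists>\<beta>\<in>B. last \<beta> \<in> up v)"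
    if v: "v \<in> Field \<kappa>" for v
  proof -
    obtain r where r: "r \<in> op.span (path_shifts (up v))" "\<And>a. a \<in> path_algebra \<Longrightarrow> a - a * r \<in> N"
      using unit[OF v] unfolding up_def by auto
    obtain Q where Q: "finite Q" "\<And>i j. (i, j) \<in> Q \<Longrightarrow> coterminal i j \<and> last j \<in> up v"
      "r \<in> op.span ((\<lambda>(i, j). shift i j) ` Q)"
      using span_path_shifts_finite[OF r(1)] by auto
    \<comment> \<open>Right multiplication by \<open>r\<close> does not change the class of an element modulo \<open>N\<close>.\<close>
    have *: "a * r \<notin> N" if "a \<in> path_algebra" "a \<notin> N" for a
      using N(3)[OF r(2)[OF that(1)], of "a * r"] that(2) by auto
    have "\<exists>(i, j)\<in>Q. j \<in> B"
    proof (rule ccontr)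
      assume "\<not> (\<exists>(i, j)\<in>Q. j \<in> B)"
      then have gN: "ghost j \<in> N" if "(i, j) \<in> Q" for i j
        using that Q(2)[OF that] by (auto simp: B_def coterminal_def)
      have "\<forall>a\<in>path_algebra. a * r \<in> N"
        using Q(3)
      proof (induction rule: op.span_induct_alt)
        case base
        then show ?case using N(2) by simp
      next
        case (step c x y)
        then obtain i j where ij: "x = shift i j" "(i, j) \<in> Q" by auto
        then have par: "coterminal i j" using Q(2) by blast
        show ?case
        proof
          fix a :: "('o list, 'k) lin_op" assume a: "a \<in> path_algebra"
          have "coterminal i [last j]" using par path_single path_last_Field by (simp add: coterminal_def)
          then have "op_scale c (a * shift i [last j]) \<in> path_algebra"
            using a by (intro path_algebra_simps path_algebra_mult shift_in_path_algebra)
          then have "op_scale c (a * shift i [last j]) * ghost j \<in> N"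
            using N(4) gN ij(2) by blast
          also have "op_scale c (a * shift i [last j]) * ghost j = a * op_scale c x"
            by (simp add: ghost_def ij(1) op_scale_mult_left op_scale_mult_right mult.assoc)
          finally show "a * (op_scale c x + y) \<in> N"
            using N(3) step.IH a by (simp add: distrib_left)
        qed
      qed
      then show False using * N(1) by blast
    qed
    then obtain i0 \<beta>0 where \<beta>0: "(i0, \<beta>0) \<in> Q" "\<beta>0 \<in> B" by blast
    have "\<exists>i\<in>fst ` Q. prefix i \<beta> \<or> prefix \<beta> i" if \<beta>: "\<beta> \<in> B" for \<beta>
    proof (rule ccontr)
      assume none: "\<not> (\<exists>i\<in>fst ` Q. prefix i \<beta> \<or> prefix \<beta> i)"
      have "ghost \<beta> * r = 0"
        using Q(3)
      proof (induction rule: op.span_induct_alt)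
        case (step c x y)
        then obtain i j where ij: "x = shift i j" "(i, j) \<in> Q" by auto
        then have "ghost \<beta> * x = 0"
          unfolding ghost_def using none by (force intro: shift_mult_zero)
        then show ?case using step by (simp add: distrib_left op_scale_mult_right)
      qed simp
      then show False using *[of "ghost \<beta>"] \<beta> ghost N(2) by (simp add: B_def)
    qed
    then show ?thesis
      using Q(1,2) \<beta>0 by (intro exI[of _ "fst ` Q"]) (auto simp: coterminal_def)
  qed
  then obtain F where F: "\<And>v. v \<in> Field \<kappa> \<Longrightarrow> finite (F v)"
    "\<And>v i. v \<in> Field \<kappa> \<Longrightarrow> i \<in> F v \<Longrightarrow> path i \<and> last i \<in> up v"
    "\<And>v \<beta>. v \<in> Field \<kappa> \<Longrightarrow> \<beta> \<in> B \<Longrightarrow> \<exists>i\<in>F v. prefix i \<beta> \<or> prefix \<beta> i"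
    "\<And>v. v \<in> Field \<kappa> \<Longrightarrow> \<exists>\<beta>\<in>B. last \<beta> \<in> up v"
    by metis
  have "\<exists>w\<in>Field \<kappa>. \<forall>i\<in>F v. prec (last i) w" if "v \<in> Field \<kappa>" for v
    using countable_bound[of "last ` F v"] F(1,2)[OF that] path_last_Field
    by (auto intro: countable_finite)
  then obtain nxt where nxt: "\<And>v. v \<in> Field \<kappa> \<Longrightarrow> nxt v \<in> Field \<kappa>"
    "\<And>v i. v \<in> Field \<kappa> \<Longrightarrow> i \<in> F v \<Longrightarrow> prec (last i) (nxt v)"
    by metis
  obtain v0 where "v0 \<in> Field \<kappa>" using countable_bound[of "{}"] by auto
  define v where "v n = (nxt ^^ n) v0" for n
  have vF: "v n \<in> Field \<kappa>" for n
    by (induction n) (auto simp: v_def nxt \<open>v0 \<in> Field \<kappa>\<close>)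
  have v_Suc: "prec (last i) (v (Suc n))" if "i \<in> F (v n)" for i n
    using nxt(2)[OF vF that] by (simp add: v_def)
  have step: "prec (v n) (v (Suc n))" for n
  proof -
    obtain i where "i \<in> F (v n)" using F(3,4)[OF vF] by blast
    then have "last i = v n \<or> prec (v n) (last i)" "prec (last i) (v (Suc n))"
      using v_Suc F(2)[OF vF, of i n] by (auto simp: up_def)
    then show ?thesis using prec_trans[of "v n" "last i"] by auto
  qed
  have mono: "prec (v m) (v n)" if "m < n" for m n
    using that
  proof (induction rule: less_Suc_induct)
    case (1 i)
    show ?case by (rule step)
  next
    case (2 i j k)
    from 2(3,4) show ?case by (rule prec_trans)
  qed
  obtain w where w: "w \<in> Field \<kappa>" "\<And>n. prec (v n) w"
    using countable_bound[of "range v"] vF by auto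
  obtain \<beta> where \<beta>: "\<beta> \<in> B" "last \<beta> \<in> up w" using F(4)[OF w(1)] by blast
  have v_\<beta>: "prec (v n) (last \<beta>)" for n
    using w(2)[of n] \<beta>(2) prec_trans[of "v n" w "last \<beta>"] by (auto simp: up_def)
  obtain g where g: "\<And>n. g n \<in> F (v n)" "\<And>n. prefix (g n) \<beta> \<or> prefix \<beta> (g n)"
    using F(3)[OF vF \<beta>(1)] by metis
  \<comment> \<open>A prolongation of \<open>\<beta>\<close> ends above \<open>\<beta>\<close>, hence above \<open>v (Suc n)\<close>.\<close>
  have "prefix (g n) \<beta>" for n
  proof (rule ccontr)
    assume "\<not> prefix (g n) \<beta>"
    then obtain m where m: "g n = \<beta> @ m" "m \<noteq> []" using g(2)[of n] by (auto simp: prefix_def)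
    have "path (g n)" using F(2)[OF vF g(1)] by blast
    then have "prec (last \<beta>) (last (g n))"
      using path_append_last[of \<beta> m] m \<beta>(1) by (auto simp: B_def path_nonempty)
    then show False
      using prec_trans[OF v_Suc[OF g(1)[of n]] v_\<beta>[of "Suc n"]] prec_asym by simp
  qed
  then have "range g \<subseteq> set (prefixes \<beta>)" by auto
  moreover have "prec (last (g m)) (last (g n))" if "m < n" for m n
  proof -
    have "v (Suc m) = v n \<or> prec (v (Suc m)) (v n)"
      using that mono[of "Suc m" n] by (cases "Suc m = n") auto
    moreover have "last (g n) = v n \<or> prec (v n) (last (g n))"
      using F(2)[OF vF g(1)] by (auto simp: up_def)
    ultimately show ?thesis using v_Suc[OF g(1)[of m]] prec_trans by metis
  qed
  then have "inj g"
    by (metis injI linorder_neqE_nat prec_irrefl)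
  ultimately show False
    using finite_subset[of "range g" "set (prefixes \<beta>)"] range_inj_infinite[of g] by simp
qed

end

section \<open>Dimension\<close>

lemma orthogonal_independent:
  fixes S :: "('p, 'k::field) lin_op set"
  assumes orth: "\<And>a b. \<lbrakk>a \<in> S; b \<in> S; a \<noteq> b\<rbrakk> \<Longrightarrow> a * b = 0" and nz: "\<And>a. a \<in> S \<Longrightarrow> a * a \<noteq> 0"
  shows "op.independent S"
proof
  assume "op.dependent S"
  then obtain t u b where t: "finite t" "t \<subseteq> S" "(\<Sum>a\<in>t. op_scale (u a) a) = 0" "b \<in> t" "u b \<noteq> 0"
    unfolding op.dependent_explicit by blast
  have "0 = (\<Sum>a\<in>t. op_scale (u a) a) * b" using t(3) by simp
  also have "\<dots> = (\<Sum>a\<in>t. op_scale (u a) (a * b))" by (simp add: sum_distrib_right op_scale_mult_left)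
  also have "\<dots> = (\<Sum>a\<in>{b}. op_scale (u a) (a * b))"
  proof (rule sum.mono_neutral_right)
    show "\<forall>a\<in>t - {b}. op_scale (u a) (a * b) = 0" using orth t by auto
  qed (use t in auto)
  also have "\<dots> = op_scale (u b) (b * b)" by simp
  finally show False using nz t by auto
qed

text \<open>An infinite set has as many finite subsets as elements.\<close>

lemma lepoll_finite_fibres:
  assumes "infinite B" and fin: "\<And>W. W \<in> Fpow B \<Longrightarrow> finite {a\<in>A. f a = W}" and "f ` A \<subseteq> Fpow B"
  shows "lepoll A B"
proof -
  have "|A| \<le>o |B|"
  proof -
    have "A \<subseteq> (\<Union>W\<in>Fpow B. {a\<in>A. f a = W})" using assms(3) by auto
    then have "|A| \<le>o |\<Union>W\<in>Fpow B. {a\<in>A. f a = W}|" by (rule card_of_mono1)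
    also have "|\<Union>W\<in>Fpow B. {a\<in>A. f a = W}| \<le>o |B|"
    proof (rule card_of_UNION_ordLeq_infinite[OF assms(1)])
      show "|Fpow B| \<le>o |B|"
        using eqpoll_Fpow[OF assms(1)] by (simp add: eqpoll_iff_card_of_ordIso ordIso_imp_ordLeq)
      show "\<forall>W\<in>Fpow B. |{a\<in>A. f a = W}| \<le>o |B|"
      proof
        fix W assume "W \<in> Fpow B"
        from fin[OF this] assms(1) show "|{a\<in>A. f a = W}| \<le>o |B|"
          by (intro ordLess_imp_ordLeq finite_ordLess_infinite2)
      qed
    qed
    finally show ?thesis .
  qed
  then show ?thesis unfolding lepoll_def card_of_ordLeq .
qed

text \<open>
  An injective map that preserves products and zero suffices: it maps the vertices to orthogonal
  nonzero idempotents. Linearity is not needed.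
\<close>

lemma path_algebra_dimension:
  fixes \<kappa> \<mu> :: "'o rel" and h :: "('o list, 'k::field) lin_op \<Rightarrow> ('o list, 'k) lin_op"
  assumes wo: "ordinal_paths \<kappa>" "ordinal_paths \<mu>" and inf: "infinite (Field \<mu>)"
    and h: "inj_on h (ordinal_paths.path_algebra \<kappa>)"
      "h ` ordinal_paths.path_algebra \<kappa> \<subseteq> ordinal_paths.path_algebra \<mu>"
      "h 0 = 0"
      "\<And>a b. \<lbrakk>a \<in> ordinal_paths.path_algebra \<kappa>; b \<in> ordinal_paths.path_algebra \<kappa>\<rbrakk> \<Longrightarrow> h (a * b) = h a * h b"
  shows "lepoll (Field \<kappa>) (Field \<mu>)"
proof -
  interpret K: ordinal_paths \<kappa> by (rule wo)
  interpret M: ordinal_paths \<mu> by (rule wo)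
  define e :: "'o \<Rightarrow> ('o list, 'k) lin_op" where "e v = h (shift [v] [v])" for v
  have V: "shift [v] [v] \<in> (K.path_algebra :: ('o list, 'k) lin_op set)" if "v \<in> Field \<kappa>" for v
    using that by (intro K.shift_in_path_algebra) (simp add: K.coterminal_def K.path_single)
  have orth: "e v * e w = (if v = w then e v else 0)" if "v \<in> Field \<kappa>" "w \<in> Field \<kappa>" for v w
    unfolding e_def using V[OF that(1)] V[OF that(2)]
    by (subst h(4)[symmetric]) (auto simp: shift_mult_zero h(3))
  have nz: "e v \<noteq> 0" if "v \<in> Field \<kappa>" for v
  proof
    assume "e v = 0"
    then have "h (shift [v] [v]) = h 0" by (simp add: e_def h(3))
    then have "shift [v] [v] = (0 :: ('o list, 'k) lin_op)"
      using V[OF that] K.path_algebra_simps(1) by (rule inj_onD[OF h(1)])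
    then show False by (simp add: shift_nonzero)
  qed
  have inj: "inj_on e (Field \<kappa>)"
    by (rule inj_onI) (metis orth nz)
  have "\<exists>U. U \<in> Fpow (Field \<mu>) \<and> e v \<in> M.algebra_in U" if "v \<in> Field \<kappa>" for v
  proof -
    have "e v \<in> M.path_algebra" unfolding e_def using h(2) V[OF that] by auto
    from M.path_algebra_finite_support[OF this] show ?thesis unfolding Fpow_def by auto
  qed
  then obtain U where U: "\<And>v. v \<in> Field \<kappa> \<Longrightarrow> U v \<in> Fpow (Field \<mu>) \<and> e v \<in> M.algebra_in (U v)"
    by metis
  show ?thesis
  proof (rule lepoll_finite_fibres[OF inf])
    show "U ` Field \<kappa> \<subseteq> Fpow (Field \<mu>)" using U by auto
    fix W assume W: "W \<in> Fpow (Field \<mu>)"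
    let ?A = "{v\<in>Field \<kappa>. U v = W}"
    let ?S = "(\<lambda>(i, j). shift i j) ` (M.paths_in W \<times> M.paths_in W) :: ('o list, 'k) lin_op set"
    have "finite ?S"
      using W M.finite_paths unfolding M.paths_in_def Fpow_def by simp
    moreover have "op.independent (e ` ?A)"
      by (rule orthogonal_independent) (use orth nz in auto)
    moreover have "e ` ?A \<subseteq> op.span ?S"
    proof -
      have "M.algebra_in W \<subseteq> op.span ?S"
        unfolding M.algebra_in_def by (rule op.span_mono) auto
      then show ?thesis using U by blast
    qed
    ultimately have "finite (e ` ?A)" using op.independent_span_bound by blast
    then show "finite ?A"
      using inj finite_imageD inj_on_subset[OF inj, of ?A] by blast
  qed
qed

section \<open>The free algebra and its evaluation\<close>

lemma sum_single: "(\<Sum>w\<in>Poly_Mapping.keys f. Poly_Mapping.single w (poly_mapping.lookup f w)) = f"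
proof (rule poly_mapping_eqI)
  fix w
  show "poly_mapping.lookup (\<Sum>u\<in>Poly_Mapping.keys f. Poly_Mapping.single u (poly_mapping.lookup f u)) w = poly_mapping.lookup f w"
    by (simp add: lookup_sum lookup_single when_def in_keys_iff)
qed

text \<open>Scalar multiplication of noncommutative polynomials.\<close>

abbreviation pm_scale :: "'k::field \<Rightarrow> ('g list \<Rightarrow>\<^sub>0 'k) \<Rightarrow> 'g list \<Rightarrow>\<^sub>0 'k" where
  "pm_scale c \<equiv> Poly_Mapping.map ((*) c)"

lemma pm_scale_conv: "pm_scale c f = Poly_Mapping.single [] c * f"
  by (simp add: mult_map_scale_conv_mult zero_list_def)

lemma lookup_pm_scale: "poly_mapping.lookup (pm_scale c f) w = c * poly_mapping.lookup f w"
  by (simp add: Poly_Mapping.map.rep_eq when_def)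

lemma keys_pm_scale: "Poly_Mapping.keys (pm_scale c f) \<subseteq> Poly_Mapping.keys f"
  by (auto simp: in_keys_iff lookup_pm_scale)

lemma pm_scale_minus_one: "pm_scale (- 1) f = - f"
  by (rule poly_mapping_eqI) (simp add: lookup_pm_scale)

text \<open>Evaluation of words and of noncommutative polynomials at a family \<open>\<rho>\<close> of operators.\<close>

definition word_op :: "('g \<Rightarrow> ('p, 'k::field) lin_op) \<Rightarrow> 'g list \<Rightarrow> ('p, 'k) lin_op" where
  "word_op \<rho> w = prod_list (map \<rho> w)"

definition eval_op :: "('g \<Rightarrow> ('p, 'k::field) lin_op) \<Rightarrow> ('g list \<Rightarrow>\<^sub>0 'k) \<Rightarrow> ('p, 'k) lin_op" where
  "eval_op \<rho> f = (\<Sum>w\<in>Poly_Mapping.keys f. op_scale (poly_mapping.lookup f w) (word_op \<rho> w))"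

lemma word_op_simps [simp]:
  "word_op \<rho> [] = 1" "word_op \<rho> (g # w) = \<rho> g * word_op \<rho> w"
  "word_op \<rho> (w @ u) = word_op \<rho> w * word_op \<rho> u"
  by (simp_all add: word_op_def)

lemma eval_op_superset:
  assumes "finite S" "Poly_Mapping.keys f \<subseteq> S"
  shows "eval_op \<rho> f = (\<Sum>w\<in>S. op_scale (poly_mapping.lookup f w) (word_op \<rho> w))"
  unfolding eval_op_def using assms by (intro sum.mono_neutral_left) (auto simp: in_keys_iff)

lemma eval_op_zero [simp]: "eval_op \<rho> 0 = 0"
  by (simp add: eval_op_def)

lemma eval_op_add: "eval_op \<rho> (f + g) = eval_op \<rho> f + eval_op \<rho> g"
proof -
  let ?S = "Poly_Mapping.keys f \<union> Poly_Mapping.keys g"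
  have "Poly_Mapping.keys (f + g) \<subseteq> ?S" by (rule keys_add)
  then show ?thesis
    by (simp add: eval_op_superset[of ?S] lookup_add op.scale_left_distrib sum.distrib)
qed

lemma eval_op_scale: "eval_op \<rho> (pm_scale c f) = op_scale c (eval_op \<rho> f)"
  using keys_pm_scale[of c f]
  by (simp add: eval_op_superset[of "Poly_Mapping.keys f"] lookup_pm_scale op.scale_sum_right)

lemma eval_op_uminus: "eval_op \<rho> (- f) = - eval_op \<rho> f"
  using eval_op_add[of \<rho> "- f" f] by (simp add: eq_neg_iff_add_eq_0)

lemma eval_op_diff: "eval_op \<rho> (f - g) = eval_op \<rho> f - eval_op \<rho> g"
  using eval_op_add[of \<rho> f "- g"] by (simp add: eval_op_uminus)

lemma eval_op_sum: "eval_op \<rho> (\<Sum>a\<in>A. f a) = (\<Sum>a\<in>A. eval_op \<rho> (f a))"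
  by (induction A rule: infinite_finite_induct) (simp_all add: eval_op_add)

lemma eval_op_single [simp]: "eval_op \<rho> (Poly_Mapping.single w c) = op_scale c (word_op \<rho> w)"
  by (subst eval_op_superset[of "{w}"]) (auto split: if_splits)

lemma eval_op_mult: "eval_op \<rho> (f * g) = eval_op \<rho> f * eval_op \<rho> g"
proof -
  have "f * g = (\<Sum>w\<in>Poly_Mapping.keys f. Poly_Mapping.single w (poly_mapping.lookup f w)) *
      (\<Sum>u\<in>Poly_Mapping.keys g. Poly_Mapping.single u (poly_mapping.lookup g u))"
    by (simp only: sum_single)
  also have "\<dots> = (\<Sum>w\<in>Poly_Mapping.keys f. \<Sum>u\<in>Poly_Mapping.keys g.
      Poly_Mapping.single (w @ u) (poly_mapping.lookup f w * poly_mapping.lookup g u))"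
    by (simp only: sum_product mult_single plus_list_def)
  finally have "eval_op \<rho> (f * g) = (\<Sum>w\<in>Poly_Mapping.keys f. \<Sum>u\<in>Poly_Mapping.keys g.
      op_scale (poly_mapping.lookup f w * poly_mapping.lookup g u) (word_op \<rho> w * word_op \<rho> u))"
    by (simp only: eval_op_sum eval_op_single word_op_simps)
  also have "\<dots> = eval_op \<rho> f * eval_op \<rho> g"
    by (simp only: eval_op_def sum_product op_scale_mult_left op_scale_mult_right op.scale_scale)
      (simp add: mult.commute)
  finally show ?thesis .
qed

text \<open>The polynomials over \<open>S\<close> without constant term.\<close>

definition free_carrier :: "'g set \<Rightarrow> ('g list \<Rightarrow>\<^sub>0 'k::field) set" where
  "free_carrier S = {f. \<forall>w\<in>Poly_Mapping.keys f. w \<noteq> [] \<and> set w \<subseteq> S}"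

lemma free_simps:
  "carrier (free_nonunital_algebra S :: ('k::field, 'g list \<Rightarrow>\<^sub>0 'k) module) = free_carrier S"
  "monoid.mult (free_nonunital_algebra S) = ((*) :: ('g list \<Rightarrow>\<^sub>0 'k) \<Rightarrow> _)"
  "ring.add (free_nonunital_algebra S) = ((+) :: ('g list \<Rightarrow>\<^sub>0 'k) \<Rightarrow> _)"
  "ring.zero (free_nonunital_algebra S) = (0 :: ('g list \<Rightarrow>\<^sub>0 'k))"
  "smult (free_nonunital_algebra S) = (pm_scale :: 'k \<Rightarrow> ('g list \<Rightarrow>\<^sub>0 'k) \<Rightarrow> _)"
  by (simp_all add: free_nonunital_algebra_def free_carrier_def)

lemma free_carrier_zero: "0 \<in> free_carrier S"
  by (simp add: free_carrier_def)

lemma free_carrier_add: "f \<in> free_carrier S \<Longrightarrow> g \<in> free_carrier S \<Longrightarrow> f + g \<in> free_carrier S"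
  using keys_add[of f g] unfolding free_carrier_def by blast

lemma free_carrier_scale: "f \<in> free_carrier S \<Longrightarrow> pm_scale c f \<in> free_carrier S"
  using keys_pm_scale[of c f] unfolding free_carrier_def by blast

lemma free_carrier_uminus: "f \<in> free_carrier S \<Longrightarrow> - f \<in> free_carrier S"
  using free_carrier_scale[of f S "- 1"] by (simp only: pm_scale_minus_one)

lemma free_carrier_diff: "f \<in> free_carrier S \<Longrightarrow> g \<in> free_carrier S \<Longrightarrow> f - g \<in> free_carrier S"
  using free_carrier_add[of f S "- g"] free_carrier_uminus[of g S] by simp

lemma free_carrier_mult:
  assumes "f \<in> free_carrier S" "g \<in> free_carrier S" shows "f * g \<in> free_carrier S"
  unfolding free_carrier_def
proof (intro CollectI ballI)
  fix w assume "w \<in> Poly_Mapping.keys (f * g)"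
  then obtain u v where "w = u @ v" "u \<in> Poly_Mapping.keys f" "v \<in> Poly_Mapping.keys g"
    using keys_mult[of f g] by (auto simp: plus_list_def)
  then show "w \<noteq> [] \<and> set w \<subseteq> S" using assms by (auto simp: free_carrier_def)
qed

lemma free_carrier_single: "w \<noteq> [] \<Longrightarrow> set w \<subseteq> S \<Longrightarrow> Poly_Mapping.single w c \<in> free_carrier S"
  by (simp add: free_carrier_def)

lemma free_a_inv:
  fixes f :: "'g list \<Rightarrow>\<^sub>0 'k::field"
  assumes "f \<in> free_carrier S"
  shows "inv\<^bsub>add_monoid (free_nonunital_algebra S :: ('k, 'g list \<Rightarrow>\<^sub>0 'k) module)\<^esub> f = - f"
  unfolding m_inv_def
proof (rule the_equality)
  show "- f \<in> carrier (add_monoid (free_nonunital_algebra S)) \<and>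
    f \<otimes>\<^bsub>add_monoid (free_nonunital_algebra S)\<^esub> - f = \<one>\<^bsub>add_monoid (free_nonunital_algebra S)\<^esub> \<and>
    - f \<otimes>\<^bsub>add_monoid (free_nonunital_algebra S)\<^esub> f = \<one>\<^bsub>add_monoid (free_nonunital_algebra S)\<^esub>"
    using free_carrier_uminus[OF assms] by (simp add: free_simps)
qed (simp add: free_simps eq_neg_iff_add_eq_0)

lemma algebra_ideal_freeI:
  fixes J :: "('g list \<Rightarrow>\<^sub>0 'k::field) set"
  assumes J: "J \<subseteq> free_carrier S" "0 \<in> J" "\<And>f g. f \<in> J \<Longrightarrow> g \<in> J \<Longrightarrow> f + g \<in> J"
    "\<And>c f. f \<in> J \<Longrightarrow> pm_scale c f \<in> J"
    "\<And>f g. f \<in> free_carrier S \<Longrightarrow> g \<in> J \<Longrightarrow> f * g \<in> J \<and> g * f \<in> J"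
  shows "algebra_ideal J (free_nonunital_algebra S)"
proof -
  let ?F = "free_nonunital_algebra S :: ('k, 'g list \<Rightarrow>\<^sub>0 'k) module"
  have "subgroup J (add_monoid ?F)"
  proof
    fix f assume f: "f \<in> J"
    have "inv\<^bsub>add_monoid ?F\<^esub> f = pm_scale (- 1) f"
      unfolding pm_scale_minus_one using f J(1) by (intro free_a_inv) (rule subsetD)
    then show "inv\<^bsub>add_monoid ?F\<^esub> f \<in> J" using J(4)[OF f] by (simp only:)
  qed (use J(1-3) in \<open>simp_all add: free_simps\<close>)
  then have "additive_subgroup J ?F" by (rule additive_subgroup.intro)
  then show ?thesis
    unfolding algebra_ideal_def two_sided_ideal_def free_simps using J(4,5) by simp
qed

lemma algebra_ideal_freeD:
  fixes J :: "('g list \<Rightarrow>\<^sub>0 'k::field) set"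
  assumes "algebra_ideal J (free_nonunital_algebra S)"
  shows "J \<subseteq> free_carrier S" "0 \<in> J" "\<And>f g. f \<in> J \<Longrightarrow> g \<in> J \<Longrightarrow> f + g \<in> J"
    "\<And>c f. f \<in> J \<Longrightarrow> pm_scale c f \<in> J"
    "\<And>f g. f \<in> free_carrier S \<Longrightarrow> g \<in> J \<Longrightarrow> f * g \<in> J \<and> g * f \<in> J"
proof -
  have J: "additive_subgroup J (free_nonunital_algebra S)"
    using assms by (simp add: algebra_ideal_def two_sided_ideal_def)
  show "J \<subseteq> free_carrier S" "0 \<in> J" "\<And>f g. f \<in> J \<Longrightarrow> g \<in> J \<Longrightarrow> f + g \<in> J"
    using additive_subgroup.a_subset[OF J] additive_subgroup.zero_closed[OF J]
      additive_subgroup.a_closed[OF J] by (simp_all add: free_simps)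
  show "\<And>c f. f \<in> J \<Longrightarrow> pm_scale c f \<in> J"
    "\<And>f g. f \<in> free_carrier S \<Longrightarrow> g \<in> J \<Longrightarrow> f * g \<in> J \<and> g * f \<in> J"
    using assms unfolding algebra_ideal_def two_sided_ideal_def free_simps by simp_all
qed

section \<open>Normal forms\<close>

text \<open>
  The representing operators of the generators: \<open>v = v v\<^sup>*\<close>, \<open>e = e r(e)\<^sup>*\<close> and
  \<open>e\<^sup>* = r(e) e\<^sup>*\<close>.
\<close>

definition gen_shift :: "('o, 'o \<times> 'o) lpa_gen \<Rightarrow> ('o list, 'k::field) lin_op" where
  "gen_shift g = (case g of Vert v \<Rightarrow> shift [v] [v] | Edge e \<Rightarrow> shift [fst e, snd e] [snd e]
     | Ghost e \<Rightarrow> shift [snd e] [fst e, snd e])"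

lemma gen_shift_simps [simp]:
  "gen_shift (Vert v) = shift [v] [v]" "gen_shift (Edge (a, b)) = shift [a, b] [b]"
  "gen_shift (Ghost (a, b)) = shift [b] [a, b]"
  by (simp_all add: gen_shift_def)

text \<open>
  The normal form of \<open>i j\<^sup>*\<close>: the edges of \<open>i\<close>, the common last vertex, and the ghost edges
  of \<open>j\<close> in reverse order.
\<close>

definition edge_word :: "'o list \<Rightarrow> ('o, 'o \<times> 'o) lpa_gen list" where
  "edge_word i = map Edge (zip i (tl i))"

definition ghost_word :: "'o list \<Rightarrow> ('o, 'o \<times> 'o) lpa_gen list" where
  "ghost_word i = rev (map Ghost (zip i (tl i)))"

definition path_word :: "'o list \<Rightarrow> 'o list \<Rightarrow> ('o, 'o \<times> 'o) lpa_gen list" where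
  "path_word i j = edge_word i @ Vert (last i) # ghost_word j"

lemma edge_word_simps [simp]:
  "edge_word [v] = []" "edge_word (a # b # t) = Edge (a, b) # edge_word (b # t)"
  by (simp_all add: edge_word_def)

lemma ghost_word_single [simp]: "ghost_word [v] = []"
  by (simp add: ghost_word_def)

lemma ghost_word_Cons: "ghost_word (a # b # t) = ghost_word (b # t) @ [Ghost (a, b)]"
  by (simp add: ghost_word_def)

lemma ghost_word_snoc: "j \<noteq> [] \<Longrightarrow> ghost_word (j @ [b]) = Ghost (last j, b) # ghost_word j"
proof (induction j)
  case (Cons a j)
  then show ?case by (cases j) (simp_all add: ghost_word_Cons)
qed simp

lemma edge_word_op: "i \<noteq> [] \<Longrightarrow> word_op gen_shift (edge_word i @ [Vert (last i)]) =
    (shift i [last i] :: ('o list, 'k::field) lin_op)"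
proof (induction i)
  case (Cons a i)
  show ?case
  proof (cases i)
    case (Cons b t)
    then have "word_op gen_shift (edge_word (a # i) @ [Vert (last (a # i))]) =
        (shift [a, b] [b] * shift i [last i] :: ('o list, 'k) lin_op)"
      using Cons.IH by (cases "t = []") (simp_all add: mult.assoc)
    also have "\<dots> = shift (a # i) [last i]"
      using shift_mult_append[of "[a, b]" "[b]" t "[last i]"] Cons by simp
    finally show ?thesis using Cons by simp
  qed simp
qed simp

lemma ghost_word_op: "i \<noteq> [] \<Longrightarrow> word_op gen_shift (Vert (last i) # ghost_word i) =
    (shift [last i] i :: ('o list, 'k::field) lin_op)"
proof (induction i)
  case (Cons a i)
  show ?case
  proof (cases i)
    case (Cons b t)
    then have "word_op gen_shift (Vert (last (a # i)) # ghost_word (a # i)) =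
        (shift [last i] i * shift [b] [a, b] :: ('o list, 'k) lin_op)"
      using Cons.IH by (cases "t = []") (simp_all add: ghost_word_Cons mult.assoc[symmetric])
    also have "\<dots> = shift [last i] (a # i)"
      using shift_append_mult[of "[last i]" "[b]" t "[a, b]"] Cons by simp
    finally show ?thesis using Cons by simp
  qed simp
qed simp

lemma path_word_op:
  assumes "i \<noteq> []" "j \<noteq> []" "last i = last j"
  shows "word_op gen_shift (path_word i j) = (shift i j :: ('o list, 'k::field) lin_op)"
proof -
  have "shift i j = (shift i [last i] * shift [last j] j :: ('o list, 'k) lin_op)" using assms by simp
  also have "\<dots> = word_op gen_shift (edge_word i) * (shift [last i] [last i] * shift [last i] [last i])
      * word_op gen_shift (ghost_word j)"
    unfolding edge_word_op[OF assms(1), symmetric] ghost_word_op[OF assms(2), symmetric]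
    using assms(3) by (simp add: mult.assoc del: shift_mult_same)
  also have "\<dots> = word_op gen_shift (path_word i j)"
    by (simp add: path_word_def mult.assoc)
  finally show ?thesis by simp
qed

text \<open>A word as an element of the free algebra.\<close>

abbreviation wd :: "'g list \<Rightarrow> 'g list \<Rightarrow>\<^sub>0 'k::field" where
  "wd w \<equiv> Poly_Mapping.single w 1"

lemma wd_mult: "wd u * wd v = wd (u @ v)"
  by (simp add: mult_single plus_list_def)

context uncountable_ordinal_paths
begin

abbreviation gens :: "('o, 'o \<times> 'o) lpa_gen set" where
  "gens \<equiv> lpa_gens (ordinal_digraph \<kappa>)"

text \<open>The ideal of relations of the Leavitt path algebra.\<close>

definition lpa_ideal :: "(('o, 'o \<times> 'o) lpa_gen list \<Rightarrow>\<^sub>0 'k::field) set" where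
  "lpa_ideal = gen_algebra_ideal (free_nonunital_algebra gens) (lpa_relators (ordinal_digraph \<kappa>))"

lemma digraph_simps [simp]:
  "verts (ordinal_digraph \<kappa>) = Field \<kappa>" "tail (ordinal_digraph \<kappa>) = fst"
  "head (ordinal_digraph \<kappa>) = snd" "(a, b) \<in> arcs (ordinal_digraph \<kappa>) \<longleftrightarrow> prec a b"
  by (auto simp: ordinal_digraph_def prec_def)

lemma gens_simps [simp]:
  "Vert v \<in> gens \<longleftrightarrow> v \<in> Field \<kappa>" "Edge (a, b) \<in> gens \<longleftrightarrow> prec a b" "Ghost (a, b) \<in> gens \<longleftrightarrow> prec a b"
  by (auto simp: lpa_gens_def)

text \<open>This makes (CK2) vacuous.\<close>

lemma infinite_emitter:
  assumes "v \<in> Field \<kappa>" shows "infinite (out_arcs (ordinal_digraph \<kappa>) v)"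
proof
  assume fin: "finite (out_arcs (ordinal_digraph \<kappa>) v)"
  let ?C = "insert v (snd ` out_arcs (ordinal_digraph \<kappa>) v)"
  have "?C \<subseteq> Field \<kappa>"
    using assms prec_Field by (auto simp: out_arcs_def)
  moreover have "countable ?C" using fin by (intro countable_finite) simp
  ultimately obtain w where w: "\<forall>c\<in>?C. prec c w" using countable_bound by meson
  then have "(v, w) \<in> out_arcs (ordinal_digraph \<kappa>) v" by (simp add: out_arcs_def)
  then have "w \<in> ?C" using image_eqI[of w snd "(v, w)"] by simp
  then show False using w prec_irrefl by blast
qed

lemma relator_cases:
  assumes "R \<in> (lpa_relators (ordinal_digraph \<kappa>) :: (('o, 'o \<times> 'o) lpa_gen list \<Rightarrow>\<^sub>0 'k::field) set)"
  obtains v w where "v \<in> Field \<kappa>" "w \<in> Field \<kappa>" "R = wd [Vert v, Vert w] - (if v = w then wd [Vert v] else 0)"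
  | a b where "prec a b" "R = wd [Vert a, Edge (a, b)] - wd [Edge (a, b)]"
  | a b where "prec a b" "R = wd [Edge (a, b), Vert b] - wd [Edge (a, b)]"
  | a b where "prec a b" "R = wd [Vert b, Ghost (a, b)] - wd [Ghost (a, b)]"
  | a b where "prec a b" "R = wd [Ghost (a, b), Vert a] - wd [Ghost (a, b)]"
  | a b c d where "prec a b" "prec c d"
      "R = wd [Ghost (a, b), Edge (c, d)] - (if a = c \<and> b = d then wd [Vert b] else 0)"
proof -
  let ?G = "ordinal_digraph \<kappa>"
  from assms show thesis
    unfolding lpa_relators_def gen_def wd_mult append_Cons append_Nil digraph_simps
  proof (elim UnE CollectE exE conjE)
    fix v w assume "R = wd [Vert v, Vert w] - (if v = w then wd [Vert v] else 0)" "v \<in> Field \<kappa>" "w \<in> Field \<kappa>"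
    then show thesis by (intro that(1))
  next
    fix e assume "R = wd [Vert (fst e), Edge e] - wd [Edge e]" "e \<in> arcs ?G"
    then show thesis by (cases e) (simp add: that(2))
  next
    fix e assume "R = wd [Edge e, Vert (snd e)] - wd [Edge e]" "e \<in> arcs ?G"
    then show thesis by (cases e) (simp add: that(3))
  next
    fix e assume "R = wd [Vert (snd e), Ghost e] - wd [Ghost e]" "e \<in> arcs ?G"
    then show thesis by (cases e) (simp add: that(4))
  next
    fix e assume "R = wd [Ghost e, Vert (fst e)] - wd [Ghost e]" "e \<in> arcs ?G"
    then show thesis by (cases e) (simp add: that(5))
  next
    fix e f assume *: "R = wd [Ghost e, Edge f] - (if e = f then wd [Vert (snd e)] else 0)"
      "e \<in> arcs ?G" "f \<in> arcs ?G"
    obtain a b c d where "e = (a, b)" "f = (c, d)" by (cases e, cases f)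
    with * show thesis by (intro that(6)[of a b c d]) simp_all
  next
    fix v assume "v \<in> Field \<kappa>" "finite (out_arcs ?G v)"
    then show thesis using infinite_emitter by simp
  qed
qed

lemma relators:
  fixes R :: "('o, 'o \<times> 'o) lpa_gen list \<Rightarrow>\<^sub>0 'k::field"
  assumes "R \<in> lpa_relators (ordinal_digraph \<kappa>)"
  shows "R \<in> free_carrier gens" "eval_op gen_shift R = 0"
proof -
  have "R \<in> free_carrier gens \<and> eval_op gen_shift R = 0"
    using assms
  proof (cases rule: relator_cases)
    case (1 v w)
    then show ?thesis
      by (auto simp: eval_op_diff shift_mult_zero
          intro!: free_carrier_diff free_carrier_single free_carrier_zero)
  next
    case (2 a b)
    then show ?thesis using prec_Field[of a b] shift_append_mult[of "[a]" "[a]" "[b]" "[b]"] 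
        shift_mult_append[of "[a]" "[a]" "[b]" "[b]"]
      by (auto simp: eval_op_diff intro!: free_carrier_diff free_carrier_single)
  next
    case (3 a b)
    then show ?thesis using prec_Field[of a b]
      by (auto simp: eval_op_diff intro!: free_carrier_diff free_carrier_single)
  next
    case (4 a b)
    then show ?thesis using prec_Field[of a b]
      by (auto simp: eval_op_diff intro!: free_carrier_diff free_carrier_single)
  next
    case (5 a b)
    then show ?thesis using prec_Field[of a b] shift_append_mult[of "[b]" "[a]" "[b]" "[a]"]
      by (auto simp: eval_op_diff intro!: free_carrier_diff free_carrier_single)
  next
    case (6 a b c d)
    then show ?thesis using prec_Field[of a b]
      by (auto simp: eval_op_diff shift_mult_zero
          intro!: free_carrier_diff free_carrier_single free_carrier_zero)
  qed
  then show "R \<in> free_carrier gens" "eval_op gen_shift R = 0" by blast+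
qed

lemma kernel_ideal:
  "algebra_ideal {f \<in> free_carrier gens. eval_op gen_shift f = (0 :: ('o list, 'k::field) lin_op)}
     (free_nonunital_algebra gens)"
  by (rule algebra_ideal_freeI)
    (auto simp: eval_op_add eval_op_scale eval_op_mult free_carrier_zero free_carrier_add
      free_carrier_scale free_carrier_mult)

lemma lpa_ideal_subset:
  fixes f :: "('o, 'o \<times> 'o) lpa_gen list \<Rightarrow>\<^sub>0 'k::field"
  assumes "f \<in> lpa_ideal" shows "f \<in> free_carrier gens \<and> eval_op gen_shift f = 0"
  using assms kernel_ideal[where 'k='k] relators[where 'k='k] unfolding lpa_ideal_def gen_algebra_ideal_def by blast

lemma relator_in_ideal: "R \<in> lpa_relators (ordinal_digraph \<kappa>) \<Longrightarrow> R \<in> lpa_ideal"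
  unfolding lpa_ideal_def gen_algebra_ideal_def by blast

lemma lpa_ideal: "algebra_ideal (lpa_ideal :: (('o, 'o \<times> 'o) lpa_gen list \<Rightarrow>\<^sub>0 'k::field) set)
    (free_nonunital_algebra gens)"
proof (rule algebra_ideal_freeI)
  show "lpa_ideal \<subseteq> free_carrier gens" using lpa_ideal_subset by blast
qed (auto simp: lpa_ideal_def gen_algebra_ideal_def dest: algebra_ideal_freeD)

lemmas ideal_zero = algebra_ideal_freeD(2)[OF lpa_ideal]
  and ideal_add = algebra_ideal_freeD(3)[OF lpa_ideal]
  and ideal_scale = algebra_ideal_freeD(4)[OF lpa_ideal]
  and ideal_mult = algebra_ideal_freeD(5)[OF lpa_ideal]

lemma ideal_uminus: "f \<in> lpa_ideal \<Longrightarrow> - f \<in> lpa_ideal"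
  using ideal_scale[of f "- 1"] by (simp only: pm_scale_minus_one)

lemma ideal_diff: "f \<in> lpa_ideal \<Longrightarrow> g \<in> lpa_ideal \<Longrightarrow> f - g \<in> lpa_ideal"
  using ideal_add[of f "- g"] ideal_uminus[of g] by simp

lemma ideal_sum: "(\<And>a. a \<in> A \<Longrightarrow> f a \<in> lpa_ideal) \<Longrightarrow> sum f A \<in> lpa_ideal"
  by (induction A rule: infinite_finite_induct) (simp_all add: ideal_zero ideal_add)

lemma ideal_wd_mult:
  fixes f :: "('o, 'o \<times> 'o) lpa_gen list \<Rightarrow>\<^sub>0 'k::field"
  assumes "f \<in> lpa_ideal" "set p \<subseteq> gens" "set s \<subseteq> gens" shows "wd p * f * wd s \<in> lpa_ideal"
proof -
  have wd: "wd w = (1 :: _ \<Rightarrow>\<^sub>0 'k) \<or> wd w \<in> (free_carrier gens :: (_ \<Rightarrow>\<^sub>0 'k) set)" if "set w \<subseteq> gens" for w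
    using that free_carrier_single[of w gens] by (cases "w = []") (auto simp: single_one[symmetric] zero_list_def simp del: single_one)
  have "wd p * f \<in> lpa_ideal" using wd[OF assms(2)] ideal_mult assms(1) by auto
  then show ?thesis using wd[OF assms(3)] ideal_mult by auto
qed

end

lemma path_word_Cons: "path_word (a # b # t) j = Edge (a, b) # path_word (b # t) j"
  by (simp add: path_word_def)

lemma path_word_single: "path_word [v] j = Vert v # ghost_word j"
  by (simp add: path_word_def)

text \<open>The parameter \<open>coeff\<close> only fixes the coefficient field.\<close>

locale ordinal_lpa = uncountable_ordinal_paths \<kappa> for \<kappa> :: "'o rel" +
  fixes coeff :: "'k::field itself"
begin

text \<open>
  Words that agree or vanish modulo the ideal of relations, and words that vanish or agree with a
  normal form.
\<close>

definition word_eq :: "('o, 'o \<times> 'o) lpa_gen list \<Rightarrow> ('o, 'o \<times> 'o) lpa_gen list \<Rightarrow> bool" where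
  "word_eq u v \<longleftrightarrow> wd u - wd v \<in> (lpa_ideal :: (_ \<Rightarrow>\<^sub>0 'k) set)"

definition word_null :: "('o, 'o \<times> 'o) lpa_gen list \<Rightarrow> bool" where
  "word_null u \<longleftrightarrow> wd u \<in> (lpa_ideal :: (_ \<Rightarrow>\<^sub>0 'k) set)"

definition reducible :: "('o, 'o \<times> 'o) lpa_gen list \<Rightarrow> bool" where
  "reducible u \<longleftrightarrow> word_null u \<or> (\<exists>i j. coterminal i j \<and> word_eq u (path_word i j))"

lemma word_eq_refl: "word_eq u u"
  by (simp add: word_eq_def ideal_zero)

lemma word_eq_sym: "word_eq u v \<Longrightarrow> word_eq v u"
  using ideal_uminus[of "wd u - wd v :: _ \<Rightarrow>\<^sub>0 'k"] by (simp add: word_eq_def)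

lemma word_eq_trans [trans]: "word_eq u v \<Longrightarrow> word_eq v w \<Longrightarrow> word_eq u w"
  using ideal_add[of "wd u - wd v :: _ \<Rightarrow>\<^sub>0 'k" "wd v - wd w"] by (simp add: word_eq_def)

lemma word_eq_null [trans]: "word_eq u v \<Longrightarrow> word_null v \<Longrightarrow> word_null u"
  using ideal_add[of "wd u - wd v :: _ \<Rightarrow>\<^sub>0 'k" "wd v"] by (simp add: word_eq_def word_null_def)

lemma word_eq_reducible [trans]: "word_eq u v \<Longrightarrow> reducible v \<Longrightarrow> reducible u"
  unfolding reducible_def using word_eq_null word_eq_trans by blast

lemma word_eq_cong: "word_eq u v \<Longrightarrow> set p \<subseteq> gens \<Longrightarrow> set s \<subseteq> gens \<Longrightarrow> word_eq (p @ u @ s) (p @ v @ s)"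
  using ideal_wd_mult[of "wd u - wd v :: _ \<Rightarrow>\<^sub>0 'k" p s]
  by (simp add: word_eq_def right_diff_distrib left_diff_distrib wd_mult)

lemma word_null_cong: "word_null u \<Longrightarrow> set p \<subseteq> gens \<Longrightarrow> set s \<subseteq> gens \<Longrightarrow> word_null (p @ u @ s)"
  using ideal_wd_mult[of "wd u :: _ \<Rightarrow>\<^sub>0 'k" p s] by (simp add: word_null_def wd_mult)

lemmas relator_unfold = lpa_relators_def gen_def wd_mult append_Cons append_Nil digraph_simps

lemma vert_vert: "v \<in> Field \<kappa> \<Longrightarrow> word_eq [Vert v, Vert v] [Vert v]"
  unfolding word_eq_def
  by (rule relator_in_ideal, unfold relator_unfold, rule UnI1, rule UnI1, rule UnI1, rule UnI1,
      rule CollectI, rule exI[of _ v], rule exI[of _ v]) simp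

lemma vert_vert_null: "v \<in> Field \<kappa> \<Longrightarrow> w \<in> Field \<kappa> \<Longrightarrow> v \<noteq> w \<Longrightarrow> word_null [Vert v, Vert w]"
  unfolding word_null_def
  by (rule relator_in_ideal, unfold relator_unfold, rule UnI1, rule UnI1, rule UnI1, rule UnI1,
      rule CollectI, rule exI[of _ v], rule exI[of _ w]) simp

lemma source_edge: "prec a b \<Longrightarrow> word_eq [Vert a, Edge (a, b)] [Edge (a, b)]"
  unfolding word_eq_def
  by (rule relator_in_ideal, unfold relator_unfold, rule UnI1, rule UnI1, rule UnI1, rule UnI2, rule UnI1,
      rule CollectI, rule exI[of _ "(a, b)"]) simp

lemma edge_range: "prec a b \<Longrightarrow> word_eq [Edge (a, b), Vert b] [Edge (a, b)]"
  unfolding word_eq_def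
  by (rule relator_in_ideal, unfold relator_unfold, rule UnI1, rule UnI1, rule UnI1, rule UnI2, rule UnI2,
      rule CollectI, rule exI[of _ "(a, b)"]) simp

lemma range_ghost: "prec a b \<Longrightarrow> word_eq [Vert b, Ghost (a, b)] [Ghost (a, b)]"
  unfolding word_eq_def
  by (rule relator_in_ideal, unfold relator_unfold, rule UnI1, rule UnI1, rule UnI2, rule UnI1,
      rule CollectI, rule exI[of _ "(a, b)"]) simp

lemma ghost_source: "prec a b \<Longrightarrow> word_eq [Ghost (a, b), Vert a] [Ghost (a, b)]"
  unfolding word_eq_def
  by (rule relator_in_ideal, unfold relator_unfold, rule UnI1, rule UnI1, rule UnI2, rule UnI2,
      rule CollectI, rule exI[of _ "(a, b)"]) simp

lemma ghost_edge: "prec a b \<Longrightarrow> word_eq [Ghost (a, b), Edge (a, b)] [Vert b]"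
  unfolding word_eq_def
  by (rule relator_in_ideal, unfold relator_unfold, rule UnI1, rule UnI2,
      rule CollectI, rule exI[of _ "(a, b)"], rule exI[of _ "(a, b)"]) simp

lemma ghost_edge_null:
  "prec a b \<Longrightarrow> prec c d \<Longrightarrow> (a, b) \<noteq> (c, d) \<Longrightarrow> word_null [Ghost (a, b), Edge (c, d)]"
  unfolding word_null_def
  by (rule relator_in_ideal, unfold relator_unfold, rule UnI1, rule UnI2,
      rule CollectI, rule exI[of _ "(a, b)"], rule exI[of _ "(c, d)"]) auto

lemma edge_word_gens: "path i \<Longrightarrow> set (edge_word i) \<subseteq> gens"
proof (induction i)
  case (Cons a i)
  then show ?case by (cases i) (auto simp: path_def)
qed (simp add: path_def)

lemma ghost_word_gens: "path i \<Longrightarrow> set (ghost_word i) \<subseteq> gens"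
proof (induction i)
  case (Cons a i)
  then show ?case by (cases i) (auto simp: path_def ghost_word_Cons)
qed (simp add: path_def)

lemma path_word_gens: "coterminal i j \<Longrightarrow> set (path_word i j) \<subseteq> gens"
  using edge_word_gens[of i] ghost_word_gens[of j] path_last_Field[of i]
  by (auto simp: path_word_def coterminal_def)

lemma path_hd_Field: "path i \<Longrightarrow> hd i \<in> Field \<kappa>"
  by (cases i) (auto simp: path_def)

lemma path_tlD: "path (a # b # t) \<Longrightarrow> prec a b \<and> path (b # t)"
  by (simp add: path_def)

lemma path_ConsI: "prec a (hd i) \<Longrightarrow> path i \<Longrightarrow> path (a # i)"
  by (cases i) (auto simp: path_def prec_Field intro: prec_trans)

lemma coterminal_tlD: "coterminal (a # b # t) j \<Longrightarrow> prec a b \<and> coterminal (b # t) j"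
  using path_tlD by (auto simp: coterminal_def)

lemma vert_path_word:
  assumes "coterminal i j" shows "word_eq (Vert (hd i) # path_word i j) (path_word i j)"
proof (cases i rule: list.exhaust[case_names Nil Cons])
  case Nil
  then show ?thesis using assms by (simp add: coterminal_def path_def)
next
  case (Cons v t)
  show ?thesis
  proof (cases t)
    case Nil
    have "v \<in> Field \<kappa>" "set (ghost_word j) \<subseteq> gens"
      using assms Cons Nil ghost_word_gens by (auto simp: coterminal_def path_def)
    then show ?thesis
      using word_eq_cong[OF vert_vert, of v "[]" "ghost_word j"] by (simp add: Cons Nil path_word_single)
  next
    case (Cons b t')
    then have *: "prec v b" "coterminal (b # t') j" "i = v # b # t'"
      using assms coterminal_tlD[of v b t' j] \<open>i = v # t\<close> by auto
    then show ?thesis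
      using word_eq_cong[OF source_edge[OF *(1)], of "[]" "path_word (b # t') j"] path_word_gens
      by (simp add: path_word_Cons)
  qed
qed

lemma vert_path_word_null:
  assumes "coterminal i j" "u \<in> Field \<kappa>" "u \<noteq> hd i" shows "word_null (Vert u # path_word i j)"
proof -
  have hd: "hd i \<in> Field \<kappa>" using assms path_hd_Field by (simp add: coterminal_def)
  have "word_eq ([Vert u] @ path_word i j @ []) ([Vert u] @ (Vert (hd i) # path_word i j) @ [])"
    using assms by (intro word_eq_cong word_eq_sym[OF vert_path_word]) auto
  also have "word_null ([] @ [Vert u, Vert (hd i)] @ path_word i j)"
    using assms hd path_word_gens by (intro word_null_cong vert_vert_null) auto
  then have "word_null ([Vert u] @ (Vert (hd i) # path_word i j) @ [])" by simp
  finally show ?thesis by simp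
qed

lemma reducible_path_word: "coterminal i j \<Longrightarrow> reducible (path_word i j)"
  unfolding reducible_def using word_eq_refl by blast

lemma reducible_vert: "coterminal i j \<Longrightarrow> u \<in> Field \<kappa> \<Longrightarrow> reducible (Vert u # path_word i j)"
  using vert_path_word[of i j] vert_path_word_null[of i j u] unfolding reducible_def by metis

lemma reducible_edge:
  assumes ij: "coterminal i j" and ab: "prec a b" shows "reducible (Edge (a, b) # path_word i j)"
proof (cases "b = hd i")
  case True
  then have "path (a # i)" "i \<noteq> []"
    using assms path_ConsI by (auto simp: coterminal_def path_nonempty)
  then have "coterminal (a # i) j" using ij by (simp add: coterminal_def)
  moreover have "path_word (a # i) j = Edge (a, b) # path_word i j"
    using True \<open>i \<noteq> []\<close> by (cases i) (simp_all add: path_word_Cons)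
  ultimately show ?thesis using reducible_path_word by metis
next
  case False
  have "word_eq ([] @ [Edge (a, b)] @ path_word i j) ([] @ [Edge (a, b), Vert b] @ path_word i j)"
    using ij path_word_gens by (intro word_eq_cong word_eq_sym[OF edge_range[OF ab]]) auto
  moreover have "word_null ([Edge (a, b)] @ (Vert b # path_word i j) @ [])"
    using ij ab False prec_Field by (intro word_null_cong vert_path_word_null) auto
  ultimately have "word_null (Edge (a, b) # path_word i j)"
    using word_eq_null by simp
  then show ?thesis by (simp add: reducible_def)
qed

lemma reducible_ghost:
  assumes ij: "coterminal i j" and ab: "prec a b" shows "reducible (Ghost (a, b) # path_word i j)"
proof (cases "a = hd i")
  case False
  have "word_eq ([] @ [Ghost (a, b)] @ path_word i j) ([] @ [Ghost (a, b), Vert a] @ path_word i j)"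
    using ij path_word_gens by (intro word_eq_cong word_eq_sym[OF ghost_source[OF ab]]) auto
  moreover have "word_null ([Ghost (a, b)] @ (Vert a # path_word i j) @ [])"
    using ij ab False prec_Field by (intro word_null_cong vert_path_word_null) auto
  ultimately have "word_null (Ghost (a, b) # path_word i j)"
    using word_eq_null by simp
  then show ?thesis by (simp add: reducible_def)
next
  case True
  have "i \<noteq> []" using ij by (simp add: coterminal_def path_nonempty)
  then obtain t where i: "i = a # t" using True by (cases i) auto
  show ?thesis
  proof (cases t)
    case Nil
    have j: "path j" "last j = a" "j \<noteq> []" using ij by (auto simp: i Nil coterminal_def path_nonempty)
    have "word_eq ([] @ [Ghost (a, b), Vert a] @ ghost_word j) ([] @ [Ghost (a, b)] @ ghost_word j)"
      using ghost_word_gens[OF j(1)] by (intro word_eq_cong ghost_source ab) auto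
    also have "word_eq ([] @ [Ghost (a, b)] @ ghost_word j) ([] @ [Vert b, Ghost (a, b)] @ ghost_word j)"
      using ghost_word_gens[OF j(1)] by (intro word_eq_cong word_eq_sym[OF range_ghost[OF ab]]) auto
    also have "[] @ [Vert b, Ghost (a, b)] @ ghost_word j = path_word [b] (j @ [b])"
      using j by (simp add: path_word_single ghost_word_snoc)
    finally have "word_eq (Ghost (a, b) # path_word i j) (path_word [b] (j @ [b]))"
      by (simp add: i Nil path_word_single)
    moreover have "coterminal [b] (j @ [b])"
      using j ab path_snoc path_single prec_Field by (auto simp: coterminal_def)
    ultimately show ?thesis unfolding reducible_def by blast
  next
    case (Cons c t')
    have *: "prec a c" "coterminal (c # t') j" using ij coterminal_tlD by (auto simp: i Cons)
    show ?thesis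
    proof (cases "b = c")
      case True
      have "word_eq ([] @ [Ghost (a, b), Edge (a, b)] @ path_word (c # t') j) ([] @ [Vert b] @ path_word (c # t') j)"
        using path_word_gens[OF *(2)] by (intro word_eq_cong ghost_edge ab) auto
      then have "word_eq (Ghost (a, b) # path_word i j) (Vert b # path_word (c # t') j)"
        by (simp add: i Cons path_word_Cons True)
      also have "reducible (Vert b # path_word (c # t') j)"
        using * ab prec_Field by (intro reducible_vert) auto
      finally show ?thesis .
    next
      case False
      have "word_null ([] @ [Ghost (a, b), Edge (a, c)] @ path_word (c # t') j)"
        using path_word_gens[OF *(2)] False by (intro word_null_cong ghost_edge_null ab *) auto
      then show ?thesis by (simp add: i Cons path_word_Cons reducible_def)
    qed
  qed
qed

lemma reducible_gen:
  assumes "coterminal i j" "g \<in> gens" shows "reducible (g # path_word i j)"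
proof (cases g)
  case (Vert v)
  then show ?thesis using assms reducible_vert by simp
next
  case (Edge e)
  then show ?thesis using assms reducible_edge by (cases e) simp
next
  case (Ghost e)
  then show ?thesis using assms reducible_ghost by (cases e) simp
qed

lemma reducible_single:
  assumes "g \<in> gens" shows "reducible [g]"
proof (cases g)
  case (Vert v)
  then have "coterminal [v] [v]" using assms by (simp add: coterminal_def path_single)
  then show ?thesis using reducible_path_word[of "[v]" "[v]"] Vert by (simp add: path_word_single)
next
  case (Edge e)
  obtain a b where e: "e = (a, b)" by (cases e)
  then have ab: "prec a b" using assms Edge by simp
  then have "coterminal [a, b] [b]" using prec_Field[OF ab] by (simp add: coterminal_def path_def)
  then have "reducible [Edge (a, b), Vert b]"
    using reducible_path_word[of "[a, b]" "[b]"] by (simp add: path_word_def)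
  then show ?thesis using word_eq_reducible[OF word_eq_sym[OF edge_range[OF ab]]] Edge e by simp
next
  case (Ghost e)
  obtain a b where e: "e = (a, b)" by (cases e)
  then have ab: "prec a b" using assms Ghost by simp
  then have "coterminal [b] [a, b]" using prec_Field[OF ab] by (simp add: coterminal_def path_def)
  then have "reducible [Vert b, Ghost (a, b)]"
    using reducible_path_word[of "[b]" "[a, b]"] by (simp add: path_word_def ghost_word_Cons)
  then show ?thesis using word_eq_reducible[OF word_eq_sym[OF range_ghost[OF ab]]] Ghost e by simp
qed

lemma reducible_word: "w \<noteq> [] \<Longrightarrow> set w \<subseteq> gens \<Longrightarrow> reducible w"
proof (induction w)
  case (Cons g w)
  show ?case
  proof (cases "w = []")
    case True
    then show ?thesis using Cons.prems reducible_single by simp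
  next
    case False
    then have "reducible w" using Cons by simp
    then consider "word_null w" | i j where "coterminal i j" "word_eq w (path_word i j)"
      by (auto simp: reducible_def)
    then show ?thesis
    proof cases
      case 1
      then have "word_null ([g] @ w @ [])" using Cons.prems by (intro word_null_cong) auto
      then show ?thesis by (simp add: reducible_def)
    next
      case 2
      have "word_eq ([g] @ w @ []) ([g] @ path_word i j @ [])"
        using Cons.prems 2 by (intro word_eq_cong) auto
      moreover have "reducible (g # path_word i j)" using 2 Cons.prems by (intro reducible_gen) auto
      ultimately show ?thesis using word_eq_reducible by simp
    qed
  qed
qed simp

text \<open>The linear combinations of words in normal form.\<close>

definition normal_forms :: "(('o, 'o \<times> 'o) lpa_gen list \<Rightarrow>\<^sub>0 'k) set" where
  "normal_forms = {f. \<forall>w\<in>Poly_Mapping.keys f. \<exists>i j. coterminal i j \<and> w = path_word i j}"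

lemma normal_forms_zero: "0 \<in> normal_forms"
  by (simp add: normal_forms_def)

lemma normal_forms_add: "f \<in> normal_forms \<Longrightarrow> g \<in> normal_forms \<Longrightarrow> f + g \<in> normal_forms"
  using keys_add[of f g] unfolding normal_forms_def by blast

lemma normal_form_single:
  assumes "w \<noteq> []" "set w \<subseteq> gens"
  shows "\<exists>n\<in>normal_forms. Poly_Mapping.single w c - n \<in> lpa_ideal"
proof -
  have sc: "Poly_Mapping.single u c = pm_scale c (wd u)" for u :: "('o, 'o \<times> 'o) lpa_gen list"
    by simp
  from reducible_word[OF assms] consider "word_null w" | i j where "coterminal i j" "word_eq w (path_word i j)"
    by (auto simp: reducible_def)
  then show ?thesis
  proof cases
    case 1
    then have "Poly_Mapping.single w c \<in> lpa_ideal"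
      unfolding sc word_null_def by (rule ideal_scale)
    then show ?thesis by (intro bexI[OF _ normal_forms_zero]) simp
  next
    case 2
    have "pm_scale c (wd w - wd (path_word i j)) \<in> lpa_ideal"
      using 2(2) unfolding word_eq_def by (rule ideal_scale)
    then have "Poly_Mapping.single w c - Poly_Mapping.single (path_word i j) c \<in> lpa_ideal"
      by (simp add: pm_scale_conv right_diff_distrib mult_single plus_list_def)
    moreover have "Poly_Mapping.single (path_word i j) c \<in> normal_forms"
      using 2(1) by (auto simp: normal_forms_def)
    ultimately show ?thesis by blast
  qed
qed

lemma normal_form_exists:
  assumes "f \<in> free_carrier gens" shows "\<exists>n\<in>normal_forms. f - n \<in> lpa_ideal"
proof -
  have "\<exists>n\<in>normal_forms. Poly_Mapping.single w (poly_mapping.lookup f w) - n \<in> lpa_ideal"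
    if "w \<in> Poly_Mapping.keys f" for w
    using assms that by (intro normal_form_single) (auto simp: free_carrier_def)
  then obtain n where n: "\<And>w. w \<in> Poly_Mapping.keys f \<Longrightarrow> n w \<in> normal_forms"
    "\<And>w. w \<in> Poly_Mapping.keys f \<Longrightarrow> Poly_Mapping.single w (poly_mapping.lookup f w) - n w \<in> lpa_ideal"
    by metis
  have "(\<Sum>w\<in>Poly_Mapping.keys f. Poly_Mapping.single w (poly_mapping.lookup f w) - n w) \<in> lpa_ideal"
    using n(2) by (rule ideal_sum)
  then have "f - (\<Sum>w\<in>Poly_Mapping.keys f. n w) \<in> lpa_ideal"
    by (simp add: sum_subtractf sum_single)
  moreover have "(\<Sum>w\<in>A. n w) \<in> normal_forms" if "finite A" "A \<subseteq> Poly_Mapping.keys f" for A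
    using that by (induction A rule: finite_induct) (simp_all add: normal_forms_zero normal_forms_add n(1))
  ultimately show ?thesis using finite_keys by blast
qed

lemma eval_normal_form_zero:
  assumes "n \<in> normal_forms" "eval_op gen_shift n = (0 :: ('o list, 'k) lin_op)" shows "n = 0"
proof -
  have "\<exists>p. coterminal (fst p) (snd p) \<and> w = path_word (fst p) (snd p)" if "w \<in> Poly_Mapping.keys n" for w
    using assms(1) that by (fastforce simp: normal_forms_def)
  then obtain d where d: "\<And>w. w \<in> Poly_Mapping.keys n \<Longrightarrow>
      coterminal (fst (d w)) (snd (d w)) \<and> w = path_word (fst (d w)) (snd (d w))"
    by metis
  let ?P = "d ` Poly_Mapping.keys n"
  define c where "c i j = poly_mapping.lookup n (path_word i j)" for i j
  have inj: "inj_on d (Poly_Mapping.keys n)" using d by (metis inj_onI)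
  have "(\<Sum>(i, j)\<in>?P. op_scale (c i j) (shift i j)) = (0 :: ('o list, 'k) lin_op)"
  proof -
    have "(\<Sum>(i, j)\<in>?P. op_scale (c i j) (shift i j)) =
      (\<Sum>w\<in>Poly_Mapping.keys n. op_scale (c (fst (d w)) (snd (d w))) (shift (fst (d w)) (snd (d w))) :: ('o list, 'k) lin_op)"
      by (simp add: sum.reindex[OF inj] case_prod_beta)
    also have "\<dots> = eval_op gen_shift n"
      unfolding eval_op_def
    proof (rule sum.cong[OF refl])
      fix w assume w: "w \<in> Poly_Mapping.keys n"
      then have "path (fst (d w))" "path (snd (d w))" "last (fst (d w)) = last (snd (d w))"
        using d by (auto simp: coterminal_def)
      then have "word_op gen_shift (path_word (fst (d w)) (snd (d w))) =
          (shift (fst (d w)) (snd (d w)) :: ('o list, 'k) lin_op)"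
        by (intro path_word_op path_nonempty)
      then show "op_scale (c (fst (d w)) (snd (d w))) (shift (fst (d w)) (snd (d w))) =
          op_scale (poly_mapping.lookup n w) (word_op gen_shift w :: ('o list, 'k) lin_op)"
        using d[OF w] by (simp add: c_def)
    qed
    finally show ?thesis using assms(2) by simp
  qed
  then have c0: "c i j = 0" if "(i, j) \<in> ?P" for i j
    using shift_combination_zero[of ?P c i j] that by simp
  have "Poly_Mapping.keys n = {}"
  proof (rule ccontr)
    assume "Poly_Mapping.keys n \<noteq> {}"
    then obtain w where w: "w \<in> Poly_Mapping.keys n" by blast
    then have "c (fst (d w)) (snd (d w)) = 0" by (intro c0) auto
    then have "poly_mapping.lookup n w = 0" using d[OF w] by (simp add: c_def)
    then show False using w by (simp add: in_keys_iff)
  qed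
  then show ?thesis by simp
qed

theorem lpa_ideal_kernel:
  "lpa_ideal = {f \<in> free_carrier gens. eval_op gen_shift f = (0 :: ('o list, 'k) lin_op)}"
proof (intro equalityI subsetI)
  fix f :: "('o, 'o \<times> 'o) lpa_gen list \<Rightarrow>\<^sub>0 'k"
  assume f: "f \<in> {f \<in> free_carrier gens. eval_op gen_shift f = (0 :: ('o list, 'k) lin_op)}"
  then obtain n where n: "n \<in> normal_forms" "f - n \<in> lpa_ideal" using normal_form_exists by blast
  then have "eval_op gen_shift (f - n) = (0 :: ('o list, 'k) lin_op)" using lpa_ideal_subset by blast
  then have "n = 0" using f n(1) by (intro eval_normal_form_zero) (simp_all add: eval_op_diff)
  then show "f \<in> lpa_ideal" using n(2) by simp
qed (use lpa_ideal_subset in blast)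

theorem eval_image: "eval_op gen_shift ` free_carrier gens = (path_algebra :: ('o list, 'k) lin_op set)"
proof (intro equalityI)
  have gen: "gen_shift g \<in> (path_algebra :: ('o list, 'k) lin_op set)" if "g \<in> gens" for g
  proof (cases g)
    case (Vert v)
    then show ?thesis using that
      by (auto simp: coterminal_def path_single intro!: shift_in_path_algebra)
  next
    case (Edge e)
    then show ?thesis using that prec_Field[of "fst e" "snd e"]
      by (cases e) (auto simp: coterminal_def path_def intro!: shift_in_path_algebra)
  next
    case (Ghost e)
    then show ?thesis using that prec_Field[of "fst e" "snd e"]
      by (cases e) (auto simp: coterminal_def path_def intro!: shift_in_path_algebra)
  qed
  have word: "word_op gen_shift w \<in> (path_algebra :: ('o list, 'k) lin_op set)"
    if "w \<noteq> []" "set w \<subseteq> gens" for w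
    using that
  proof (induction w)
    case (Cons g w)
    then show ?case using gen[of g] by (cases "w = []") (auto intro: path_algebra_mult)
  qed simp
  show "eval_op gen_shift ` free_carrier gens \<subseteq> (path_algebra :: ('o list, 'k) lin_op set)"
    unfolding eval_op_def
    by (intro image_subsetI path_algebra_sum path_algebra_simps word) (auto simp: free_carrier_def)
  show "(path_algebra :: ('o list, 'k) lin_op set) \<subseteq> eval_op gen_shift ` free_carrier gens"
  proof
    fix a :: "('o list, 'k) lin_op" assume "a \<in> path_algebra"
    then show "a \<in> eval_op gen_shift ` free_carrier gens"
      unfolding path_algebra_def
    proof (induction rule: op.span_induct_alt)
      case base
      show ?case by (rule image_eqI[of _ _ 0]) (simp_all add: free_carrier_zero)
    next
      case (step c x y)
      then obtain i j f where *: "x = shift i j" "coterminal i j" "y = eval_op gen_shift f" "f \<in> free_carrier gens"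
        by blast
      have "word_op gen_shift (path_word i j) = (shift i j :: ('o list, 'k) lin_op)"
        using * by (intro path_word_op) (auto simp: coterminal_def path_nonempty)
      then have "op_scale c x + y = eval_op gen_shift (Poly_Mapping.single (path_word i j) c + f)"
        using * by (simp add: eval_op_add)
      moreover have "Poly_Mapping.single (path_word i j) c + f \<in> free_carrier gens"
        using * path_word_gens by (intro free_carrier_add free_carrier_single) (auto simp: path_word_def)
      ultimately show ?case by (rule image_eqI)
    qed
  qed
qed

end

section \<open>Transfer from rings of operators\<close>

lemma additive_subgroupI':
  assumes "abelian_group M" "N \<subseteq> carrier M" "\<zero>\<^bsub>M\<^esub> \<in> N"
    "\<And>x y. x \<in> N \<Longrightarrow> y \<in> N \<Longrightarrow> x \<oplus>\<^bsub>M\<^esub> y \<in> N" "\<And>x. x \<in> N \<Longrightarrow> \<ominus>\<^bsub>M\<^esub> x \<in> N"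
  shows "additive_subgroup N M"
  using assms by (intro additive_subgroup.intro subgroup.intro) (auto simp: a_inv_def)

context left_module
begin

lemma act_zero_left: "m \<in> carrier M \<Longrightarrow> \<zero>\<^bsub>R\<^esub> \<odot>\<^bsub>M\<^esub> m = \<zero>\<^bsub>M\<^esub>"
  using act_l_distr[of "\<zero>\<^bsub>R\<^esub>" "\<zero>\<^bsub>R\<^esub>" m] act_closed[of "\<zero>\<^bsub>R\<^esub>" m] M.add.r_cancel_one' by simp

lemma act_zero_right: "a \<in> carrier R \<Longrightarrow> a \<odot>\<^bsub>M\<^esub> \<zero>\<^bsub>M\<^esub> = \<zero>\<^bsub>M\<^esub>"
  using act_r_distr[of a "\<zero>\<^bsub>M\<^esub>" "\<zero>\<^bsub>M\<^esub>"] act_closed[of a "\<zero>\<^bsub>M\<^esub>"] M.add.r_cancel_one' by simp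

lemma act_minus_left: "a \<in> carrier R \<Longrightarrow> m \<in> carrier M \<Longrightarrow> (\<ominus>\<^bsub>R\<^esub> a) \<odot>\<^bsub>M\<^esub> m = \<ominus>\<^bsub>M\<^esub> (a \<odot>\<^bsub>M\<^esub> m)"
  using act_l_distr[of "\<ominus>\<^bsub>R\<^esub> a" a m] act_zero_left[of m] act_closed
  by (intro M.minus_equality[symmetric]) (simp_all add: R.l_neg)

lemma act_minus_right: "a \<in> carrier R \<Longrightarrow> m \<in> carrier M \<Longrightarrow> a \<odot>\<^bsub>M\<^esub> (\<ominus>\<^bsub>M\<^esub> m) = \<ominus>\<^bsub>M\<^esub> (a \<odot>\<^bsub>M\<^esub> m)"
  using act_r_distr[of a "\<ominus>\<^bsub>M\<^esub> m" m] act_zero_right[of a] act_closed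
  by (intro M.minus_equality[symmetric]) (simp_all add: M.l_neg)

end

text \<open>
  The witness \<open>N\<close> is the annihilator of an element \<open>m\<close> with \<open>R m \<noteq> 0\<close>. For a nonzero ideal \<open>J\<close> the submodule \<open>J m\<close> is not zero by faithfulness, hence everything, so
  \<open>r m = m\<close> for some \<open>r\<close> in \<open>J\<close>.
\<close>

lemma left_primitive_ringE:
  assumes "left_primitive_ring TYPE('m) R"
  obtains N where "N \<subset> carrier R" "\<zero>\<^bsub>R\<^esub> \<in> N" "\<And>x y. x \<in> N \<Longrightarrow> y \<in> N \<Longrightarrow> x \<oplus>\<^bsub>R\<^esub> y \<in> N"
    "\<And>a x. a \<in> carrier R \<Longrightarrow> x \<in> N \<Longrightarrow> a \<otimes>\<^bsub>R\<^esub> x \<in> N"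
    "\<And>J. two_sided_ideal J R \<Longrightarrow> J \<noteq> {\<zero>\<^bsub>R\<^esub>} \<Longrightarrow>
      \<exists>r\<in>J. \<forall>a\<in>carrier R. a \<oplus>\<^bsub>R\<^esub> (\<ominus>\<^bsub>R\<^esub> (a \<otimes>\<^bsub>R\<^esub> r)) \<in> N"
proof -
  from assms obtain M :: "('a, 'm) module" where "simple_left_module R M" "faithful_left_module R M"
    unfolding left_primitive_ring_def by blast
  then have "left_module R M" by (simp add: simple_left_module_def)
  then interpret left_module R M .
  obtain a0 m where am: "a0 \<in> carrier R" "m \<in> carrier M" "a0 \<odot>\<^bsub>M\<^esub> m \<noteq> \<zero>\<^bsub>M\<^esub>"
    using \<open>simple_left_module R M\<close> unfolding simple_left_module_def by blast
  have simple: "N = {\<zero>\<^bsub>M\<^esub>} \<or> N = carrier M"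
    if "N \<subseteq> carrier M" "\<zero>\<^bsub>M\<^esub> \<in> N" "\<And>x y. x \<in> N \<Longrightarrow> y \<in> N \<Longrightarrow> x \<oplus>\<^bsub>M\<^esub> y \<in> N"
      "\<And>x. x \<in> N \<Longrightarrow> \<ominus>\<^bsub>M\<^esub> x \<in> N" "\<And>a n. a \<in> carrier R \<Longrightarrow> n \<in> N \<Longrightarrow> a \<odot>\<^bsub>M\<^esub> n \<in> N" for N
  proof -
    have "left_submodule N R M"
      unfolding left_submodule_def
      using that(5) additive_subgroupI'[OF M.abelian_group_axioms that(1-4)] by blast
    then show ?thesis using \<open>simple_left_module R M\<close> unfolding simple_left_module_def by blast
  qed
  have m0: "m \<noteq> \<zero>\<^bsub>M\<^esub>" using am act_zero_right by auto
  let ?N = "{a \<in> carrier R. a \<odot>\<^bsub>M\<^esub> m = \<zero>\<^bsub>M\<^esub>}"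
  show thesis
  proof (rule that[of ?N])
    show "?N \<subset> carrier R" using am by blast
    show "\<zero>\<^bsub>R\<^esub> \<in> ?N" using am(2) act_zero_left by simp
    show "x \<oplus>\<^bsub>R\<^esub> y \<in> ?N" if "x \<in> ?N" "y \<in> ?N" for x y
      using that am(2) by (simp add: act_l_distr)
    show "a \<otimes>\<^bsub>R\<^esub> x \<in> ?N" if "a \<in> carrier R" "x \<in> ?N" for a x
      using that am(2) by (simp add: act_assoc act_zero_right m_closed)
  next
    fix J assume J: "two_sided_ideal J R" "J \<noteq> {\<zero>\<^bsub>R\<^esub>}"
    then have "additive_subgroup J R" by (simp add: two_sided_ideal_def)
    then interpret J: additive_subgroup J R .
    have Jc: "r \<in> carrier R" if "r \<in> J" for r using that by (rule J.a_Hcarr)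
    have Jm: "a \<otimes>\<^bsub>R\<^esub> r \<in> J" "r \<otimes>\<^bsub>R\<^esub> a \<in> J" if "a \<in> carrier R" "r \<in> J" for a r
      using J(1) that unfolding two_sided_ideal_def by blast+
    have Jinv: "\<ominus>\<^bsub>R\<^esub> r \<in> J" if "r \<in> J" for r
      using J.a_inv_closed[OF that] .
    let ?K = "(\<lambda>r. r \<odot>\<^bsub>M\<^esub> m) ` J"
    have "?K = {\<zero>\<^bsub>M\<^esub>} \<or> ?K = carrier M"
    proof (rule simple)
      show "?K \<subseteq> carrier M" using Jc am(2) act_closed by blast
      show "\<zero>\<^bsub>M\<^esub> \<in> ?K" using J.zero_closed act_zero_left[OF am(2)] by (metis image_eqI)
    next
      fix x y assume "x \<in> ?K" "y \<in> ?K"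
      then obtain r s where "x = r \<odot>\<^bsub>M\<^esub> m" "y = s \<odot>\<^bsub>M\<^esub> m" "r \<in> J" "s \<in> J" by blast
      then show "x \<oplus>\<^bsub>M\<^esub> y \<in> ?K"
        using act_l_distr[of r s m] J.a_closed[of r s] Jc am(2) by (metis image_eqI)
    next
      fix x assume "x \<in> ?K"
      then obtain r where "x = r \<odot>\<^bsub>M\<^esub> m" "r \<in> J" by blast
      then show "\<ominus>\<^bsub>M\<^esub> x \<in> ?K"
        using act_minus_left[of r m] Jinv[of r] Jc am(2) by (metis image_eqI)
    next
      fix a n assume "a \<in> carrier R" "n \<in> ?K"
      then obtain r where "a \<in> carrier R" "n = r \<odot>\<^bsub>M\<^esub> m" "r \<in> J" by blast
      then show "a \<odot>\<^bsub>M\<^esub> n \<in> ?K"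
        using act_assoc[of a r m] Jm(1)[of a r] Jc am(2) by (metis image_eqI)
    qed
    moreover have "?K \<noteq> {\<zero>\<^bsub>M\<^esub>}"
    proof
      assume K: "?K = {\<zero>\<^bsub>M\<^esub>}"
      \<comment> \<open>The annihilator of \<open>J\<close> in the module is a submodule that contains \<open>m\<close>.\<close>
      let ?W = "{n \<in> carrier M. \<forall>r\<in>J. r \<odot>\<^bsub>M\<^esub> n = \<zero>\<^bsub>M\<^esub>}"
      have "?W = {\<zero>\<^bsub>M\<^esub>} \<or> ?W = carrier M"
      proof (rule simple)
        show "a \<odot>\<^bsub>M\<^esub> n \<in> ?W" if "a \<in> carrier R" "n \<in> ?W" for a n
        proof (intro CollectI conjI ballI)
          show "a \<odot>\<^bsub>M\<^esub> n \<in> carrier M" using that act_closed by blast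
          fix r assume "r \<in> J"
          then have "r \<odot>\<^bsub>M\<^esub> (a \<odot>\<^bsub>M\<^esub> n) = (r \<otimes>\<^bsub>R\<^esub> a) \<odot>\<^bsub>M\<^esub> n"
            using that Jc by (simp add: act_assoc)
          then show "r \<odot>\<^bsub>M\<^esub> (a \<odot>\<^bsub>M\<^esub> n) = \<zero>\<^bsub>M\<^esub>" using that \<open>r \<in> J\<close> Jm(2) by simp
        qed
      qed (use Jc in \<open>auto simp: act_zero_right act_r_distr act_minus_right\<close>)
      moreover have "m \<in> ?W" using K am(2) by blast
      ultimately have W: "?W = carrier M" using m0 by blast
      have "r = \<zero>\<^bsub>R\<^esub>" if "r \<in> J" for r
        using \<open>faithful_left_module R M\<close> Jc[OF that] that W unfolding faithful_left_module_def by blast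
      then show False using J(2) J.zero_closed by blast
    qed
    ultimately have "m \<in> ?K" using am(2) by simp
    then obtain r where r: "r \<in> J" "r \<odot>\<^bsub>M\<^esub> m = m" by (metis imageE)
    have "a \<oplus>\<^bsub>R\<^esub> (\<ominus>\<^bsub>R\<^esub> (a \<otimes>\<^bsub>R\<^esub> r)) \<in> ?N" if a: "a \<in> carrier R" for a
    proof -
      have "(a \<oplus>\<^bsub>R\<^esub> (\<ominus>\<^bsub>R\<^esub> (a \<otimes>\<^bsub>R\<^esub> r))) \<odot>\<^bsub>M\<^esub> m = a \<odot>\<^bsub>M\<^esub> m \<oplus>\<^bsub>M\<^esub> \<ominus>\<^bsub>M\<^esub> (a \<odot>\<^bsub>M\<^esub> (r \<odot>\<^bsub>M\<^esub> m))"
        using a Jc[OF r(1)] am(2) by (simp add: act_l_distr act_minus_left act_assoc m_closed)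
      also have "\<dots> = \<zero>\<^bsub>M\<^esub>" using r a am(2) act_closed by (simp add: M.r_neg)
      finally show ?thesis using a Jc[OF r(1)] by (simp add: m_closed)
    qed
    then show "\<exists>r\<in>J. \<forall>a\<in>carrier R. a \<oplus>\<^bsub>R\<^esub> (\<ominus>\<^bsub>R\<^esub> (a \<otimes>\<^bsub>R\<^esub> r)) \<in> ?N" using r(1) by blast
  qed
qed

text \<open>
  An algebra that is identified by \<open>h\<close> with a set \<open>B\<close> of operators. The axioms of an algebra are
  not assumed: they follow from those of the ring of operators.
\<close>

locale operator_representation =
  fixes A :: "('k::field, 'a) module" (structure)
    and h :: "'a \<Rightarrow> ('p, 'k) lin_op" and B :: "('p, 'k) lin_op set"
  assumes bij: "bij_betw h (carrier A) B"
    and zero_closed: "\<zero> \<in> carrier A" and add_closed: "\<lbrakk>x \<in> carrier A; y \<in> carrier A\<rbrakk> \<Longrightarrow> x \<oplus> y \<in> carrier A"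
    and mult_closed: "\<lbrakk>x \<in> carrier A; y \<in> carrier A\<rbrakk> \<Longrightarrow> x \<otimes> y \<in> carrier A"
    and scale_closed: "x \<in> carrier A \<Longrightarrow> c \<odot> x \<in> carrier A"
    and h_zero: "h \<zero> = 0" and h_add: "\<lbrakk>x \<in> carrier A; y \<in> carrier A\<rbrakk> \<Longrightarrow> h (x \<oplus> y) = h x + h y"
    and h_mult: "\<lbrakk>x \<in> carrier A; y \<in> carrier A\<rbrakk> \<Longrightarrow> h (x \<otimes> y) = h x * h y"
    and h_scale: "x \<in> carrier A \<Longrightarrow> h (c \<odot> x) = op_scale c (h x)"
begin

lemma h_in: "x \<in> carrier A \<Longrightarrow> h x \<in> B"
  using bij by (auto simp: bij_betw_def)

lemma h_eqI: "\<lbrakk>h x = h y; x \<in> carrier A; y \<in> carrier A\<rbrakk> \<Longrightarrow> x = y"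
  using bij by (auto simp: bij_betw_def inj_on_def)

lemma h_onto: "b \<in> B \<Longrightarrow> \<exists>x\<in>carrier A. h x = b"
  using bij by (auto simp: bij_betw_def)

lemmas closed = zero_closed add_closed mult_closed scale_closed
lemmas h_simps = h_zero h_add h_mult h_scale closed

lemma is_nonunital_algebra: "nonunital_algebra A"
proof -
  have "abelian_group A"
  proof (rule abelian_groupI)
    fix x assume x: "x \<in> carrier A"
    have "op_scale (- 1) (h x) + h x = 0" by (simp add: op.scale_left_diff_distrib)
    then show "\<exists>y\<in>carrier A. y \<oplus> x = \<zero>"
      using x by (intro bexI[of _ "(- 1) \<odot> x"] h_eqI) (simp_all add: h_simps)
  qed (auto intro!: h_eqI simp: h_simps ac_simps)
  moreover have "nonunital_ring_axioms A"
    by standard (auto intro!: h_eqI simp: h_simps distrib_left distrib_right mult.assoc)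
  moreover have "nonunital_algebra_axioms A"
    by standard (auto intro!: h_eqI simp: h_simps op.scale_left_distrib op.scale_right_distrib
      op_scale_mult_left op_scale_mult_right)
  ultimately show ?thesis by (intro nonunital_algebra.intro nonunital_ring.intro)
qed

sublocale nonunital_algebra A by (rule is_nonunital_algebra)

lemma h_uminus: "x \<in> carrier A \<Longrightarrow> h (\<ominus> x) = - h x"
  using h_add[of "\<ominus> x" x] l_neg[of x] by (simp add: h_zero eq_neg_iff_add_eq_0)

lemma h_eq_zero: "x \<in> carrier A \<Longrightarrow> h x = 0 \<longleftrightarrow> x = \<zero>"
  using h_eqI[of x \<zero>] h_zero zero_closed by auto

lemma regular:
  assumes "\<And>a. a \<in> B \<Longrightarrow> \<exists>x\<in>B. a = a * x * a" shows "von_neumann_regular_ring A"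
  unfolding von_neumann_regular_ring_def
proof (intro conjI ballI)
  show "nonunital_ring A" by (rule nonunital_ring_axioms)
  fix a assume a: "a \<in> carrier A"
  obtain b where "b \<in> B" "h a = h a * b * h a" using assms[OF h_in[OF a]] by blast
  then obtain x where "x \<in> carrier A" "h a = h a * h x * h a" using h_onto by blast
  then show "\<exists>x\<in>carrier A. a = a \<otimes> x \<otimes> a"
    using a by (intro bexI[of _ x] h_eqI) (simp_all add: h_simps)
qed

lemma prime:
  assumes B: "\<And>a b. \<lbrakk>a \<in> B; a \<noteq> 0; b \<in> B; b \<noteq> 0\<rbrakk> \<Longrightarrow>
    \<exists>x\<in>B. \<exists>y\<in>B. \<exists>z\<in>B. \<exists>u\<in>B. (x * a * y) * (z * b * u) \<noteq> 0"
  shows "prime_ring A"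
  unfolding prime_ring_def
proof (intro conjI allI impI)
  show "nonunital_ring A" by (rule nonunital_ring_axioms)
  fix I J assume I: "two_sided_ideal I A" "I \<noteq> {\<zero>}" and J: "two_sided_ideal J A" "J \<noteq> {\<zero>}"
  have nz: "\<exists>a\<in>K. a \<in> carrier A \<and> a \<noteq> \<zero>" and cl: "\<And>a x y. \<lbrakk>a \<in> K; x \<in> carrier A; y \<in> carrier A\<rbrakk> \<Longrightarrow> x \<otimes> a \<otimes> y \<in> K"
    if K: "two_sided_ideal K A" "K \<noteq> {\<zero>}" for K
  proof -
    have "additive_subgroup K A" using K by (simp add: two_sided_ideal_def)
    then show "\<exists>a\<in>K. a \<in> carrier A \<and> a \<noteq> \<zero>"
      using additive_subgroup.zero_closed additive_subgroup.a_Hcarr K(2) by fastforce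
    show "x \<otimes> a \<otimes> y \<in> K" if "a \<in> K" "x \<in> carrier A" "y \<in> carrier A" for a x y
      using K(1) that unfolding two_sided_ideal_def by blast
  qed
  obtain a where a: "a \<in> I" "a \<in> carrier A" "a \<noteq> \<zero>" using nz[OF I] by blast
  obtain b where b: "b \<in> J" "b \<in> carrier A" "b \<noteq> \<zero>" using nz[OF J] by blast
  obtain x' y' z' u' where *: "x' \<in> B" "y' \<in> B" "z' \<in> B" "u' \<in> B" "(x' * h a * y') * (z' * h b * u') \<noteq> 0"
    using B[of "h a" "h b"] a b h_in h_eq_zero by blast
  obtain x y z u where xyzu: "x \<in> carrier A" "y \<in> carrier A" "z \<in> carrier A" "u \<in> carrier A"
    "h x = x'" "h y = y'" "h z = z'" "h u = u'"
    using h_onto *(1-4) by metis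
  let ?p = "(x \<otimes> a \<otimes> y) \<otimes> (z \<otimes> b \<otimes> u)"
  have "h ?p \<noteq> 0" using *(5) a b xyzu by (simp add: h_simps)
  then have "?p \<noteq> \<zero>" using h_zero by auto
  moreover have "?p \<in> I \<cdot> J" using cl[OF I a(1)] cl[OF J b(1)] xyzu by (intro ideal_prod.prod)
  ultimately show "I \<cdot> J \<noteq> {\<zero>}" by blast
qed

text \<open>Only the ideals \<open>D v\<close> of a chosen family are tested against a simple faithful module.\<close>

lemma not_primitive:
  assumes ideals: "\<And>v. v \<in> V \<Longrightarrow> D v \<subseteq> B \<and> op.subspace (D v) \<and> D v \<noteq> {0} \<and>
      (\<forall>a\<in>B. \<forall>r\<in>D v. a * r \<in> D v \<and> r * a \<in> D v)"
    and no: "\<And>N. \<lbrakk>N \<subset> B; 0 \<in> N; \<And>m n. m \<in> N \<Longrightarrow> n \<in> N \<Longrightarrow> m + n \<in> N;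
      \<And>a n. a \<in> B \<Longrightarrow> n \<in> N \<Longrightarrow> a * n \<in> N;
      \<And>v. v \<in> V \<Longrightarrow> \<exists>r\<in>D v. \<forall>a\<in>B. a - a * r \<in> N\<rbrakk> \<Longrightarrow> False"
  shows "\<not> left_primitive_ring TYPE('m) A"
proof
  assume "left_primitive_ring TYPE('m) A"
  then obtain N where N: "N \<subset> carrier A" "\<zero> \<in> N" "\<And>x y. x \<in> N \<Longrightarrow> y \<in> N \<Longrightarrow> x \<oplus> y \<in> N"
    "\<And>a x. a \<in> carrier A \<Longrightarrow> x \<in> N \<Longrightarrow> a \<otimes> x \<in> N"
    "\<And>J. two_sided_ideal J A \<Longrightarrow> J \<noteq> {\<zero>} \<Longrightarrow> \<exists>r\<in>J. \<forall>a\<in>carrier A. a \<oplus> (\<ominus> (a \<otimes> r)) \<in> N"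
    by (rule left_primitive_ringE) blast
  have NA: "x \<in> carrier A" if "x \<in> N" for x using that N(1) by blast
  show False
  proof (rule no[of "h ` N"])
    show "h ` N \<subset> B"
    proof
      show "h ` N \<subseteq> B" using NA h_in by blast
      obtain x where "x \<in> carrier A" "x \<notin> N" using N(1) by blast
      then have "h x \<notin> h ` N" using NA h_eqI by blast
      then show "h ` N \<noteq> B" using h_in[OF \<open>x \<in> carrier A\<close>] by blast
    qed
    show "0 \<in> h ` N" using N(2) h_zero by (metis image_eqI)
    show "m + n \<in> h ` N" if "m \<in> h ` N" "n \<in> h ` N" for m n
      using that N(3) NA by (auto simp: h_add[symmetric])
    show "a * n \<in> h ` N" if a: "a \<in> B" and n: "n \<in> h ` N" for a n
    proof -
      obtain x y where "x \<in> carrier A" "a = h x" "y \<in> N" "n = h y" using h_onto[OF a] n by blast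
      then show ?thesis using N(4)[of x y] NA by (auto simp: h_mult[symmetric])
    qed
  next
    fix v assume v: "v \<in> V"
    let ?J = "{x \<in> carrier A. h x \<in> D v}"
    have sub: "op.subspace (D v)" using ideals[OF v] by blast
    have "two_sided_ideal ?J A"
      unfolding two_sided_ideal_def
    proof (intro conjI ballI)
      show "additive_subgroup ?J A"
        using sub
        by (intro additive_subgroupI' abelian_group_axioms)
          (auto simp: h_simps h_uminus op.subspace_0 op.subspace_add op.subspace_neg)
    qed (use ideals[OF v] h_in in \<open>auto simp: h_simps\<close>)
    moreover have "?J \<noteq> {\<zero>}"
    proof -
      obtain d where "d \<in> D v" "d \<noteq> 0" using ideals[OF v] op.subspace_0[OF sub] by blast
      moreover obtain x where "x \<in> carrier A" "h x = d" using h_onto ideals[OF v] \<open>d \<in> D v\<close> by blast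
      ultimately have "x \<in> ?J" "x \<noteq> \<zero>" using h_zero by auto
      then show ?thesis by blast
    qed
    ultimately obtain r where r: "r \<in> ?J" "\<And>a. a \<in> carrier A \<Longrightarrow> a \<oplus> (\<ominus> (a \<otimes> r)) \<in> N"
      using N(5) by blast
    have "a - a * h r \<in> h ` N" if a: "a \<in> B" for a
    proof -
      obtain x where x: "x \<in> carrier A" "h x = a" using h_onto[OF a] by blast
      have "h (x \<oplus> (\<ominus> (x \<otimes> r))) = a - a * h r"
        using x r(1) by (simp add: h_simps h_uminus)
      then show ?thesis using r(2)[OF x(1)] by (metis image_eqI)
    qed
    then show "\<exists>r\<in>D v. \<forall>a\<in>B. a - a * r \<in> h ` N" using r(1) by blast
  qed
qed

end

section \<open>The representation of the Leavitt path algebra\<close>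

lemma quotient_algebra_simps:
  "carrier (quotient_algebra A I) = a_rcosets\<^bsub>A\<^esub> I"
  "monoid.mult (quotient_algebra A I) = rcoset_mult A I"
  "ring.zero (quotient_algebra A I) = I"
  "ring.add (quotient_algebra A I) = set_add A"
  "smult (quotient_algebra A I) = (\<lambda>c S. \<Union>x\<in>S. I +>\<^bsub>A\<^esub> (c \<odot>\<^bsub>A\<^esub> x))"
  by (simp_all add: quotient_algebra_def FactRing_def ring.extend_def module.fields_def)

context ordinal_lpa
begin

abbreviation free_algebra :: "('k, ('o, 'o \<times> 'o) lpa_gen list \<Rightarrow>\<^sub>0 'k) module" where
  "free_algebra \<equiv> free_nonunital_algebra gens"

abbreviation LPA :: "('k, (('o, 'o \<times> 'o) lpa_gen list \<Rightarrow>\<^sub>0 'k) set) module" where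
  "LPA \<equiv> leavitt_path_algebra TYPE('k) (ordinal_digraph \<kappa>)"

text \<open>The coset \<open>f + lpa_ideal\<close>.\<close>

definition coset :: "(('o, 'o \<times> 'o) lpa_gen list \<Rightarrow>\<^sub>0 'k) \<Rightarrow> (('o, 'o \<times> 'o) lpa_gen list \<Rightarrow>\<^sub>0 'k) set" where
  "coset f = {x. x - f \<in> lpa_ideal}"

lemma a_r_coset_eq: "lpa_ideal +>\<^bsub>free_algebra\<^esub> f = coset f"
proof -
  have "lpa_ideal +>\<^bsub>free_algebra\<^esub> f = (\<lambda>x. x + f) ` lpa_ideal"
    by (auto simp: a_r_coset_def' free_simps)
  also have "\<dots> = coset f"
  proof (intro equalityI subsetI)
    fix x assume "x \<in> coset f"
    then show "x \<in> (\<lambda>x. x + f) ` lpa_ideal"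
      by (intro image_eqI[of _ _ "x - f"]) (simp_all add: coset_def)
  qed (auto simp: coset_def)
  finally show ?thesis .
qed

lemma coset_self: "f \<in> coset f"
  by (simp add: coset_def ideal_zero)

lemma coset_carrier: "x \<in> coset f \<Longrightarrow> f \<in> free_carrier gens \<Longrightarrow> x \<in> free_carrier gens"
  using lpa_ideal_subset[of "x - f"] free_carrier_add[of "x - f" gens f] by (simp add: coset_def)

lemma coset_eqI: "x - f \<in> lpa_ideal \<Longrightarrow> coset x = coset f"
proof -
  assume *: "x - f \<in> lpa_ideal"
  have "y - x \<in> lpa_ideal \<longleftrightarrow> y - f \<in> lpa_ideal" for y
    using ideal_add[OF _ *, of "y - x"] ideal_diff[OF _ *, of "y - f"] by auto
  then show ?thesis by (simp add: coset_def)
qed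

lemma LPA_def: "LPA = quotient_algebra free_algebra lpa_ideal"
  by (simp add: leavitt_path_algebra_def Let_def lpa_ideal_def)

lemma LPA_carrier: "carrier LPA = coset ` free_carrier gens"
  by (auto simp: LPA_def quotient_algebra_simps A_RCOSETS_def' a_r_coset_eq free_simps)

lemma LPA_zero: "\<zero>\<^bsub>LPA\<^esub> = coset 0"
  by (simp add: LPA_def quotient_algebra_simps coset_def)

lemma LPA_add:
  "coset f \<oplus>\<^bsub>LPA\<^esub> coset g = coset (f + g)"
proof -
  have "coset f \<oplus>\<^bsub>LPA\<^esub> coset g = (\<Union>x\<in>coset f. \<Union>y\<in>coset g. {x + y})"
    by (simp add: LPA_def quotient_algebra_simps set_add_def' free_simps)
  also have "\<dots> = coset (f + g)"
  proof (intro equalityI subsetI)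
    fix z assume "z \<in> (\<Union>x\<in>coset f. \<Union>y\<in>coset g. {x + y})"
    then obtain x y where "z = x + y" "x - f \<in> lpa_ideal" "y - g \<in> lpa_ideal" by (auto simp: coset_def)
    then show "z \<in> coset (f + g)"
      using ideal_add[of "x - f" "y - g"] by (simp add: coset_def algebra_simps)
  next
    fix z assume "z \<in> coset (f + g)"
    then have "z - g \<in> coset f" by (simp add: coset_def algebra_simps)
    moreover have "z = (z - g) + g" by simp
    ultimately show "z \<in> (\<Union>x\<in>coset f. \<Union>y\<in>coset g. {x + y})" using coset_self by blast
  qed
  finally show ?thesis .
qed

lemma LPA_mult:
  assumes "f \<in> free_carrier gens" "g \<in> free_carrier gens"
  shows "coset f \<otimes>\<^bsub>LPA\<^esub> coset g = coset (f * g)"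
proof -
  have "coset f \<otimes>\<^bsub>LPA\<^esub> coset g = (\<Union>x\<in>coset f. \<Union>y\<in>coset g. coset (x * y))"
    by (simp add: LPA_def quotient_algebra_simps rcoset_mult_def free_simps a_r_coset_eq)
  also have "\<dots> = (\<Union>x\<in>coset f. \<Union>y\<in>coset g. coset (f * g))"
  proof (intro SUP_cong refl coset_eqI)
    fix x y assume xy: "x \<in> coset f" "y \<in> coset g"
    have "(x - f) * y \<in> lpa_ideal" "f * (y - g) \<in> lpa_ideal"
      using xy ideal_mult coset_carrier assms by (auto simp: coset_def)
    then show "x * y - f * g \<in> lpa_ideal"
      using ideal_add[of "(x - f) * y" "f * (y - g)"] by (simp add: algebra_simps)
  qed
  also have "\<dots> = coset (f * g)" using coset_self by blast
  finally show ?thesis .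
qed

lemma LPA_scale: "c \<odot>\<^bsub>LPA\<^esub> coset f = coset (pm_scale c f)"
proof -
  have "c \<odot>\<^bsub>LPA\<^esub> coset f = (\<Union>x\<in>coset f. coset (pm_scale c x))"
    by (simp add: LPA_def quotient_algebra_simps free_simps a_r_coset_eq)
  also have "\<dots> = (\<Union>x\<in>coset f. coset (pm_scale c f))"
  proof (intro SUP_cong refl coset_eqI)
    fix x assume "x \<in> coset f"
    then show "pm_scale c x - pm_scale c f \<in> lpa_ideal"
      using ideal_scale[of "x - f" c] by (simp add: coset_def pm_scale_conv right_diff_distrib)
  qed
  also have "\<dots> = coset (pm_scale c f)" using coset_self by blast
  finally show ?thesis .
qed

text \<open>The operator of a coset, computed from an arbitrary representative.\<close>

definition coset_op :: "(('o, 'o \<times> 'o) lpa_gen list \<Rightarrow>\<^sub>0 'k) set \<Rightarrow> ('o list, 'k) lin_op" where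
  "coset_op S = eval_op gen_shift (SOME f. f \<in> S)"

lemma coset_op_coset: "coset_op (coset f) = eval_op gen_shift f"
proof -
  have "(SOME x. x \<in> coset f) \<in> coset f" using coset_self by (rule someI)
  then have "(SOME x. x \<in> coset f) - f \<in> lpa_ideal" by (simp add: coset_def)
  from lpa_ideal_subset[OF this]
  have "eval_op gen_shift ((SOME x. x \<in> coset f) - f) = (0 :: ('o list, 'k) lin_op)" by simp
  then show ?thesis by (simp add: coset_op_def eval_op_diff)
qed

theorem LPA_representation: "operator_representation LPA coset_op path_algebra"
proof
  show "bij_betw coset_op (carrier LPA) path_algebra"
    unfolding bij_betw_def
  proof
    show "inj_on coset_op (carrier LPA)"
    proof (rule inj_onI)
      fix x y assume "x \<in> carrier LPA" "y \<in> carrier LPA" and eq: "coset_op x = coset_op y"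
      then obtain f g where fg: "x = coset f" "f \<in> free_carrier gens" "y = coset g" "g \<in> free_carrier gens"
        by (auto simp: LPA_carrier)
      have "f - g \<in> lpa_ideal"
        unfolding lpa_ideal_kernel using fg eq by (simp add: coset_op_coset eval_op_diff free_carrier_diff)
      then show "x = y" using fg coset_eqI by simp
    qed
    show "coset_op ` carrier LPA = path_algebra"
      by (simp add: LPA_carrier image_image coset_op_coset eval_image)
  qed
qed (auto simp: LPA_carrier LPA_zero LPA_add LPA_mult LPA_scale coset_op_coset eval_op_add eval_op_mult
    eval_op_scale free_carrier_zero free_carrier_add free_carrier_mult free_carrier_scale)

sublocale rep: operator_representation LPA coset_op path_algebra
  by (rule LPA_representation)

theorem LPA_algebra: "nonunital_algebra LPA"
  by (rule rep.is_nonunital_algebra)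

theorem LPA_prime: "prime_ring LPA"
  by (rule rep.prime) (rule path_algebra_prime)

theorem LPA_regular: "von_neumann_regular_ring LPA"
  by (rule rep.regular) (rule path_algebra_regular)

theorem LPA_not_primitive: "\<not> left_primitive_ring TYPE('m) LPA"
proof (rule rep.not_primitive[of "Field \<kappa>" "\<lambda>v. op.span (path_shifts {u. u = v \<or> prec v u})"])
  fix v assume v: "v \<in> Field \<kappa>"
  let ?D = "{u. u = v \<or> prec v u}"
  have up: "b \<in> ?D" if "a \<in> ?D" "prec a b" for a b using that prec_trans by auto
  have "shift [v] [v] \<in> (path_shifts ?D :: ('o list, 'k) lin_op set)"
  proof -
    have "coterminal [v] [v]" using v by (simp add: coterminal_def path_single)
    then show ?thesis unfolding path_shifts_def by fastforce
  qed
  then have "shift [v] [v] \<in> op.span (path_shifts ?D :: ('o list, 'k) lin_op set)"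
    by (rule op.span_base)
  then have "op.span (path_shifts ?D) \<noteq> {0 :: ('o list, 'k) lin_op}"
    using shift_nonzero[of "[v]" "[v]"] by auto
  then show "op.span (path_shifts ?D) \<subseteq> (path_algebra :: ('o list, 'k) lin_op set) \<and>
      op.subspace (op.span (path_shifts ?D :: ('o list, 'k) lin_op set)) \<and>
      op.span (path_shifts ?D) \<noteq> {0 :: ('o list, 'k) lin_op} \<and>
      (\<forall>a\<in>path_algebra. \<forall>r\<in>op.span (path_shifts ?D :: ('o list, 'k) lin_op set).
        a * r \<in> op.span (path_shifts ?D) \<and> r * a \<in> op.span (path_shifts ?D))"
    using span_path_shifts_subset span_path_shifts_ideal[where D="?D", where 'k='k] up
    by (intro conjI ballI op.subspace_span) simp_all
next
  fix N :: "('o list, 'k) lin_op set"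
  assume "N \<subset> path_algebra" "0 \<in> N" "\<And>m n. m \<in> N \<Longrightarrow> n \<in> N \<Longrightarrow> m + n \<in> N"
      "\<And>a n. a \<in> path_algebra \<Longrightarrow> n \<in> N \<Longrightarrow> a * n \<in> N"
      "\<And>v. v \<in> Field \<kappa> \<Longrightarrow>
      \<exists>r\<in>op.span (path_shifts {u. u = v \<or> prec v u}). \<forall>a\<in>path_algebra. a - a * r \<in> N"
  then show False by (rule path_algebra_not_primitive)
qed

end

lemma LPA_isomorphic_imp_lepoll:
  fixes \<kappa> \<mu> :: "'o rel"
  assumes \<kappa>: "Well_order \<kappa>" "uncountable_cofinality \<kappa>" and \<mu>: "Well_order \<mu>" "uncountable_cofinality \<mu>"
    and inf: "infinite (Field \<mu>)"
    and iso: "algebra_isomorphic (leavitt_path_algebra TYPE('k::field) (ordinal_digraph \<kappa>))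
      (leavitt_path_algebra TYPE('k) (ordinal_digraph \<mu>))"
  shows "lepoll (Field \<kappa>) (Field \<mu>)"
proof -
  interpret K: ordinal_lpa \<kappa> "TYPE('k)" by standard (use \<kappa> in auto)
  interpret M: ordinal_lpa \<mu> "TYPE('k)" by standard (use \<mu> in auto)
  obtain f where f: "bij_betw f (carrier K.LPA) (carrier M.LPA)"
    "\<And>x y. \<lbrakk>x \<in> carrier K.LPA; y \<in> carrier K.LPA\<rbrakk> \<Longrightarrow> f (x \<oplus>\<^bsub>K.LPA\<^esub> y) = f x \<oplus>\<^bsub>M.LPA\<^esub> f y"
    "\<And>x y. \<lbrakk>x \<in> carrier K.LPA; y \<in> carrier K.LPA\<rbrakk> \<Longrightarrow> f (x \<otimes>\<^bsub>K.LPA\<^esub> y) = f x \<otimes>\<^bsub>M.LPA\<^esub> f y"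
    using iso unfolding algebra_isomorphic_def algebra_iso_def by blast
  define g where "g = inv_into (carrier K.LPA) K.coset_op"
  define h where "h a = M.coset_op (f (g a))" for a
  have g: "bij_betw g K.path_algebra (carrier K.LPA)"
    unfolding g_def by (rule bij_betw_inv_into[OF K.rep.bij])
  have gK: "g a \<in> carrier K.LPA" if "a \<in> K.path_algebra" for a
    using g that by (auto simp: bij_betw_def)
  have Kg: "K.coset_op (g a) = a" if "a \<in> K.path_algebra" for a
    unfolding g_def using K.rep.bij that by (rule bij_betw_inv_into_right)
  have fM: "f x \<in> carrier M.LPA" if "x \<in> carrier K.LPA" for x
    using f(1) that by (auto simp: bij_betw_def)
  have "bij_betw (M.coset_op \<circ> (f \<circ> g)) K.path_algebra M.path_algebra"
    by (intro bij_betw_trans[OF bij_betw_trans[OF g f(1)] M.rep.bij])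
  then have bij: "bij_betw h K.path_algebra M.path_algebra"
    by (simp add: h_def[abs_def] comp_def)
  have mult: "h (a * b) = h a * h b" if "a \<in> K.path_algebra" "b \<in> K.path_algebra" for a b
  proof -
    have "g (a * b) = g a \<otimes>\<^bsub>K.LPA\<^esub> g b"
      using that by (intro K.rep.h_eqI) (simp_all add: Kg gK K.rep.h_simps K.path_algebra_mult)
    then show ?thesis using that by (simp add: h_def f(3) gK fM M.rep.h_mult)
  qed
  have add: "h (a + b) = h a + h b" if "a \<in> K.path_algebra" "b \<in> K.path_algebra" for a b
  proof -
    have "g (a + b) = g a \<oplus>\<^bsub>K.LPA\<^esub> g b"
      using that by (intro K.rep.h_eqI) (simp_all add: Kg gK K.rep.h_simps K.path_algebra_simps)
    then show ?thesis using that by (simp add: h_def f(2) gK fM M.rep.h_add)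
  qed
  have "h 0 = 0" using add[of 0 0] K.path_algebra_simps(1) by simp
  then show ?thesis
    using path_algebra_dimension[OF K.ordinal_paths_axioms M.ordinal_paths_axioms inf, of h] bij mult
    by (simp add: bij_betw_def)
qed

lemma algebra_isomorphic_sym:
  assumes "nonunital_algebra A" "algebra_isomorphic A B" shows "algebra_isomorphic B A"
proof -
  interpret nonunital_algebra A by (rule assms)
  obtain f where f: "bij_betw f (carrier A) (carrier B)"
    "\<And>x y. \<lbrakk>x \<in> carrier A; y \<in> carrier A\<rbrakk> \<Longrightarrow> f (x \<oplus>\<^bsub>A\<^esub> y) = f x \<oplus>\<^bsub>B\<^esub> f y"
    "\<And>x y. \<lbrakk>x \<in> carrier A; y \<in> carrier A\<rbrakk> \<Longrightarrow> f (x \<otimes>\<^bsub>A\<^esub> y) = f x \<otimes>\<^bsub>B\<^esub> f y"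
    "\<And>c x. x \<in> carrier A \<Longrightarrow> f (c \<odot>\<^bsub>A\<^esub> x) = c \<odot>\<^bsub>B\<^esub> f x"
    using assms(2) unfolding algebra_isomorphic_def algebra_iso_def by blast
  define g where "g = inv_into (carrier A) f"
  have gA: "g y \<in> carrier A" and fg: "f (g y) = y" if "y \<in> carrier B" for y
    using that f(1) unfolding g_def bij_betw_def
    by (auto intro: inv_into_into f_inv_into_f)
  have gf: "g (f x) = x" if "x \<in> carrier A" for x
    unfolding g_def using f(1) that by (rule bij_betw_inv_into_left)
  have "g \<in> algebra_iso B A"
    unfolding algebra_iso_def
  proof (intro CollectI conjI ballI allI)
    show "bij_betw g (carrier B) (carrier A)" unfolding g_def by (rule bij_betw_inv_into[OF f(1)])
  next
    fix x y assume xy: "x \<in> carrier B" "y \<in> carrier B"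
    show "g (x \<oplus>\<^bsub>B\<^esub> y) = g x \<oplus>\<^bsub>A\<^esub> g y"
      using gf[of "g x \<oplus>\<^bsub>A\<^esub> g y"] f(2)[of "g x" "g y"] xy by (simp add: gA fg)
    show "g (x \<otimes>\<^bsub>B\<^esub> y) = g x \<otimes>\<^bsub>A\<^esub> g y"
      using gf[of "g x \<otimes>\<^bsub>A\<^esub> g y"] f(3)[of "g x" "g y"] xy by (simp add: gA fg m_closed)
  next
    fix c x assume x: "x \<in> carrier B"
    show "g (c \<odot>\<^bsub>B\<^esub> x) = c \<odot>\<^bsub>A\<^esub> g x"
      using gf[of "c \<odot>\<^bsub>A\<^esub> g x"] f(4)[of "g x" c] x by (simp add: gA fg smult_closed)
  qed
  then show ?thesis unfolding algebra_isomorphic_def by blast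
qed

theorem theorem5p4:
  shows
    "(\<forall>\<kappa> :: 'o rel. Well_order \<kappa> \<longrightarrow> uncountable_cofinality \<kappa> \<longrightarrow>
        prime_ring (leavitt_path_algebra TYPE('k::field) (ordinal_digraph \<kappa>)) \<and>
        \<not> left_primitive_ring TYPE('m) (leavitt_path_algebra TYPE('k) (ordinal_digraph \<kappa>)) \<and>
        von_neumann_regular_ring (leavitt_path_algebra TYPE('k) (ordinal_digraph \<kappa>))) \<and>
     (\<forall>(\<A> :: 'i set) (\<kappa> :: 'i \<Rightarrow> 'o rel).
        (\<forall>\<alpha>\<in>\<A>. Well_order (\<kappa> \<alpha>) \<and> uncountable (Field (\<kappa> \<alpha>)) \<and>
                 uncountable_cofinality (\<kappa> \<alpha>)) \<longrightarrow>
        pairwise (\<lambda>\<alpha> \<beta>. \<not> Field (\<kappa> \<alpha>) \<approx> Field (\<kappa> \<beta>)) \<A> \<longrightarrow>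
        (\<forall>\<alpha>\<in>\<A>.
           nonunital_algebra (leavitt_path_algebra TYPE(complex) (ordinal_digraph (\<kappa> \<alpha>))) \<and>
           prime_ring (leavitt_path_algebra TYPE(complex) (ordinal_digraph (\<kappa> \<alpha>))) \<and>
           \<not> left_primitive_ring TYPE('m)
               (leavitt_path_algebra TYPE(complex) (ordinal_digraph (\<kappa> \<alpha>))) \<and>
           von_neumann_regular_ring
             (leavitt_path_algebra TYPE(complex) (ordinal_digraph (\<kappa> \<alpha>)))) \<and>
        pairwise (\<lambda>\<alpha> \<beta>. \<not> algebra_isomorphic
             (leavitt_path_algebra TYPE(complex) (ordinal_digraph (\<kappa> \<alpha>)))
             (leavitt_path_algebra TYPE(complex) (ordinal_digraph (\<kappa> \<beta>)))) \<A>)"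
proof (intro conjI allI impI ballI pairwiseI)
  fix \<kappa> :: "'o rel" assume "Well_order \<kappa>" "uncountable_cofinality \<kappa>"
  then interpret ordinal_lpa \<kappa> "TYPE('k)" by unfold_locales auto
  show "prime_ring LPA" "\<not> left_primitive_ring TYPE('m) LPA" "von_neumann_regular_ring LPA"
    by (rule LPA_prime LPA_not_primitive LPA_regular)+
next
  fix \<A> :: "'i set" and \<kappa> :: "'i \<Rightarrow> 'o rel" and \<alpha>
  assume "\<forall>\<alpha>\<in>\<A>. Well_order (\<kappa> \<alpha>) \<and> uncountable (Field (\<kappa> \<alpha>)) \<and> uncountable_cofinality (\<kappa> \<alpha>)"
    and "\<alpha> \<in> \<A>"
  then interpret ordinal_lpa "\<kappa> \<alpha>" "TYPE(complex)" by unfold_locales auto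
  show "nonunital_algebra LPA" "prime_ring LPA" "\<not> left_primitive_ring TYPE('m) LPA"
    "von_neumann_regular_ring LPA"
    by (rule LPA_algebra LPA_prime LPA_not_primitive LPA_regular)+
next
  fix \<A> :: "'i set" and \<kappa> :: "'i \<Rightarrow> 'o rel" and \<alpha> \<beta>
  assume \<kappa>: "\<forall>\<alpha>\<in>\<A>. Well_order (\<kappa> \<alpha>) \<and> uncountable (Field (\<kappa> \<alpha>)) \<and> uncountable_cofinality (\<kappa> \<alpha>)"
    and card: "pairwise (\<lambda>\<alpha> \<beta>. \<not> Field (\<kappa> \<alpha>) \<approx> Field (\<kappa> \<beta>)) \<A>"
    and \<alpha>\<beta>: "\<alpha> \<in> \<A>" "\<beta> \<in> \<A>" "\<alpha> \<noteq> \<beta>"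
  let ?L = "\<lambda>\<alpha>. leavitt_path_algebra TYPE(complex) (ordinal_digraph (\<kappa> \<alpha>))"
  interpret ordinal_lpa "\<kappa> \<alpha>" "TYPE(complex)" using \<kappa> \<alpha>\<beta> by unfold_locales auto
  have wo: "Well_order (\<kappa> \<gamma>)" "uncountable_cofinality (\<kappa> \<gamma>)" "infinite (Field (\<kappa> \<gamma>))"
    if "\<gamma> \<in> \<A>" for \<gamma>
    using \<kappa> that countable_finite by blast+
  show "\<not> algebra_isomorphic (?L \<alpha>) (?L \<beta>)"
  proof
    assume iso: "algebra_isomorphic (?L \<alpha>) (?L \<beta>)"
    note iso' = algebra_isomorphic_sym[OF LPA_algebra iso]
    have "lepoll (Field (\<kappa> \<alpha>)) (Field (\<kappa> \<beta>))"
      using LPA_isomorphic_imp_lepoll[OF wo(1,2)[OF \<alpha>\<beta>(1)] wo[OF \<alpha>\<beta>(2)] iso] .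
    moreover have "lepoll (Field (\<kappa> \<beta>)) (Field (\<kappa> \<alpha>))"
      using LPA_isomorphic_imp_lepoll[OF wo(1,2)[OF \<alpha>\<beta>(2)] wo[OF \<alpha>\<beta>(1)] iso'] .
    ultimately have "Field (\<kappa> \<alpha>) \<approx> Field (\<kappa> \<beta>)" by (rule lepoll_antisym)
    then show False using card \<alpha>\<beta> by (simp add: pairwise_def)
  qed
qed

end
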